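(* For $|q|<1$ the following four identities hold: $$\sum_{n=0}^\infty \frac{(q;q^2)_n(-q^2;q^4)_n}{(q^4;q^4)_n(-q^3;q^6)_n(1+q^{2n+1})}(-1)^nq^{n^2+2n}=\frac{J_{12}J_{1,12}J_{3,12}J_{10,24}}{J_{2,12}J_6^2J_8},$$ $$\sum_{n=0}^\infty \frac{(q;q^2)_n(-q^2;q^4)_n}{(q^4;q^4)_n(-q^3;q^6)_{n+1}}(-1)^nq^{n^2+4n}=\frac{J_{12}J_{3,12}J_{5,12}J_{2,24}}{J_{2,12}J_6^2J_8},$$ $$\sum_{n=0}^\infty \frac{(-q;q)_n(-q^2;q^2)_n}{(q;q^2)_{n+1}(q^3;q^3)_{n+1}}q^{(n^2+5n)/2}=\frac{J_8J_{12}^5J_{2,24}}{J_4J_6J_{1,12}J_{2,12}J_{3,12}^2J_{5,12}},$$ $$\sum_{n=1}^\infty \frac{(-q;q)_{n-1}(-q^2;q^2)_{n-1}}{(q^3;q^3)_{n-1}(q;q^2)_n (1-q^n)}q^{n(n+1)/2}=\frac14\left(\frac{J_2^3J_6^3}{J_1^2J_3^2J_4J_{12}}+\frac{2J_4^3J_6}{J_1J_2J_3J_{12}}-3\right).$$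
   Context: Here $q$ is a complex number with $|q|<1$. For a base $p$ with $|p|<1$: $(a;p)_\infty=\prod_{k\ge 0}(1-ap^k)$, $(a;p)_n=\prod_{k=0}^{n-1}(1-ap^k)$ for integers $n\ge 0$, and $(a_1,\dots,a_m;p)_\infty=(a_1;p)_\infty\cdots(a_m;p)_\infty$. Notation: $J_m:=(q^m;q^m)_\infty$ and $J_{a,m}:=(q^a,q^{m-a},q^m;q^m)_\infty$. *)

theory Defs
  imports "HOL-Analysis.Analysis"
begin

definition qpoch :: "complex \<Rightarrow> complex \<Rightarrow> nat \<Rightarrow> complex" where
  "qpoch a p n = (\<Prod>k<n. 1 - a * p ^ k)"

(* The infinite product converges for norm p < 1, including when some factors vanish. *)
definition qpoch_inf :: "complex \<Rightarrow> complex \<Rightarrow> complex" where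
  "qpoch_inf a p = (\<Prod>k. 1 - a * p ^ k)"

definition J :: "complex \<Rightarrow> nat \<Rightarrow> complex" where
  "J q m = qpoch_inf (q ^ m) (q ^ m)"

(* Intended for 0 < a < m, so that the subtraction of naturals does not truncate. *)
definition J2 :: "complex \<Rightarrow> nat \<Rightarrow> nat \<Rightarrow> complex" where
  "J2 q a m = qpoch_inf (q ^ a) (q ^ m) * qpoch_inf (q ^ (m - a)) (q ^ m) * qpoch_inf (q ^ m) (q ^ m)"

end

theory Submission
  imports Defs
begin

text \<open>
  Each of the four series is a combination of members of four one-parameter families of series.
  A member \<open>S x\<close> of such a family satisfies a first-order relation \<open>S x = c x * S (x * \<rho>)\<close>, found by
  creative telescoping in the summation index; letting the parameter tend to \<open>0\<close> turns it into an
  infinite product. With \<open>A\<close>, \<open>B\<close> the first two sums, the families give \<open>A + q B\<close> and \<open>A - q B\<close>; with \<open>C\<close>, \<open>D\<close>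
  the last two, they give \<open>3 + 4 D\<close> and \<open>1 + 4 q^2 C\<close> as combinations of two eta quotients.
  What remains are theta function identities: \<open>J_{1,12} J_{10,24} + q J_{5,12} J_{2,24}\<close> and
  \<open>J_{1,12} J_{10,24} - q J_{5,12} J_{2,24}\<close> are evaluated by the quintuple product, and their difference
  at \<open>-q^2\<close>, together with a two-dissection of \<open>J_1 J_3\<close>, gives the third sum.
\<close>

text \<open>Put \<open>z = q^(2n+1)\<close> and \<open>y = q^(n+1)\<close>. Since
  \<open>1 + z\<close> divides \<open>1 + z^3\<close> with quotient \<open>1 - z + z^2\<close>, and
  \<open>1 - y\<close> divides \<open>1 - y^3\<close> with quotient \<open>1 + y + y^2\<close>, the
  first two sums carry, relative to a common summand, the weights \<open>1 - z + z^2\<close> and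
  (after a factor \<open>q\<close>) \<open>z\<close>; the last two carry, up to powers of
  \<open>q\<close>, \<open>y\<close> and \<open>1 + y + y^2\<close>. The combinations that embed
  into families are those with the weights \<open>1 + z^2\<close>, \<open>(1 - z)^2\<close>,
  \<open>1 + y^2\<close>, \<open>(1 + y)^2\<close>. In each family the parameter step moves every
  factor containing the parameter by whole steps of the summation index. Two members can then be
  written over one common term ratio, and only a rational identity in \<open>X = q^n\<close>
  remains. The obstacle is the limit at parameter 0. For the families of the last two sums it is an
  Euler series, hence a product. For the other two it is left unevaluated and eliminated by means of
  a second member whose value is known: at \<open>x = - q^2\<close> the series terminates, at
  \<open>b = q^12\<close> it telescopes to a boundary term.\<close>

section \<open>Infinite products\<close>

lemma qpoch_0 [simp]: "qpoch a p 0 = 1"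
  by (simp add: qpoch_def)

lemma qpoch_Suc: "qpoch a p (Suc n) = qpoch a p n * (1 - a * p ^ n)"
  by (simp add: qpoch_def)

lemma qpoch_add: "qpoch a p (n + m) = qpoch a p n * (\<Prod>j<m. 1 - a * p ^ (n + j))"
  by (induction m) (simp_all add: qpoch_Suc mult.assoc)

lemma one_minus_power_neq_0:
  fixes q :: complex
  assumes "norm q < 1" "n > 0"
  shows "1 - q ^ n \<noteq> 0"
proof
  assume "1 - q ^ n = 0"
  hence "q ^ n = 1"
    by simp
  hence "norm (q ^ n) = 1"
    by simp
  moreover have "norm q ^ n < 1"
    using assms by (simp add: power_less_one_iff)
  ultimately show False
    by (simp add: norm_power)
qed

lemma abs_convergent_qpoch:
  fixes a p :: complex
  assumes "norm p < 1"
  shows "abs_convergent_prod (\<lambda>k. 1 - a * p ^ k)"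
proof (rule summable_imp_abs_convergent_prod)
  have "summable (\<lambda>k. norm a * norm p ^ k)"
    using assms by (intro summable_mult summable_geometric) auto
  thus "summable (\<lambda>k. norm (1 - a * p ^ k - 1))"
    by (simp add: norm_mult norm_power)
qed

lemma qpoch_tendsto:
  assumes "norm p < 1"
  shows "(\<lambda>n. qpoch a p n) \<longlonglongrightarrow> qpoch_inf a p"
proof -
  have "(\<lambda>n. \<Prod>k\<le>n. 1 - a * p ^ k) \<longlonglongrightarrow> qpoch_inf a p"
    unfolding qpoch_inf_def
    by (intro convergent_prod_LIMSEQ abs_convergent_prod_imp_convergent_prod
        abs_convergent_qpoch assms)
  hence "(\<lambda>n. qpoch a p (Suc n)) \<longlonglongrightarrow> qpoch_inf a p"
    by (simp add: qpoch_def lessThan_Suc_atMost)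
  thus ?thesis
    by (rule LIMSEQ_imp_Suc)
qed

lemma qpoch_inf_nonzero:
  assumes "norm p < 1" "\<And>k. a * p ^ k \<noteq> 1"
  shows "qpoch_inf a p \<noteq> 0"
  unfolding qpoch_inf_def using assms
  by (intro prodinf_nonzero abs_convergent_prod_imp_convergent_prod abs_convergent_qpoch) auto

lemma qpoch_inf_nonzero':
  assumes "norm p < 1" "norm a < 1"
  shows "qpoch_inf a p \<noteq> 0"
proof (rule qpoch_inf_nonzero)
  fix k
  have "norm (a * p ^ k) \<le> norm a * 1"
    unfolding norm_mult norm_power
    using assms by (intro mult_left_mono power_le_one) auto
  hence "norm (a * p ^ k) < 1"
    using assms by simp
  thus "a * p ^ k \<noteq> 1" by auto
qed (use assms in auto)

lemma qpoch_inf_unfold: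
  assumes "norm p < 1"
  shows "qpoch_inf a p = (1 - a) * qpoch_inf (a * p) p"
proof (rule LIMSEQ_unique)
  show "(\<lambda>n. qpoch a p (Suc n)) \<longlonglongrightarrow> qpoch_inf a p"
    using qpoch_tendsto[OF assms] by (rule LIMSEQ_Suc)
  have "qpoch a p (Suc n) = (1 - a) * qpoch (a * p) p n" for n
    unfolding qpoch_def by (subst prod.lessThan_Suc_shift) (simp add: mult.assoc)
  thus "(\<lambda>n. qpoch a p (Suc n)) \<longlonglongrightarrow> (1 - a) * qpoch_inf (a * p) p"
    by (simp add: tendsto_mult_left qpoch_tendsto[OF assms])
qed

text \<open>Grouping the factors by the residue of the exponent modulo \<open>m\<close> is exact for
  partial products of length \<open>n * m\<close>, and these form a subsequence of the convergent
  partial products.\<close>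

lemma qpoch_inf_split:
  assumes "norm p < 1" "m > 0"
  shows "qpoch_inf a p = (\<Prod>j<m. qpoch_inf (a * p ^ j) (p ^ m))"
proof (rule LIMSEQ_unique)
  have pm: "norm (p ^ m) < 1"
    using assms by (simp add: norm_power power_less_one_iff)
  have "qpoch a p (n * m) = (\<Prod>j<m. qpoch (a * p ^ j) (p ^ m) n)" for n
  proof (induction n)
    case (Suc n)
    have "qpoch a p (Suc n * m) = qpoch a p (n * m) * (\<Prod>j<m. 1 - a * p ^ (n * m + j))"
      using qpoch_add[of a p "n * m" m] by (simp add: add.commute)
    also have "(\<Prod>j<m. 1 - a * p ^ (n * m + j)) = (\<Prod>j<m. 1 - a * p ^ j * (p ^ m) ^ n)"
      by (intro prod.cong) (auto simp: power_add power_mult[symmetric] mult_ac)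
    finally show ?case
      by (simp only: Suc qpoch_Suc prod.distrib)
  qed simp
  moreover have "(\<lambda>n. \<Prod>j<m. qpoch (a * p ^ j) (p ^ m) n) \<longlonglongrightarrow> (\<Prod>j<m. qpoch_inf (a * p ^ j) (p ^ m))"
    by (intro tendsto_prod qpoch_tendsto pm)
  ultimately show "(\<lambda>n. qpoch a p (n * m)) \<longlonglongrightarrow> (\<Prod>j<m. qpoch_inf (a * p ^ j) (p ^ m))"
    by simp
  have "strict_mono (\<lambda>n. n * m)"
    using assms by (simp add: strict_mono_def)
  thus "(\<lambda>n. qpoch a p (n * m)) \<longlonglongrightarrow> qpoch_inf a p"
    using LIMSEQ_subseq_LIMSEQ[OF qpoch_tendsto[OF assms(1)]] by (auto simp: o_def)
qed

lemma qpoch_inf_square: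
  assumes "norm p < 1"
  shows "qpoch_inf (a\<^sup>2) (p\<^sup>2) = qpoch_inf a p * qpoch_inf (- a) p"
proof (rule LIMSEQ_unique)
  have "norm (p\<^sup>2) < 1"
    using assms by (simp add: norm_power power_less_one_iff)
  thus "(\<lambda>n. qpoch (a\<^sup>2) (p\<^sup>2) n) \<longlonglongrightarrow> qpoch_inf (a\<^sup>2) (p\<^sup>2)"
    by (rule qpoch_tendsto)
  have "qpoch (a\<^sup>2) (p\<^sup>2) n = qpoch a p n * qpoch (- a) p n" for n
    unfolding qpoch_def prod.distrib[symmetric]
    by (intro prod.cong) (auto simp: algebra_simps power2_eq_square power_mult_distrib)
  thus "(\<lambda>n. qpoch (a\<^sup>2) (p\<^sup>2) n) \<longlonglongrightarrow> qpoch_inf a p * qpoch_inf (- a) p"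
    by (simp add: tendsto_mult qpoch_tendsto assms)
qed

section \<open>Series of quotient type\<close>

text \<open>The quadratic exponent of \<open>r\<close> beats any geometric growth
  \<open>C ^ n\<close>: the quotient \<open>C * r ^ n\<close> of consecutive terms drops below 1/2.
  This is the majorant for all series whose terms are products of ratios of size
  \<open>C * r ^ k\<close>.\<close>

lemma summable_pow_gauss:
  fixes C r :: real
  assumes "0 \<le> C" "0 \<le> r" "r < 1"
  shows "summable (\<lambda>n. C ^ n * r ^ (n * (n - 1) div 2))"
proof -
  have lim: "(\<lambda>n. C * r ^ n) \<longlonglongrightarrow> 0"
    using tendsto_mult_left[OF LIMSEQ_realpow_zero[OF assms(2,3)], of C] by simp
  have "eventually (\<lambda>n. C * r ^ n < 1/2) sequentially"
    using order_tendstoD(2)[OF lim, of "1/2"] by simp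
  then obtain N where N: "\<And>n. n \<ge> N \<Longrightarrow> C * r ^ n < 1/2"
    by (auto simp: eventually_at_top_linorder)
  show ?thesis
  proof (rule summable_ratio_test[where c = "1/2" and N = N])
    fix n assume "n \<ge> N"
    have "Suc n * (Suc n - 1) div 2 = n * (n - 1) div 2 + n"
    proof -
      have "Suc n * (Suc n - 1) = n * (n - 1) + 2 * n"
        by (cases n) (auto simp: algebra_simps)
      thus ?thesis by simp
    qed
    hence "C ^ Suc n * r ^ (Suc n * (Suc n - 1) div 2)
        = (C * r ^ n) * (C ^ n * r ^ (n * (n - 1) div 2))"
      by (simp add: power_add)
    also have "\<dots> \<le> 1/2 * (C ^ n * r ^ (n * (n - 1) div 2))"
      using N[OF \<open>n \<ge> N\<close>] assms by (intro mult_right_mono) auto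
    finally show "norm (C ^ Suc n * r ^ (Suc n * (Suc n - 1) div 2))
        \<le> 1/2 * norm (C ^ n * r ^ (n * (n - 1) div 2))"
      using assms by (simp only: real_norm_def abs_of_nonneg mult_nonneg_nonneg zero_le_power)
  qed simp
qed

lemma norm_prod_gauss_bound:
  fixes f :: "nat \<Rightarrow> complex"
  assumes "\<And>k. norm (f k) \<le> C * r ^ k" "0 \<le> r"
  shows "norm (\<Prod>k<n. f k) \<le> C ^ n * r ^ (n * (n - 1) div 2)"
proof -
  have "norm (\<Prod>k<n. f k) = (\<Prod>k<n. norm (f k))"
    by (rule prod_norm[symmetric])
  also have "\<dots> \<le> (\<Prod>k<n. C * r ^ k)"
    by (intro prod_mono) (auto simp: assms)
  also have "\<dots> = C ^ n * r ^ (\<Sum>k<n. k)"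
    by (simp add: prod.distrib power_sum)
  also have "(\<Sum>k<n. k) = n * (n - 1) div 2"
    by (simp add: Sum_Ico_nat lessThan_atLeast0)
  finally show ?thesis .
qed

lemma has_prod_type_series:
  fixes f :: "nat \<Rightarrow> complex" and W :: "nat \<Rightarrow> complex"
  assumes "\<And>k. norm (f k) \<le> C * r ^ k" "0 \<le> C" "0 \<le> r" "r < 1" "\<And>n. norm (W n) \<le> B"
  shows "summable (\<lambda>n. norm ((\<Prod>k<n. f k) * W n))"
proof (rule summable_comparison_test')
  show "summable (\<lambda>n. C ^ n * r ^ (n * (n - 1) div 2) * B)"
    using summable_pow_gauss[OF assms(2-4)] by (rule summable_mult2)
  show "norm (norm ((\<Prod>k<n. f k) * W n)) \<le> C ^ n * r ^ (n * (n - 1) div 2) * B" for n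
  proof -
    have "norm ((\<Prod>k<n. f k) * W n) \<le> C ^ n * r ^ (n * (n - 1) div 2) * B"
      unfolding norm_mult
    proof (rule mult_mono)
      show "norm (\<Prod>k<n. f k) \<le> C ^ n * r ^ (n * (n - 1) div 2)"
        using assms(1,3) by (rule norm_prod_gauss_bound)
      show "norm (W n) \<le> B"
        by (rule assms)
    qed (simp_all add: assms(2,3))
    thus ?thesis by simp
  qed
qed

text \<open>Tannery's theorem, with a majorant that does not depend on \<open>j\<close>. It carries
  out the passage of a family to the parameter 0.\<close>

lemma suminf_prod_tendsto:
  fixes f :: "nat \<Rightarrow> nat \<Rightarrow> complex"
  assumes bd: "\<And>j k. norm (f j k) \<le> C * r ^ k" "0 \<le> C" "0 \<le> r" "r < 1"
    and W: "\<And>j n. norm (W j n) \<le> B"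
    and lim: "\<And>k. (\<lambda>j. f j k) \<longlonglongrightarrow> f' k" "\<And>n. (\<lambda>j. W j n) \<longlonglongrightarrow> W' n"
  shows "(\<lambda>j. \<Sum>n. (\<Prod>k<n. f j k) * W j n) \<longlonglongrightarrow> (\<Sum>n. (\<Prod>k<n. f' k) * W' n)"
proof -
  have "eventually (\<lambda>j. summable (\<lambda>n. norm ((\<Prod>k<n. f j k) * W j n))) sequentially \<and>
    summable (\<lambda>n. norm ((\<Prod>k<n. f' k) * W' n)) \<and>
    ((\<lambda>j. \<Sum>n. (\<Prod>k<n. f j k) * W j n) \<longlongrightarrow> (\<Sum>n. (\<Prod>k<n. f' k) * W' n)) sequentially"
  proof (rule tannerys_theorem)
    show "((\<lambda>j. (\<Prod>k<n. f j k) * W j n) \<longlongrightarrow> (\<Prod>k<n. f' k) * W' n) sequentially" for n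
      by (intro tendsto_mult tendsto_prod lim)
    show "eventually (\<lambda>(n, j). norm ((\<Prod>k<n. f j k) * W j n) \<le> C ^ n * r ^ (n * (n - 1) div 2) * B)
            (at_top \<times>\<^sub>F sequentially)"
    proof (intro always_eventually allI, safe)
      fix n j
      show "norm ((\<Prod>k<n. f j k) * W j n) \<le> C ^ n * r ^ (n * (n - 1) div 2) * B"
        unfolding norm_mult
      proof (rule mult_mono)
        show "norm (\<Prod>k<n. f j k) \<le> C ^ n * r ^ (n * (n - 1) div 2)"
          using bd(1,3) by (rule norm_prod_gauss_bound)
        show "norm (W j n) \<le> B"
          by (rule W)
      qed (simp_all add: bd(2,3))
    qed
    show "summable (\<lambda>n. C ^ n * r ^ (n * (n - 1) div 2) * B)"
      using summable_pow_gauss[OF bd(2-4)] by (rule summable_mult2)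
  qed simp
  thus ?thesis by blast
qed

lemma sums_telescope_eq:
  fixes u v g :: "nat \<Rightarrow> complex"
  assumes "u sums U" "v sums V" "\<And>n. u n - v n = g (Suc n) - g n" "g 0 = G" "g \<longlonglongrightarrow> 0"
  shows "U - V = - G"
proof -
  have "(\<lambda>n. g (Suc n) - g n) sums (0 - g 0)"
    using assms(5) by (rule telescope_sums)
  moreover have "(\<lambda>n. g (Suc n) - g n) sums (U - V)"
    using sums_diff[OF assms(1,2)] assms(3) by simp
  ultimately have "0 - g 0 = U - V"
    by (rule sums_unique2)
  thus ?thesis
    using assms(4) by simp
qed

lemma iterate_first_order:
  fixes S c :: "nat \<Rightarrow> complex"
  assumes "\<And>j. S j = c j * S (Suc j)" "S \<longlonglongrightarrow> L" "(\<lambda>n. \<Prod>j<n. c j) \<longlonglongrightarrow> P"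
  shows "S 0 = P * L"
proof -
  have "S 0 = (\<Prod>j<n. c j) * S n" for n
  proof (induction n)
    case (Suc n)
    thus ?case
      using assms(1)[of n] by (simp only: prod.lessThan_Suc mult.assoc)
  qed simp
  moreover have "(\<lambda>n. (\<Prod>j<n. c j) * S n) \<longlonglongrightarrow> P * L"
    by (intro tendsto_mult assms)
  ultimately have "(\<lambda>n. S 0) \<longlonglongrightarrow> P * L"
    by simp
  thus ?thesis
    by (simp add: LIMSEQ_const_iff)
qed

lemma isCont_qpower_tendsto:
  fixes w :: "complex \<Rightarrow> complex"
  assumes "norm q < 1" "isCont w 0"
  shows "(\<lambda>n. w (q ^ n)) \<longlonglongrightarrow> w 0"
  using assms by (intro isCont_tendsto_compose[OF assms(2)] LIMSEQ_power_zero)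

text \<open>Ratios and weights are rational in \<open>X\<close> and are only evaluated at the points
  \<open>q ^ n\<close>, which tend to 0. Continuity at the single point 0 therefore gives both the
  limit and a bound.\<close>

lemma isCont_qpower_bounded:
  fixes w :: "complex \<Rightarrow> complex"
  assumes "norm q < 1" "isCont w 0"
  obtains C where "0 \<le> C" "\<And>n. norm (w (q ^ n)) \<le> C"
proof -
  have "Bseq (\<lambda>n. w (q ^ n))"
    using isCont_qpower_tendsto[OF assms] by (intro convergent_imp_Bseq convergentI)
  then obtain C where "C > 0" "\<And>n. norm (w (q ^ n)) \<le> C"
    by (auto elim: BseqE)
  thus ?thesis using that[of C] by auto
qed

lemma qseries_summable:
  fixes \<rho> w :: "complex \<Rightarrow> complex"
  assumes "norm q < 1" "isCont \<rho> 0" "isCont w 0"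
  shows "summable (\<lambda>n. norm ((\<Prod>k<n. \<rho> (q ^ k) * q ^ k) * w (q ^ n)))"
proof -
  obtain C where C: "0 \<le> C" "\<And>n. norm (\<rho> (q ^ n)) \<le> C"
    using isCont_qpower_bounded[OF assms(1,2)] by blast
  obtain B where B: "\<And>n. norm (w (q ^ n)) \<le> B"
    using isCont_qpower_bounded[OF assms(1,3)] by blast
  show ?thesis
  proof (rule has_prod_type_series)
    show "norm (\<rho> (q ^ k) * q ^ k) \<le> C * norm q ^ k" for k
      using C(2)[of k] by (simp add: norm_mult norm_power mult_right_mono)
    show "norm (w (q ^ n)) \<le> B" for n
      by (rule B)
  qed (use assms C in auto)
qed

text \<open>With \<open>T n\<close> the product of the ratios,
  \<open>T (n + 1) * G (q ^ (n + 1))\<close> equals \<open>T n * \<rho> X * X * G (q * X)\<close> at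
  \<open>X = q ^ n\<close>. So \<open>eq\<close> times \<open>T n\<close> is a telescoping identity,
  and a claim about sums is reduced to a rational identity in \<open>X\<close> with certificate
  \<open>G\<close>. The only boundary contribution comes from \<open>n = 0\<close>, that is
  \<open>X = 1\<close>.\<close>

lemma qseries_telescope:
  fixes \<rho> v w G :: "complex \<Rightarrow> complex"
  assumes "norm q < 1" "isCont \<rho> 0" "isCont v 0" "isCont w 0" "isCont G 0"
    and eq: "\<And>n. v (q ^ n) - w (q ^ n) = \<rho> (q ^ n) * q ^ n * G (q * q ^ n) - G (q ^ n)"
    and G1: "G 1 = g"
  shows "(\<Sum>n. (\<Prod>k<n. \<rho> (q ^ k) * q ^ k) * v (q ^ n))
       - (\<Sum>n. (\<Prod>k<n. \<rho> (q ^ k) * q ^ k) * w (q ^ n)) = - g"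
proof (rule sums_telescope_eq)
  let ?T = "\<lambda>n. \<Prod>k<n. \<rho> (q ^ k) * q ^ k"
  let ?g = "\<lambda>n. ?T n * G (q ^ n)"
  show "(\<lambda>n. ?T n * v (q ^ n)) sums (\<Sum>n. ?T n * v (q ^ n))"
       "(\<lambda>n. ?T n * w (q ^ n)) sums (\<Sum>n. ?T n * w (q ^ n))"
    by (rule summable_sums[OF summable_norm_cancel[OF qseries_summable]]; fact)+
  show "?g \<longlonglongrightarrow> 0"
    by (rule summable_LIMSEQ_zero[OF summable_norm_cancel[OF qseries_summable[OF assms(1,2,5)]]])
  show "?T n * v (q ^ n) - ?T n * w (q ^ n) = ?g (Suc n) - ?g n" for n
    using arg_cong[OF eq[of n], of "\<lambda>z. ?T n * z"] by (simp add: algebra_simps)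
qed (simp add: G1)

text \<open>A change of term ratio: if \<open>r\<close> and \<open>e\<close> differ by the quotient
  \<open>\<phi> (k + 1) / \<phi> k\<close>, their products differ by \<open>\<phi>\<close> alone.
  Two members of a family are brought over one ratio \<open>e\<close> in this way. The division-free
  form allows zeros of \<open>\<phi>\<close>.\<close>

lemma prod_gauge:
  fixes r e \<phi> :: "nat \<Rightarrow> complex"
  assumes "\<And>k. r k * \<phi> k = e k * \<phi> (Suc k)"
  shows "(\<Prod>k<n. r k) * \<phi> 0 = (\<Prod>k<n. e k) * \<phi> n"
proof (induction n)
  case (Suc n)
  have "(\<Prod>k<Suc n. r k) * \<phi> 0 = r n * ((\<Prod>k<n. r k) * \<phi> 0)"
    by simp
  also have "\<dots> = r n * ((\<Prod>k<n. e k) * \<phi> n)"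
    by (simp only: Suc)
  also have "\<dots> = (\<Prod>k<n. e k) * (r n * \<phi> n)"
    by (simp only: mult_ac)
  also have "\<dots> = (\<Prod>k<n. e k) * (e n * \<phi> (Suc n))"
    by (simp only: assms)
  finally show ?case
    by (simp add: mult.assoc)
qed simp

section \<open>Denominators on the unit disc: nonvanishing and uniform lower bounds\<close>

lemma norm_one_minus_ge:
  fixes q u :: complex
  assumes "norm u \<le> 1"
  shows "1 - norm q \<le> norm (1 - q * u)"
proof -
  have "norm (q * u) \<le> norm q"
    using assms by (simp add: norm_mult mult_left_le)
  moreover have "1 - norm (q * u) \<le> norm (1 - q * u)"
    using norm_triangle_ineq2[of 1 "q * u"] by simp
  ultimately show ?thesis by linarith
qed

lemma one_minus_mult_neq_0:
  fixes q u :: complex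
  assumes "norm q < 1" "norm u \<le> 1"
  shows "1 - q * u \<noteq> 0"
proof
  assume "1 - q * u = 0"
  thus False
    using norm_one_minus_ge[OF assms(2), of q] assms(1) by simp
qed

text \<open>With \<open>z = q * u\<close> the quantity is \<open>(1 - z^3) / (1 - z)\<close>; the
  numerator is bounded below by the previous bound and \<open>|1 - z|\<close> is at most 2.\<close>

lemma norm_cyclotomic3_ge:
  fixes q u :: complex
  assumes "norm q < 1" "norm u \<le> 1"
  shows "(1 - norm q) / 2 \<le> norm (1 + q * u + (q * u)\<^sup>2)"
proof -
  have "1 - norm q \<le> norm (1 - q * (q\<^sup>2 * u ^ 3))"
    by (rule norm_one_minus_ge)
      (use assms in \<open>simp add: norm_mult norm_power mult_le_one power_le_one\<close>)
  also have "1 - q * (q\<^sup>2 * u ^ 3) = (1 + q * u + (q * u)\<^sup>2) * (1 - q * u)"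
    by algebra
  also have "norm \<dots> \<le> norm (1 + q * u + (q * u)\<^sup>2) * 2"
    unfolding norm_mult
  proof (rule mult_left_mono)
    have "norm (q * u) \<le> 1"
      using assms by (simp add: norm_mult mult_le_one)
    thus "norm (1 - q * u) \<le> 2"
      using norm_triangle_ineq4[of 1 "q * u"] by simp
  qed simp
  finally show ?thesis by simp
qed

lemma cyclotomic3_neq_0:
  fixes q u :: complex
  assumes "norm q < 1" "norm u \<le> 1"
  shows "1 + q * u + (q * u)\<^sup>2 \<noteq> 0"
proof
  assume "1 + q * u + (q * u)\<^sup>2 = 0"
  thus False
    using norm_cyclotomic3_ge[OF assms] assms(1) by simp
qed

lemma norm_power_le_one [simp]:
  fixes q :: complex
  assumes "norm q < 1"
  shows "norm (q ^ n) \<le> 1"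
  using assms by (simp add: norm_power power_le_one)

lemma norm_divide_le:
  fixes x y :: complex
  assumes "norm x \<le> a" "b \<le> norm y" "0 < b"
  shows "norm (x / y) \<le> a / b"
  unfolding norm_divide
  by (rule frac_le[OF order_trans[OF norm_ge_zero assms(1)] assms(1,3,2)])

lemma norm_mult_power_le:
  fixes a q :: complex
  assumes "norm a \<le> C"
  shows "norm (a * q ^ k) \<le> C * norm q ^ k"
  using assms by (simp add: norm_mult norm_power mult_right_mono)

section \<open>Euler's series\<close>

text \<open>The term is \<open>z^n q^(n(n-1)/2) / (q;q)_n\<close>, written as a product of ratios.
  The proof is the pattern for all later families: a first-order step in the parameter, iteration,
  and a limit at parameter 0, where only the term \<open>n = 0\<close> survives.\<close>

lemma euler_sums:
  fixes q z :: complex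
  assumes q: "norm q < 1"
  shows "(\<Sum>n. (\<Prod>k<n. z / (1 - q * q ^ k) * q ^ k)) = qpoch_inf (- z) q"
proof -
  define S where "S = (\<lambda>x::complex. \<Sum>n. (\<Prod>k<n. x / (1 - q * q ^ k) * q ^ k) * 1)"
  have nz: "1 - q * q ^ k \<noteq> 0" for k
    using q by (intro one_minus_mult_neq_0) auto
  have step: "S x = (1 + x) * S (x * q)" for x
  proof -
    let ?\<rho> = "\<lambda>X. x / (1 - q * X)"
    \<comment> \<open>The certificate \<open>X - 1\<close> vanishes at \<open>X = 1\<close>, hence
      the value 0 on the right.\<close>
    have tel: "(\<Sum>n. (\<Prod>k<n. ?\<rho> (q ^ k) * q ^ k) * 1)
       - (\<Sum>n. (\<Prod>k<n. ?\<rho> (q ^ k) * q ^ k) * ((1 + x) * q ^ n)) = - 0"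
      by (rule qseries_telescope[OF q, where v = "\<lambda>X. 1" and w = "\<lambda>X. (1 + x) * X" and G = "\<lambda>X. X - 1"])
        (use nz in \<open>auto intro!: continuous_intros simp: field_simps\<close>)
    have "(\<Prod>k<n. ?\<rho> (q ^ k) * q ^ k) * q ^ n = (\<Prod>k<n. x * q / (1 - q * q ^ k) * q ^ k)" for n
      by (induction n) (simp_all add: mult_ac)
    hence "S (x * q) = (\<Sum>n. (\<Prod>k<n. ?\<rho> (q ^ k) * q ^ k) * q ^ n)"
      by (simp add: S_def)
    moreover have "summable (\<lambda>n. (\<Prod>k<n. ?\<rho> (q ^ k) * q ^ k) * q ^ n)"
      using summable_norm_cancel[OF qseries_summable[OF q, of ?\<rho> "\<lambda>X. X"]]
      by (simp add: continuous_intros)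
    hence "(\<Sum>n. (\<Prod>k<n. ?\<rho> (q ^ k) * q ^ k) * ((1 + x) * q ^ n))
        = (1 + x) * (\<Sum>n. (\<Prod>k<n. ?\<rho> (q ^ k) * q ^ k) * q ^ n)"
      by (subst suminf_mult[symmetric]) (simp_all add: mult_ac)
    ultimately show ?thesis
      using tel by (simp add: S_def)
  qed
  have "S (z * q ^ 0) = qpoch_inf (- z) q * 1"
  proof (rule iterate_first_order)
    show "S (z * q ^ j) = (1 + z * q ^ j) * S (z * q ^ Suc j)" for j
      using step[of "z * q ^ j"] by (simp add: mult_ac)
    show "(\<lambda>n. \<Prod>j<n. 1 + z * q ^ j) \<longlonglongrightarrow> qpoch_inf (- z) q"
      using qpoch_tendsto[OF q, of "- z"] by (simp add: qpoch_def)
    have "(\<lambda>j. S (z * q ^ j)) \<longlonglongrightarrow> (\<Sum>n. (\<Prod>k<n. 0 * q ^ k) * 1)"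
      unfolding S_def
    proof (rule suminf_prod_tendsto[where C = "norm z / (1 - norm q)" and r = "norm q" and B = 1])
      fix j k
      have "norm (z * q ^ j / (1 - q * q ^ k)) \<le> norm z / (1 - norm q)"
        using q by (intro norm_divide_le norm_one_minus_ge)
          (simp_all add: norm_mult norm_power mult_left_le power_le_one)
      thus "norm (z * q ^ j / (1 - q * q ^ k) * q ^ k) \<le> norm z / (1 - norm q) * norm q ^ k"
        by (rule norm_mult_power_le)
      have "(\<lambda>j. z * q ^ j / (1 - q * q ^ k) * q ^ k) \<longlonglongrightarrow> z * 0 / (1 - q * q ^ k) * q ^ k"
        using q nz by (intro tendsto_intros LIMSEQ_power_zero) auto
      thus "(\<lambda>j. z * q ^ j / (1 - q * q ^ k) * q ^ k) \<longlonglongrightarrow> 0 * q ^ k"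
        by simp
    qed (use q in auto)
    moreover have "(\<Sum>n. (\<Prod>k<n. 0 * q ^ k) * 1) = (1 :: complex)"
    proof -
      have "(\<lambda>n. (\<Prod>k<n. 0 * q ^ k) * (1::complex)) sums (\<Sum>n\<in>{0}. (\<Prod>k<n. 0 * q ^ k) * 1)"
        by (rule sums_finite) auto
      thus ?thesis by (simp add: sums_iff)
    qed
    ultimately show "(\<lambda>j. S (z * q ^ j)) \<longlonglongrightarrow> 1" by simp
  qed
  thus ?thesis by (simp add: S_def)
qed

section \<open>The Jacobi triple product\<close>

text \<open>The coefficients satisfy \<open>(1 - p^n) c_n = c_(n-1)\<close>, which for the sum reads
  \<open>S y - S (y p) = y S y\<close>. Iterating moves the argument to 0, where the power series is
  continuous with value 1.\<close>

lemma euler_sums_inverse: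
  fixes p x :: complex
  assumes p: "norm p < 1" and x: "norm x < 1"
  shows "(\<lambda>n. x ^ n / qpoch p p n) sums (1 / qpoch_inf x p)"
    and "summable (\<lambda>n. norm (x ^ n / qpoch p p n))"
proof -
  define S where "S = (\<lambda>x::complex. \<Sum>n. 1 / qpoch p p n * x ^ n)"
  have nz: "qpoch p p n \<noteq> 0" for n
    using one_minus_power_neq_0[OF p, of "Suc k" for k] by (auto simp: qpoch_def)
  have "(\<lambda>n. 1 / qpoch p p n) \<longlonglongrightarrow> 1 / qpoch_inf p p"
    using p by (intro tendsto_intros qpoch_tendsto qpoch_inf_nonzero')
  then obtain C where C: "\<And>n. norm (1 / qpoch p p n) \<le> C"
    by (meson BseqE convergent_imp_Bseq convergentI)
  have abs: "summable (\<lambda>n. norm (1 / qpoch p p n * y ^ n))" if "norm y < 1" for y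
  proof (rule summable_comparison_test')
    show "summable (\<lambda>n. C * norm y ^ n)"
      using that by (intro summable_mult summable_geometric) simp
    show "norm (norm (1 / qpoch p p n * y ^ n)) \<le> C * norm y ^ n" for n
      using norm_mult_power_le[OF C[of n], of y n] by simp
  qed
  show "summable (\<lambda>n. norm (x ^ n / qpoch p p n))"
    using abs[OF x] by simp
  have summ: "summable (\<lambda>n. 1 / qpoch p p n * y ^ n)" if "norm y < 1" for y
    using abs[OF that] by (rule summable_norm_cancel)
  have step: "(1 - y) * S y = S (y * p)" if y: "norm y < 1" for y
  proof -
    have yp: "norm (y * p) < 1"
      using norm_mult_power_le[of y 1 p 1] y p by (simp add: norm_mult)
    have "S y - S (y * p) = (\<Sum>n. 1 / qpoch p p n * y ^ n - 1 / qpoch p p n * (y * p) ^ n)"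
      unfolding S_def by (intro suminf_diff summ y yp)
    \<comment> \<open>The term \<open>n = 0\<close> of the difference is
      \<open>1 - 1 = 0\<close>.\<close>
    also have "\<dots> = (\<Sum>n. 1 / qpoch p p (Suc n) * y ^ Suc n - 1 / qpoch p p (Suc n) * (y * p) ^ Suc n)"
      by (subst suminf_split_head[OF summable_diff[OF summ[OF y] summ[OF yp]]]) simp
    also have "\<dots> = (\<Sum>n. y * (1 / qpoch p p n * y ^ n))"
    proof (rule suminf_cong)
      fix n
      have "1 - p * p ^ n \<noteq> 0"
        using one_minus_power_neq_0[OF p, of "Suc n"] by simp
      thus "1 / qpoch p p (Suc n) * y ^ Suc n - 1 / qpoch p p (Suc n) * (y * p) ^ Suc n
          = y * (1 / qpoch p p n * y ^ n)"
        using nz[of n] by (simp add: qpoch_Suc divide_simps) (simp add: power_mult_distrib algebra_simps)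
    qed
    also have "\<dots> = y * S y"
      unfolding S_def by (rule suminf_mult[OF summ[OF y]])
    finally show ?thesis by (simp add: algebra_simps)
  qed
  have it: "qpoch x p n * S x = S (x * p ^ n)" for n
  proof (induction n)
    case (Suc n)
    have "norm (x * p ^ n) \<le> norm x * 1"
      unfolding norm_mult norm_power using p by (intro mult_left_mono power_le_one) auto
    hence "norm (x * p ^ n) < 1" using x by simp
    from step[OF this] show ?case
      by (simp add: qpoch_Suc Suc[symmetric] mult_ac)
  qed simp
  have "isCont S 0"
    unfolding S_def by (rule isCont_powser[OF summ[of "1/2"]]) auto
  moreover have "(\<lambda>n. x * p ^ n) \<longlonglongrightarrow> 0"
    using tendsto_mult_left[OF LIMSEQ_power_zero[OF p], of x] by simp
  ultimately have "(\<lambda>n. S (x * p ^ n)) \<longlonglongrightarrow> S 0"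
    by (rule isCont_tendsto_compose)
  moreover have "(\<lambda>n. S (x * p ^ n)) \<longlonglongrightarrow> qpoch_inf x p * S x"
    unfolding it[symmetric] by (intro tendsto_mult qpoch_tendsto p tendsto_const)
  ultimately have "qpoch_inf x p * S x = S 0"
    using LIMSEQ_unique by blast
  moreover have "S 0 = 1"
    unfolding S_def by (subst suminf_finite[of "{0}"]) auto
  moreover have "qpoch_inf x p \<noteq> 0"
    by (intro qpoch_inf_nonzero' p x)
  ultimately have "S x = 1 / qpoch_inf x p"
    by (simp add: field_simps)
  thus "(\<lambda>n. x ^ n / qpoch p p n) sums (1 / qpoch_inf x p)"
    using summable_sums[OF summ[OF x]] by (simp add: S_def)
qed

lemma prod_power_qpoch:
  fixes p z :: complex
  shows "(\<Prod>k<n. z / (1 - p * p ^ k) * p ^ k) = z ^ n * p ^ (n * (n - 1) div 2) / qpoch p p n"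
proof -
  have "(\<Sum>k<n. k) = n * (n - 1) div 2"
    by (simp add: Sum_Ico_nat lessThan_atLeast0)
  thus ?thesis
    by (simp add: prod.distrib prod_dividef qpoch_def flip: power_sum)
qed

section \<open>Absolutely convergent sums over the integers and over pairs\<close>

lemma int_abs_summable:
  fixes f :: "int \<Rightarrow> complex"
  assumes "summable (\<lambda>n. norm (f (int n)))" "summable (\<lambda>n. norm (f (- int n - 1)))"
  shows "(\<lambda>k. norm (f k)) summable_on UNIV"
proof -
  have "(\<lambda>n. norm (f (int n))) summable_on UNIV" "(\<lambda>n. norm (f (- int n - 1))) summable_on UNIV"
    using assms by (intro norm_summable_imp_summable_on; simp)+
  hence "(\<lambda>k. norm (f k)) summable_on range int" "(\<lambda>k. norm (f k)) summable_on range (\<lambda>n. - int n - 1)"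
    by (subst summable_on_reindex; simp add: inj_on_def o_def)+
  moreover have "range int \<inter> range (\<lambda>n. - int n - 1) = {}"
    by auto
  ultimately have "(\<lambda>k. norm (f k)) summable_on (range int \<union> range (\<lambda>n. - int n - 1))"
    by (rule summable_on_Un_disjoint)
  moreover have "range int \<union> range (\<lambda>n. - int n - 1) = UNIV"
  proof (intro equalityI subsetI UNIV_I)
    fix k :: int
    show "k \<in> range int \<union> range (\<lambda>n. - int n - 1)"
    proof (cases "k \<ge> 0")
      case True
      hence "k = int (nat k)" by simp
      thus ?thesis by blast
    next
      case False
      hence "k = - int (nat (- k - 1)) - 1" by simp
      thus ?thesis by blast
    qed
  qed
  ultimately show ?thesis
    by (simp only:)
qed

lemma has_sum_times:
  fixes f :: "'a \<Rightarrow> complex" and g :: "'b \<Rightarrow> complex"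
  assumes f: "(\<lambda>x. norm (f x)) summable_on A" and g: "(\<lambda>y. norm (g y)) summable_on B"
    and "(f has_sum a) A" "(g has_sum b) B"
  shows "((\<lambda>(x, y). f x * g y) has_sum (a * b)) (A \<times> B)"
proof (rule has_sum_SigmaI)
  show "((\<lambda>y. case (x, y) of (x, y) \<Rightarrow> f x * g y) has_sum f x * b) B" for x
    using has_sum_cmult_right[OF assms(4), of "f x"] by simp
  show "((\<lambda>x. f x * b) has_sum a * b) A"
    by (rule has_sum_cmult_left[OF assms(3)])
  have "(\<lambda>z. norm (case z of (x, y) \<Rightarrow> f x * g y)) summable_on A \<times> B"
  proof (subst Infinite_Sum.abs_summable_on_Sigma_iff, intro conjI ballI)
    fix x
    show "(\<lambda>y. norm (case (x, y) of (x, y) \<Rightarrow> f x * g y)) summable_on B"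
      using summable_on_cmult_right[OF g, of "norm (f x)"] by (simp add: norm_mult)
  next
    have "(\<Sum>\<^sub>\<infinity>y\<in>B. norm (case (x, y) of (x, y) \<Rightarrow> f x * g y)) = norm (f x) * (\<Sum>\<^sub>\<infinity>y\<in>B. norm (g y))" for x
      by (simp add: norm_mult infsum_cmult_right')
    moreover have "(\<lambda>x. norm (f x) * (\<Sum>\<^sub>\<infinity>y\<in>B. norm (g y))) summable_on A"
      by (rule summable_on_cmult_left[OF f])
    ultimately show "(\<lambda>x. norm (\<Sum>\<^sub>\<infinity>y\<in>B. norm (case (x, y) of (x, y) \<Rightarrow> f x * g y))) summable_on A"
      by (simp add: infsum_nonneg abs_mult)
  qed
  thus "(\<lambda>(x, y). f x * g y) summable_on A \<times> B"
    by (rule abs_summable_summable)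
qed

definition theta_term :: "complex \<Rightarrow> complex \<Rightarrow> int \<Rightarrow> complex" where
  "theta_term y p k = y powi k * p powi (k * (k - 1) div 2)"

lemma two_int_triangle: "2 * (k * (k - 1) div 2) = k * (k - 1 :: int)"
  by simp

lemma int_triangle_add:
  "(n + m) * (n + m - 1) div 2 = n * (n - 1) div 2 + m * (m - 1) div 2 + n * (m :: int)"
proof -
  have "2 * ((n + m) * (n + m - 1) div 2) = 2 * (n * (n - 1) div 2 + m * (m - 1) div 2 + n * m)"
    unfolding distrib_left two_int_triangle by (simp add: algebra_simps)
  thus ?thesis
    by (rule mult_left_cancel[THEN iffD1, rotated]) simp
qed

lemma int_triangle_nat: "int n * (int n - 1) div 2 = int (n * (n - 1) div 2)"
proof -
  have "int n * (int n - 1) = int (n * (n - 1))"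
    by (cases n) (simp_all add: algebra_simps)
  thus ?thesis
    by (simp only: zdiv_int of_nat_numeral)
qed

text \<open>Each half of the integers is bounded by the Gaussian majorant. For
  \<open>k = - n - 1\<close> the exponent is \<open>n(n-1)/2 + 2n + 1\<close>, so the growth
  constant \<open>|y|\<close> of the other half is replaced by \<open>|p^2 / y|\<close>.\<close>

lemma theta_term_abs_summable:
  assumes p: "norm p < 1" "p \<noteq> 0" and y: "y \<noteq> 0"
  shows "(\<lambda>k. norm (theta_term y p k)) summable_on UNIV"
proof (rule int_abs_summable)
  have "theta_term y p (int n) = y ^ n * p ^ (n * (n - 1) div 2)" for n
    unfolding theta_term_def int_triangle_nat by (simp only: power_int_of_nat)
  thus "summable (\<lambda>n. norm (theta_term y p (int n)))"
    using summable_pow_gauss[of "norm y" "norm p"] p by (simp add: norm_mult norm_power)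
  have "theta_term y p (- int n - 1) = p / y * ((p\<^sup>2 / y) ^ n * p ^ (n * (n - 1) div 2))" for n
  proof -
    have e: "(- int n - 1) * (- int n - 1 - 1) div 2 = int (n * (n - 1) div 2) + 2 * int n + 1"
    proof -
      have "(- int n - 1) * (- int n - 1 - 1) = int n * (int n - 1) + (2 * int n + 1) * 2"
        by (simp add: algebra_simps)
      thus ?thesis
        by (simp only: div_mult_self1 int_triangle_nat)
    qed
    have "theta_term y p (- int n - 1) = inverse (y ^ n * y) * (p ^ (n * (n - 1) div 2) * (p ^ n)\<^sup>2 * p)"
    proof -
      have "y powi (- int n - 1) = inverse (y ^ n * y)"
      proof -
        have "- int n - 1 = - int (Suc n)" by simp
        thus ?thesis
          by (simp only: power_int_minus power_int_of_nat power_Suc mult.commute)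
      qed
      moreover have "p powi (int (n * (n - 1) div 2) + 2 * int n + 1) = p ^ (n * (n - 1) div 2 + 2 * n + 1)"
        by (subst power_int_of_nat[symmetric]) (simp add: add_ac)
      ultimately show ?thesis
        unfolding theta_term_def e by (simp add: power_add power_mult power2_eq_square power_mult_distrib)
    qed
    thus ?thesis
      using y by (simp add: field_simps power2_eq_square power_mult_distrib)
  qed
  thus "summable (\<lambda>n. norm (theta_term y p (- int n - 1)))"
    using summable_mult[OF summable_pow_gauss[of "norm (p\<^sup>2 / y)" "norm p"], of "norm (p / y)"] p
    by (simp add: norm_mult norm_power norm_divide)
qed

lemma qpoch_inf_split_initial:
  assumes "norm p < 1"
  shows "qpoch_inf a p = qpoch a p n * qpoch_inf (a * p ^ n) p"
proof (induction n)
  case (Suc n)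
  thus ?case
    using qpoch_inf_unfold[OF assms, of "a * p ^ n"] by (simp add: qpoch_Suc mult_ac)
qed simp

text \<open>The argument is \<open>p^(-N)\<close> with \<open>N = - n - 1\<close>, so the factor
  with index \<open>N\<close> is zero.\<close>

lemma qpoch_inf_power_int_neg:
  assumes "norm p < 1" "p \<noteq> 0" "n < 0"
  shows "qpoch_inf (p powi (n + 1)) p = 0"
proof -
  define N where "N = nat (- n - 1)"
  have N: "n + 1 + int N = 0"
    using assms by (simp add: N_def)
  have "p powi (n + 1) * p powi (int N) = 1"
    using assms by (simp only: power_int_add[symmetric] N power_int_0_right simp_thms)
  hence "p powi (n + 1) * p ^ N = 1"
    by simp
  hence "qpoch (p powi (n + 1)) p (Suc N) = 0"
    by (simp add: qpoch_Suc)
  thus ?thesis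
    using qpoch_inf_split_initial[OF assms(1), of "p powi (n + 1)" "Suc N"] by simp
qed

text \<open>The theta series is multiplied by the expansion of \<open>1 / (x;p)_inf\<close> with
  \<open>x = - p / y\<close>, which converges because \<open>norm p < norm y\<close>. Summing along
  \<open>k = n + m\<close> over \<open>m\<close> first gives Euler's series for
  \<open>(p^(n+1);p)_inf\<close>. This vanishes for negative \<open>n\<close>, and what remains is
  Euler's series for \<open>(-y;p)_inf\<close> times \<open>(p;p)_inf\<close>.\<close>

theorem jacobi_triple_product:
  assumes p: "norm p < 1" "p \<noteq> 0" and y: "norm p < norm y"
  shows "(theta_term y p has_sum qpoch_inf (- y) p * qpoch_inf (- (p / y)) p * qpoch_inf p p) UNIV"
proof -
  define x where "x = - (p / y)"
  have y0: "y \<noteq> 0"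
    using y by auto
  have x: "norm x < 1"
    using y y0 by (simp add: x_def norm_divide)
  have nz: "qpoch p p n \<noteq> 0" for n
    using one_minus_power_neq_0[OF p(1), of "Suc k" for k] by (auto simp: qpoch_def)
  obtain T where T: "(theta_term y p has_sum T) UNIV"
    using abs_summable_summable[OF theta_term_abs_summable[OF p y0]] by (auto simp: summable_on_def)
  have "((\<lambda>(k, m). theta_term y p k * (x ^ m / qpoch p p m)) has_sum (T * (1 / qpoch_inf x p))) (UNIV \<times> UNIV)"
    using euler_sums_inverse[OF p(1) x] norm_summable_imp_has_sum[OF euler_sums_inverse(2,1)[OF p(1) x]]
    by (intro has_sum_times theta_term_abs_summable p y0 T norm_summable_imp_summable_on) auto
  also have "?this \<longleftrightarrow> ((\<lambda>(n, m). theta_term y p (n + int m) * (x ^ m / qpoch p p m)) has_sum (T * (1 / qpoch_inf x p))) (UNIV \<times> UNIV)"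
    by (rule has_sum_reindex_bij_witness[where i = "\<lambda>(n, m). (n + int m, m)" and j = "\<lambda>(n, m). (n - int m, m)"]) auto
  finally have sum2: "((\<lambda>(n, m). theta_term y p (n + int m) * (x ^ m / qpoch p p m)) has_sum (T * (1 / qpoch_inf x p))) (UNIV \<times> UNIV)" .
  have inner: "((\<lambda>m. theta_term y p (n + int m) * (x ^ m / qpoch p p m)) has_sum (theta_term y p n * qpoch_inf (p powi (n + 1)) p)) UNIV" for n
  proof -
    \<comment> \<open>The shift by \<open>m\<close> multiplies the theta term by
      \<open>(y p^n)^m p^(m(m-1)/2)\<close>. Together with \<open>x^m\<close> the base is
      \<open>y p^n x = - p^(n+1)\<close>, so \<open>y\<close> drops out.\<close>
    define z where "z = - (p powi (n + 1))"
    have z: "theta_term y p (n + int m) * (x ^ m / qpoch p p m)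
        = theta_term y p n * (\<Prod>k<m. z / (1 - p * p ^ k) * p ^ k)" for m
    proof -
      have "theta_term y p (n + int m) = theta_term y p n * (y ^ m * p ^ (m * (m - 1) div 2) * (p powi n) ^ m)"
        unfolding theta_term_def int_triangle_add int_triangle_nat using p y0
        by (simp add: power_int_add power_int_mult)
      moreover have "z = p powi n * (y * x)"
        using p y0 by (simp add: z_def x_def power_int_add)
      ultimately show ?thesis
        unfolding prod_power_qpoch by (simp add: power_mult_distrib)
    qed
    have "summable (\<lambda>m. norm ((\<Prod>k<m. z / (1 - p * p ^ k) * p ^ k) * 1))"
      by (rule qseries_summable[OF p(1), of "\<lambda>X. z / (1 - p * X)" "\<lambda>_. 1"]) (auto intro!: continuous_intros)
    hence s: "summable (\<lambda>m. norm (\<Prod>k<m. z / (1 - p * p ^ k) * p ^ k))"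
      by simp
    have "((\<lambda>m. (\<Prod>k<m. z / (1 - p * p ^ k) * p ^ k)) has_sum qpoch_inf (- z) p) UNIV"
      using summable_sums[OF summable_norm_cancel[OF s]] euler_sums[OF p(1), of z]
      by (intro norm_summable_imp_has_sum s) auto
    from has_sum_cmult_right[OF this, of "theta_term y p n"] show ?thesis
      unfolding z by (simp add: z_def)
  qed
  have "((\<lambda>n. theta_term y p n * qpoch_inf (p powi (n + 1)) p) has_sum (T * (1 / qpoch_inf x p))) UNIV"
    by (rule has_sum_SigmaD[OF sum2]) (use inner in simp)
  also have "?this \<longleftrightarrow> ((\<lambda>n. theta_term y p n * qpoch_inf (p powi (n + 1)) p) has_sum (T * (1 / qpoch_inf x p))) (range int)"
  proof (rule has_sum_cong_neutral)
    fix n :: int assume "n \<in> UNIV - range int"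
    have "n < 0"
    proof (rule ccontr)
      assume "\<not> n < 0"
      hence "n = int (nat n)" by simp
      with \<open>n \<in> UNIV - range int\<close> show False by blast
    qed
    thus "theta_term y p n * qpoch_inf (p powi (n + 1)) p = 0"
      using qpoch_inf_power_int_neg[OF p] by simp
  qed auto
  also have "\<dots> \<longleftrightarrow> ((\<lambda>n. theta_term y p (int n) * qpoch_inf (p powi (int n + 1)) p) has_sum (T * (1 / qpoch_inf x p))) UNIV"
    by (subst has_sum_reindex) (simp_all add: inj_on_def o_def)
  finally have "(\<lambda>n. theta_term y p (int n) * qpoch_inf (p powi (int n + 1)) p) sums (T * (1 / qpoch_inf x p))"
    by (rule has_sum_imp_sums)
  moreover have "theta_term y p (int n) * qpoch_inf (p powi (int n + 1)) p
      = qpoch_inf p p * (\<Prod>k<n. y / (1 - p * p ^ k) * p ^ k)" for n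
  proof -
    have "p powi (int n + 1) = p * p ^ n"
      using p by (simp add: power_int_add mult.commute)
    moreover have "qpoch_inf (p * p ^ n) p = qpoch_inf p p / qpoch p p n"
      using qpoch_inf_split_initial[OF p(1), of p n] nz[of n] by (simp add: field_simps)
    ultimately show ?thesis
      unfolding prod_power_qpoch theta_term_def int_triangle_nat by simp
  qed
  ultimately have "(\<lambda>n. qpoch_inf p p * (\<Prod>k<n. y / (1 - p * p ^ k) * p ^ k)) sums (T * (1 / qpoch_inf x p))"
    by simp
  moreover have "(\<lambda>n. qpoch_inf p p * (\<Prod>k<n. y / (1 - p * p ^ k) * p ^ k)) sums (qpoch_inf p p * qpoch_inf (- y) p)"
  proof -
    have "summable (\<lambda>m. (\<Prod>k<m. y / (1 - p * p ^ k) * p ^ k) * 1)"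
      by (rule summable_norm_cancel[OF qseries_summable[OF p(1), of "\<lambda>X. y / (1 - p * X)" "\<lambda>_. 1"]])
        (auto intro!: continuous_intros)
    thus ?thesis
      using euler_sums[OF p(1), of y] by (intro sums_mult) (simp add: sums_iff)
  qed
  ultimately have "T * (1 / qpoch_inf x p) = qpoch_inf p p * qpoch_inf (- y) p"
    by (rule sums_unique2)
  moreover have "qpoch_inf x p \<noteq> 0"
    by (intro qpoch_inf_nonzero' p x)
  ultimately have "T = qpoch_inf (- y) p * qpoch_inf x p * qpoch_inf p p"
    by (simp add: field_simps)
  thus ?thesis
    using T by (simp add: x_def)
qed

lemma power_strict_less_norm:
  fixes q :: complex
  assumes "norm q < 1" "q \<noteq> 0" "a < m"
  shows "norm (q ^ m) < norm (q ^ a)"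
  using assms by (simp add: norm_power power_strict_decreasing)

text \<open>The triple product at \<open>y = \<epsilon> * q ^ a\<close> and base
  \<open>q ^ m\<close>; a sign is its own inverse, so \<open>- p / y\<close> becomes
  \<open>- \<epsilon> * q ^ (m - a)\<close>.\<close>

lemma theta_has_sum:
  assumes q: "norm q < 1" "q \<noteq> 0" and "0 < a" "a < m" and \<epsilon>: "\<epsilon> = 1 \<or> \<epsilon> = -1"
  shows "((\<lambda>k. \<epsilon> powi k * q powi (int m * (k * (k - 1) div 2) + int a * k)) has_sum
     qpoch_inf (- \<epsilon> * q ^ a) (q ^ m) * qpoch_inf (- \<epsilon> * q ^ (m - a)) (q ^ m) * qpoch_inf (q ^ m) (q ^ m)) UNIV"
proof -
  have p: "norm (q ^ m) < 1" "q ^ m \<noteq> 0"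
    using assms by (auto simp: norm_power power_less_one_iff)
  have "norm (q ^ m) < norm (\<epsilon> * q ^ a)"
    using power_strict_less_norm[OF q \<open>a < m\<close>] \<epsilon> by (auto simp: norm_mult)
  from jacobi_triple_product[OF p this]
  have "(theta_term (\<epsilon> * q ^ a) (q ^ m) has_sum qpoch_inf (- (\<epsilon> * q ^ a)) (q ^ m) *
      qpoch_inf (- (q ^ m / (\<epsilon> * q ^ a))) (q ^ m) * qpoch_inf (q ^ m) (q ^ m)) UNIV" .
  moreover have "theta_term (\<epsilon> * q ^ a) (q ^ m) = (\<lambda>k. \<epsilon> powi k * q powi (int m * (k * (k - 1) div 2) + int a * k))"
    unfolding theta_term_def power_int_mult_distrib power_int_power using q
    by (auto simp: power_int_add mult_ac)
  moreover have "- (q ^ m / (\<epsilon> * q ^ a)) = - \<epsilon> * q ^ (m - a)"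
    using \<epsilon> q assms by (auto simp: power_diff)
  ultimately show ?thesis by simp
qed

text \<open>An even modulus absorbs the division by 2. The exponents become polynomials, which can
  be compared by ring normalisation after reindexing.\<close>

lemma theta_has_sum_even:
  assumes q: "norm q < 1" "q \<noteq> 0" and "0 < a" "a < 2 * h" and \<epsilon>: "\<epsilon> = 1 \<or> \<epsilon> = -1"
  shows "((\<lambda>k. \<epsilon> powi k * q powi (int h * (k * (k - 1)) + int a * k)) has_sum
     qpoch_inf (- \<epsilon> * q ^ a) (q ^ (2 * h)) * qpoch_inf (- \<epsilon> * q ^ (2 * h - a)) (q ^ (2 * h))
       * qpoch_inf (q ^ (2 * h)) (q ^ (2 * h))) UNIV"
proof -
  have ex: "int (2 * h) * (k * (k - 1) div 2) = int h * (k * (k - 1))" for k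
  proof -
    have "int (2 * h) * T = int h * (2 * T)" for T by simp
    thus ?thesis by (simp only: two_int_triangle)
  qed
  thus ?thesis
    using theta_has_sum[OF assms(1-4) \<epsilon>] by (simp only: ex)
qed

section \<open>Reindexing and dissecting sums over the integers\<close>

lemma has_sum_bijI:
  assumes "((\<lambda>x. f (h x)) has_sum S) A"
    and "\<And>x. x \<in> A \<Longrightarrow> h x \<in> B" "\<And>x. x \<in> A \<Longrightarrow> g (h x) = x"
    and "\<And>y. y \<in> B \<Longrightarrow> g y \<in> A" "\<And>y. y \<in> B \<Longrightarrow> h (g y) = y"
  shows "(f has_sum S) B"
proof -
  have "bij_betw h A B"
    by (rule bij_betwI[where g = g]) (use assms in auto)
  from has_sum_reindex_bij_betw[OF this] assms(1) show ?thesis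
    by blast
qed

lemma qpoch_inf_split2:
  assumes "norm p < 1"
  shows "qpoch_inf a p = qpoch_inf a (p\<^sup>2) * qpoch_inf (a * p) (p\<^sup>2)"
  using qpoch_inf_split[OF assms, of 2 a] by (simp add: numeral_2_eq_2)

lemma qpoch_inf_split3:
  assumes "norm p < 1"
  shows "qpoch_inf a p = qpoch_inf a (p ^ 3) * qpoch_inf (a * p) (p ^ 3) * qpoch_inf (a * p\<^sup>2) (p ^ 3)"
  using qpoch_inf_split[OF assms, of 3 a] by (simp add: numeral_3_eq_3 numeral_2_eq_2)

lemma has_sum_int_parity:
  fixes f :: "int \<Rightarrow> complex"
  assumes "((\<lambda>r. f (2 * r)) has_sum a) UNIV" "((\<lambda>r. f (2 * r - 1)) has_sum b) UNIV"
  shows "(f has_sum (a + b)) UNIV"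
proof -
  have "(f has_sum a) {k. even k}"
    by (rule has_sum_bijI[where f = f and h = "\<lambda>r. 2 * r" and g = "\<lambda>k. k div 2", OF assms(1)]) auto
  moreover have "(f has_sum b) {k. odd k}"
    by (rule has_sum_bijI[where f = f and h = "\<lambda>r. 2 * r - 1" and g = "\<lambda>k. (k + 1) div 2", OF assms(2)]) (auto elim!: oddE)
  ultimately have "(f has_sum (a + b)) ({k. even k} \<union> {k. odd k})"
    by (rule has_sum_Un_disjoint) auto
  moreover have "{k. even k} \<union> {k. odd k} = (UNIV :: int set)" by auto
  ultimately show ?thesis by simp
qed

lemma has_sum_int_mod3:
  fixes f :: "int \<Rightarrow> complex"
  assumes "((\<lambda>r. f (3 * r)) has_sum a) UNIV" "((\<lambda>r. f (3 * r + 1)) has_sum b) UNIV"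
    "((\<lambda>r. f (3 * r + 2)) has_sum c) UNIV"
  shows "(f has_sum (a + b + c)) UNIV"
proof -
  have "(f has_sum a) {k. k mod 3 = 0}"
    by (rule has_sum_bijI[where f = f and h = "\<lambda>r. 3 * r" and g = "\<lambda>k. k div 3", OF assms(1)]) auto
  moreover have "(f has_sum b) {k. k mod 3 = 1}"
    by (rule has_sum_bijI[where f = f and h = "\<lambda>r. 3 * r + 1" and g = "\<lambda>k. k div 3", OF assms(2)]) (auto, presburger+)
  ultimately have "(f has_sum (a + b)) ({k. k mod 3 = 0} \<union> {k. k mod 3 = 1})"
    by (rule has_sum_Un_disjoint) auto
  moreover have "(f has_sum c) {k. k mod 3 = 2}"
    by (rule has_sum_bijI[where f = f and h = "\<lambda>r. 3 * r + 2" and g = "\<lambda>k. k div 3", OF assms(3)]) (auto, presburger+)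
  ultimately have "(f has_sum (a + b + c)) ({k. k mod 3 = 0} \<union> {k. k mod 3 = 1} \<union> {k. k mod 3 = 2})"
    by (rule has_sum_Un_disjoint) auto
  moreover have "{k. k mod 3 = 0} \<union> {k. k mod 3 = 1} \<union> {k. k mod 3 = 2} = (UNIV :: int set)"
  proof -
    have "m mod 3 = 0 \<or> m mod 3 = 1 \<or> m mod 3 = 2" for m :: int by presburger
    thus ?thesis by auto
  qed
  ultimately show ?thesis by simp
qed

lemma has_sum_int_reflect:
  fixes f :: "int \<Rightarrow> complex"
  assumes "(f has_sum a) UNIV"
  shows "((\<lambda>k. f (c - k)) has_sum a) UNIV"
  by (rule has_sum_bijI[where h = "\<lambda>k. c - k" and g = "\<lambda>k. c - k"]) (use assms in auto)

lemma has_sum_int_shift: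
  fixes f :: "int \<Rightarrow> complex"
  assumes "(f has_sum a) UNIV"
  shows "((\<lambda>k. f (k + c)) has_sum a) UNIV"
  by (rule has_sum_bijI[where h = "\<lambda>k. k - c" and g = "\<lambda>k. k + c"]) (use assms in auto)

section \<open>A quintuple product\<close>

lemma minus_one_powi_double [simp]: "(- 1 :: complex) powi (2 * k) = 1"
  by (simp add: power_int_mult)

text \<open>The two theta factors are multiplied as a double series over \<open>(i, j)\<close> with
  quadratic form \<open>6 i^2 + 12 j^2\<close>. The substitution \<open>i = r - 2 l + c\<close>,
  \<open>j = r + l\<close> makes it \<open>18 r^2 + 36 l^2\<close> without cross term, and
  \<open>c\<close> is the residue of \<open>i + 2 j\<close> modulo 3. On each class the series
  splits into a sum over \<open>r\<close> times a sum over \<open>l\<close>: for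
  \<open>c = 0\<close> and \<open>c = 1\<close> the latter is \<open>J q 24\<close>, for
  \<open>c = 2\<close> it is zero. \<open>X\<close>, \<open>Y\<close>, \<open>W\<close> are the
  three sums over \<open>r\<close>.\<close>

lemma quintuple_product:
  assumes q: "norm q < 1" "q \<noteq> 0" and e: "0 < e" "e < 6"
    and X: "((\<lambda>r. q powi (18 * r\<^sup>2 - 6 * r + 3 * int e * r)) has_sum X) UNIV"
    and Y: "((\<lambda>r. q powi (18 * r\<^sup>2 + 6 * r + 3 * int e * r + int e)) has_sum Y) UNIV"
    and W: "((\<lambda>r. q powi (18 * r\<^sup>2 + 18 * r + 3 * int e * r + 12 + 2 * int e)) has_sum W) UNIV"
  shows "J2 q e 12 * J2 q (12 - 2 * e) 24 = J q 24 * (X - Y)"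
proof -
  let ?s = "\<lambda>k::int. (- 1 :: complex) powi k"
  let ?f = "\<lambda>k. ?s k * q powi (6 * (k * (k - 1)) + int e * k)"
  let ?g = "\<lambda>k. ?s k * q powi (12 * (k * (k - 1)) + int (12 + 2 * e) * k)"
  have f: "(?f has_sum J2 q e 12) UNIV"
    using theta_has_sum_even[OF q, of e 6 "-1"] e by (simp add: J2_def)
  have g: "(?g has_sum J2 q (12 - 2 * e) 24) UNIV"
    using theta_has_sum_even[OF q, of "12 + 2 * e" 12 "-1"] e by (simp add: J2_def mult_ac)
  have abs: "(\<lambda>k. norm (h k)) summable_on UNIV" if "(h has_sum v) UNIV" for h :: "int \<Rightarrow> complex" and v
    by (rule summable_on_iff_abs_summable_on_complex[THEN iffD1, OF has_sum_imp_summable[OF that]])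
  let ?F = "\<lambda>(i, j). ?f i * ?g j"
  have F: "(?F has_sum (J2 q e 12 * J2 q (12 - 2 * e) 24)) UNIV"
    using has_sum_times[OF abs[OF f] abs[OF g] f g] by simp
  \<comment> \<open>The sums over \<open>l\<close> for \<open>c = 0, 1, 2\<close>. The first two are
    theta series to the base \<open>q^72\<close> with arguments \<open>q^48\<close> and
    \<open>q^24\<close>, that is, three classes of factors that recombine to
    \<open>(q^24;q^24)_inf\<close>.\<close>
  let ?B = "\<lambda>l. ?s l * q powi (36 * (l * (l - 1)) + 48 * l)"
  let ?B' = "\<lambda>l. ?s l * q powi (36 * (l * (l - 1)) + 24 * l)"
  let ?B'' = "\<lambda>l. ?s l * q powi (36 * (l * (l - 1)))"
  have J24: "qpoch_inf (q ^ 24) (q ^ 72) * qpoch_inf (q ^ 48) (q ^ 72) * qpoch_inf (q ^ 72) (q ^ 72) = J q 24"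
  proof -
    have "norm (q ^ 24) < 1"
      using q by (simp add: norm_power power_less_one_iff)
    moreover have "q ^ 24 * q ^ 24 = q ^ 48" "q ^ 24 * (q ^ 24)\<^sup>2 = q ^ 72" "(q ^ 24) ^ 3 = q ^ 72"
      by (simp_all flip: power_mult power_add)
    ultimately show ?thesis
      using qpoch_inf_split3[of "q ^ 24" "q ^ 24"] by (simp add: J_def)
  qed
  have B: "(?B has_sum J q 24) UNIV" "(?B' has_sum J q 24) UNIV"
    using theta_has_sum_even[OF q, of 48 36 "-1"] theta_has_sum_even[OF q, of 24 36 "-1"] J24
    by (simp_all add: mult_ac)
  have "(\<lambda>k. norm (theta_term (-1) (q ^ 72) k)) summable_on UNIV"
    using q by (intro theta_term_abs_summable) (auto simp: norm_power power_less_one_iff)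
  moreover have "theta_term (-1) (q ^ 72) = ?B''"
  proof
    fix k :: int
    have "72 * (k * (k - 1) div 2) = 36 * (k * (k - 1))"
      using two_int_triangle[of k] by simp
    thus "theta_term (-1) (q ^ 72) k = ?B'' k"
      by (simp only: theta_term_def power_int_power of_nat_numeral)
  qed
  ultimately obtain b where b: "(?B'' has_sum b) UNIV"
    using abs_summable_summable[of ?B'' UNIV] by (auto simp: summable_on_def)
  \<comment> \<open>The exponent \<open>36 l (l - 1)\<close> is invariant under
    \<open>l -> 1 - l\<close> while the sign flips, so the sum equals its own negative.\<close>
  have "?B'' (1 - l) = - ?B'' l" for l
  proof -
    have "?s (1 - l) = - ?s l"
      using power_int_add[of "-1::complex" "1 - l" "2 * l"] power_int_add[of "-1::complex" 1 l] by (simp add: add.commute)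
    thus ?thesis by (simp add: algebra_simps)
  qed
  hence "((\<lambda>l. - ?B'' l) has_sum b) UNIV"
    using has_sum_int_reflect[OF b, of 1] by simp
  hence "- b = b"
    using has_sum_unique has_sum_uminusI[OF b] by blast
  hence b0: "b = 0" by simp
  \<comment> \<open>Since \<open>i + 2 j = 3 r + c\<close>, the inverse substitution is division by
    3 with remainder \<open>c\<close>.\<close>
  have part: "(?F has_sum v * u) {(i, j). (i + 2 * j) mod 3 = c}"
    if "(h has_sum v) UNIV" "(k has_sum u) UNIV" "0 \<le> c" "c < 3"
      "\<And>r l. ?F (r - 2 * l + c, r + l) = h r * k l" for h k v u and c :: int
  proof -
    have "((\<lambda>(r, l). h r * k l) has_sum v * u) (UNIV \<times> UNIV)"
      by (intro has_sum_times abs that; fact)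
    hence "((\<lambda>z. ?F ((\<lambda>(r, l). (r - 2 * l + c, r + l)) z)) has_sum v * u) (UNIV \<times> UNIV)"
      using that(5) by (simp add: case_prod_unfold)
    thus ?thesis
    proof (rule has_sum_bijI[where g = "\<lambda>(i, j). ((i + 2 * j) div 3, j - (i + 2 * j) div 3)" and
          h = "\<lambda>(r, l). (r - 2 * l + c, r + l)"])
      fix z :: "int \<times> int"
      show "(\<lambda>(r, l). (r - 2 * l + c, r + l)) z \<in> {(i, j). (i + 2 * j) mod 3 = c}"
        using that(3,4) by (cases z) (auto simp: algebra_simps)
      show "(\<lambda>(i, j). ((i + 2 * j) div 3, j - (i + 2 * j) div 3)) ((\<lambda>(r, l). (r - 2 * l + c, r + l)) z) = z"
        using that(3,4) by (cases z) (auto simp: algebra_simps)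
    next
      fix z :: "int \<times> int" assume z: "z \<in> {(i, j). (i + 2 * j) mod 3 = c}"
      obtain i j where ij: "z = (i, j)" by (cases z)
      have "3 * ((i + 2 * j) div 3) + c = i + 2 * j"
        using z div_mult_mod_eq[of "i + 2 * j" 3] by (simp add: ij)
      thus "(\<lambda>(r, l). (r - 2 * l + c, r + l)) ((\<lambda>(i, j). ((i + 2 * j) div 3, j - (i + 2 * j) div 3)) z) = z"
        by (simp add: ij algebra_simps)
    qed auto
  qed
  have sgn: "?s (r - 2 * l + c) * ?s (r + l) = ?s c * ?s l" for r l c
  proof -
    have "?s (r - 2 * l + c) * ?s (r + l) = ?s ((r - 2 * l + c) + (r + l))"
      by (rule power_int_add[symmetric]) simp
    also have "(r - 2 * l + c) + (r + l) = 2 * (r - l) + (c + l)"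
      by simp
    also have "?s \<dots> = ?s (2 * (r - l)) * (?s c * ?s l)"
      by (subst power_int_add; simp add: power_int_add)
    finally have "?s (r - 2 * l + c) * ?s (r + l) = ?s (2 * (r - l)) * (?s c * ?s l)" .
    thus ?thesis by simp
  qed
  have FF: "?F (r - 2 * l + c, r + l) = ?s c * ?s l * q powi (
      (6 * ((r - 2 * l + c) * ((r - 2 * l + c) - 1)) + int e * (r - 2 * l + c))
      + (12 * ((r + l) * ((r + l) - 1)) + int (12 + 2 * e) * (r + l)))" for r l c
    unfolding prod.case sgn[of r l c, symmetric] power_int_add[of q, OF disjI1[OF q(2)]]
    by (simp only: mult_ac)
  have p0: "?F (r - 2 * l + 0, r + l) = q powi (18 * r\<^sup>2 - 6 * r + 3 * int e * r) * ?B l" for r l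
  proof -
    have ex: "(6 * ((r - 2 * l + 0) * ((r - 2 * l + 0) - 1)) + int e * (r - 2 * l + 0))
      + (12 * ((r + l) * ((r + l) - 1)) + int (12 + 2 * e) * (r + l))
      = (18 * r\<^sup>2 - 6 * r + 3 * int e * r) + (36 * (l * (l - 1)) + 48 * l)"
      by (simp add: power2_eq_square algebra_simps)
    show ?thesis
      unfolding FF ex unfolding power_int_add[of q, OF disjI1[OF q(2)]] by simp
  qed
  have p1: "?F (r - 2 * l + 1, r + l) = (- (q powi (18 * r\<^sup>2 + 6 * r + 3 * int e * r + int e))) * ?B' l" for r l
  proof -
    have ex: "(6 * ((r - 2 * l + 1) * ((r - 2 * l + 1) - 1)) + int e * (r - 2 * l + 1))
      + (12 * ((r + l) * ((r + l) - 1)) + int (12 + 2 * e) * (r + l))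
      = (18 * r\<^sup>2 + 6 * r + 3 * int e * r + int e) + (36 * (l * (l - 1)) + 24 * l)"
      by (simp add: power2_eq_square algebra_simps)
    show ?thesis
      unfolding FF ex unfolding power_int_add[of q, OF disjI1[OF q(2)]] by simp
  qed
  have p2: "?F (r - 2 * l + 2, r + l) = q powi (18 * r\<^sup>2 + 18 * r + 3 * int e * r + 12 + 2 * int e) * ?B'' l" for r l
  proof -
    have ex: "(6 * ((r - 2 * l + 2) * ((r - 2 * l + 2) - 1)) + int e * (r - 2 * l + 2))
      + (12 * ((r + l) * ((r + l) - 1)) + int (12 + 2 * e) * (r + l))
      = (18 * r\<^sup>2 + 18 * r + 3 * int e * r + 12 + 2 * int e) + (36 * (l * (l - 1)))"
      by (simp add: power2_eq_square algebra_simps)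
    show ?thesis
      unfolding FF ex unfolding power_int_add[of q, OF disjI1[OF q(2)]] by simp
  qed
  have "(?F has_sum X * J q 24) {(i, j). (i + 2 * j) mod 3 = 0}"
    using part[OF X B(1) _ _ p0] by simp
  moreover have "(?F has_sum (- Y) * J q 24) {(i, j). (i + 2 * j) mod 3 = 1}"
    using part[OF has_sum_uminusI[OF Y] B(2) _ _ p1] by simp
  ultimately have "(?F has_sum (X * J q 24 + (- Y) * J q 24))
      ({(i, j). (i + 2 * j) mod 3 = 0} \<union> {(i, j). (i + 2 * j) mod 3 = 1})"
    by (rule has_sum_Un_disjoint) auto
  moreover have "(?F has_sum W * b) {(i, j). (i + 2 * j) mod 3 = 2}"
    using part[OF W b _ _ p2] by simp
  ultimately have "(?F has_sum (X * J q 24 + (- Y) * J q 24 + W * b))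
      ({(i, j). (i + 2 * j) mod 3 = 0} \<union> {(i, j). (i + 2 * j) mod 3 = 1} \<union> {(i, j). (i + 2 * j) mod 3 = 2})"
    by (rule has_sum_Un_disjoint) auto
  moreover have "{(i, j). (i + 2 * j) mod 3 = 0} \<union> {(i, j). (i + 2 * j) mod 3 = 1}
      \<union> {(i, j). (i + 2 * j) mod 3 = 2} = (UNIV :: (int \<times> int) set)"
  proof -
    have "m mod 3 = 0 \<or> m mod 3 = 1 \<or> m mod 3 = 2" for m :: int by presburger
    thus ?thesis by auto
  qed
  ultimately have "(?F has_sum (X * J q 24 + (- Y) * J q 24 + W * b)) UNIV"
    by simp
  from has_sum_unique[OF F this] show ?thesis
    by (simp add: b0 algebra_simps)
qed

section \<open>Theta function identities\<close>

text \<open>Euler's function of the base itself. Unlike \<open>J q m\<close>, it can be evaluated at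
  \<open>- x\<close> and at powers of any base, which the changes of base below require.\<close>

definition P :: "complex \<Rightarrow> complex" where
  "P x = qpoch_inf x x"

lemma P_nonzero: "norm x < 1 \<Longrightarrow> P x \<noteq> 0"
  unfolding P_def by (rule qpoch_inf_nonzero')

lemma J_eq_P: "J q m = P (q ^ m)"
  by (simp add: J_def P_def)

section \<open>Infinite products as quotients of values of Euler's function\<close>

lemma qpoch_minus_base:
  assumes "norm x < 1"
  shows "qpoch_inf (- x) x = P (x\<^sup>2) / P x"
  using qpoch_inf_square[OF assms, of x] P_nonzero[OF assms] by (simp add: P_def field_simps)

lemma qpoch_odd:
  assumes "norm x < 1"
  shows "qpoch_inf x (x\<^sup>2) = P x / P (x\<^sup>2)"
proof -
  have "norm (x\<^sup>2) < 1"
    using assms by (simp add: norm_power power_less_one_iff)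
  moreover have "x * x = x\<^sup>2"
    by (simp add: power2_eq_square)
  ultimately show ?thesis
    using qpoch_inf_split2[OF assms, of x] P_nonzero[of "x\<^sup>2"] by (simp add: P_def field_simps)
qed

lemma qpoch_minus_odd:
  assumes x: "norm x < 1"
  shows "qpoch_inf (- x) (x\<^sup>2) = P (x\<^sup>2) ^ 2 / (P x * P (x ^ 4))"
proof -
  have x2: "norm (x\<^sup>2) < 1" "norm (x ^ 4) < 1"
    using x by (simp_all add: norm_power power_less_one_iff)
  have x4: "(x\<^sup>2)\<^sup>2 = x ^ 4"
    by simp
  show ?thesis
    using qpoch_inf_square[OF x2(1), of x] qpoch_odd[OF x] qpoch_odd[OF x2(1)]
      P_nonzero[OF x] P_nonzero[OF x2(1)] P_nonzero[OF x2(2)]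
    unfolding x4 by (simp add: field_simps power2_eq_square)
qed

lemma qpoch_thirds:
  assumes x: "norm x < 1"
  shows "qpoch_inf x (x ^ 3) * qpoch_inf (x\<^sup>2) (x ^ 3) = P x / P (x ^ 3)"
proof -
  have x3: "norm (x ^ 3) < 1"
    using x by (simp add: norm_power power_less_one_iff)
  have "x * x = x\<^sup>2" "x * x\<^sup>2 = x ^ 3"
    by (simp_all add: power2_eq_square power3_eq_cube)
  thus ?thesis
    using qpoch_inf_split3[OF x, of x] P_nonzero[OF x3] by (simp add: P_def field_simps)
qed

lemma qpoch_minus_thirds:
  assumes x: "norm x < 1"
  shows "qpoch_inf (- x) (x ^ 3) * qpoch_inf (- (x\<^sup>2)) (x ^ 3) = P (x\<^sup>2) * P (x ^ 3) / (P x * P (x ^ 6))"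
proof -
  have x3: "norm (x ^ 3) < 1" "norm (x ^ 6) < 1"
    using x by (simp_all add: norm_power power_less_one_iff)
  have e: "- x * x = - (x\<^sup>2)" "- x * x\<^sup>2 = - (x ^ 3)"
    by (simp_all add: power2_eq_square power3_eq_cube)
  have e': "(x ^ 3)\<^sup>2 = x ^ 6"
    by (simp flip: power_mult)
  have "qpoch_inf (- x) (x ^ 3) * qpoch_inf (- (x\<^sup>2)) (x ^ 3) * qpoch_inf (- (x ^ 3)) (x ^ 3) = P (x\<^sup>2) / P x"
    using qpoch_inf_split3[OF x, of "- x"] unfolding e qpoch_minus_base[OF x] by simp
  moreover have "qpoch_inf (- (x ^ 3)) (x ^ 3) = P (x ^ 6) / P (x ^ 3)"
    using qpoch_minus_base[OF x3(1)] unfolding e' .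
  ultimately show ?thesis
    using P_nonzero[OF x3(1)] P_nonzero[OF x3(2)] P_nonzero[OF x] by (simp add: field_simps)
qed

text \<open>Splitting by parity of the index, \<open>(-x;-x)_inf\<close> is
  \<open>(-x;x^2)_inf (x^2;x^2)_inf\<close>.\<close>

lemma P_minus:
  assumes x: "norm x < 1"
  shows "P (- x) = P (x\<^sup>2) ^ 3 / (P x * P (x ^ 4))"
proof -
  have "P (- x) = qpoch_inf (- x) (x\<^sup>2) * P (x\<^sup>2)"
    using qpoch_inf_split2[of "- x" "- x"] x by (simp add: P_def power2_eq_square)
  thus ?thesis
    by (simp only: qpoch_minus_odd[OF x]) (simp add: power2_eq_square power3_eq_cube)
qed

text \<open>The quintuple product at \<open>e = 1\<close> and \<open>e = 5\<close> gives
  \<open>J q 24 * (X - Y)\<close> and \<open>J q 24 * (Y - Z)\<close> for three theta series with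
  leading exponent \<open>18 n^2\<close>. The sum needs only \<open>X - Z\<close>, a parity
  dissection of \<open>(q^3;q^3)_inf\<close>. The difference needs \<open>X + Z - 2 Y\<close>, which
  is the triple product at a primitive cube root of unity.\<close>

lemma theta_pair:
  assumes q: "norm q < 1" "q \<noteq> 0"
  shows "J2 q 1 12 * J2 q 10 24 + q * (J2 q 5 12 * J2 q 2 24) = J q 3 * J q 24" (is ?T1)
    and "J2 q 1 12 * J2 q 10 24 - q * (J2 q 5 12 * J2 q 2 24) = J q 24 * (J q 1)\<^sup>2 * J q 6 / (J q 2 * J q 3)" (is ?T2)
proof -
  let ?s = "\<lambda>k::int. (- 1 :: complex) powi k"
  note padd = power_int_add[of q, OF disjI1[OF q(2)]]
  define X where "X = (\<Sum>\<^sub>\<infinity>n::int. q powi (18 * n\<^sup>2 - 3 * n))"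
  define Y where "Y = (\<Sum>\<^sub>\<infinity>n::int. q powi (18 * n\<^sup>2 + 9 * n + 1))"
  define Z where "Z = (\<Sum>\<^sub>\<infinity>n::int. q powi (18 * n\<^sup>2 - 15 * n + 3))"
  \<comment> \<open>Existence of the sums is enough here; the shape
    \<open>18 n^2 + (a - 18) n\<close> is \<open>18 n (n - 1) + a n\<close>.\<close>
  have th: "\<exists>S. ((\<lambda>n::int. q powi (18 * n\<^sup>2 + (int a - 18) * n + c)) has_sum S) UNIV" if "0 < a" "a < 36" for a c
  proof -
    have "((\<lambda>k. q powi c * (1 powi k * q powi (int 18 * (k * (k - 1)) + int a * k))) has_sum
      q powi c * (qpoch_inf (- 1 * q ^ a) (q ^ (2 * 18)) * qpoch_inf (- 1 * q ^ (2 * 18 - a)) (q ^ (2 * 18))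
       * qpoch_inf (q ^ (2 * 18)) (q ^ (2 * 18)))) UNIV"
      using that by (intro has_sum_cmult_right theta_has_sum_even q) auto
    moreover have "q powi c * (1 powi k * q powi (int 18 * (k * (k - 1)) + int a * k)) = q powi (18 * k\<^sup>2 + (int a - 18) * k + c)" for k
    proof -
      have "q powi c * (1 powi k * q powi (int 18 * (k * (k - 1)) + int a * k)) = q powi (c + (int 18 * (k * (k - 1)) + int a * k))"
        by (simp only: power_int_1_left mult_1_left padd)
      also have "c + (int 18 * (k * (k - 1)) + int a * k) = 18 * k\<^sup>2 + (int a - 18) * k + c"
        by (simp add: power2_eq_square algebra_simps)
      finally show ?thesis .
    qed
    ultimately show ?thesis by auto
  qed
  obtain X where X: "((\<lambda>n::int. q powi (18 * n\<^sup>2 - 3 * n)) has_sum X) UNIV"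
    using th[of 15 0] by auto
  obtain Y where Y: "((\<lambda>n::int. q powi (18 * n\<^sup>2 + 9 * n + 1)) has_sum Y) UNIV"
    using th[of 27 1] by auto
  obtain Z where Z: "((\<lambda>n::int. q powi (18 * n\<^sup>2 - 15 * n + 3)) has_sum Z) UNIV"
    using th[of 3 3] by auto
  have ext: "(g has_sum v) UNIV" if "((\<lambda>n::int. q powi (e n)) has_sum v) UNIV" "\<And>n. g n = q powi (e' n)" "\<And>n. e n = e' n" for g e e' v
  proof -
    have "g = (\<lambda>n. q powi (e n))"
      using that(2,3) by (simp add: fun_eq_iff)
    thus ?thesis
      using that(1) by simp
  qed
  have expand: "(n + 1)\<^sup>2 = n\<^sup>2 + 2 * n + 1" "(1 - n)\<^sup>2 = n\<^sup>2 - 2 * n + 1" for n :: int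
    by (simp_all add: power2_eq_square algebra_simps)
  obtain W1 where W1: "((\<lambda>r. q powi (18 * r\<^sup>2 + 18 * r + 3 * int 1 * r + 12 + 2 * int 1)) has_sum W1) UNIV"
  proof -
    obtain S where "((\<lambda>n::int. q powi (18 * n\<^sup>2 + (int 3 - 18) * n + 11)) has_sum S) UNIV"
      using th[of 3 11] by auto
    from ext[OF has_sum_int_shift[OF this, of 1] refl] show ?thesis
      by (rule that) (simp add: expand algebra_simps)
  qed
  obtain W5 where W5: "((\<lambda>r. q powi (18 * r\<^sup>2 + 18 * r + 3 * int 5 * r + 12 + 2 * int 5)) has_sum W5) UNIV"
  proof -
    obtain S where "((\<lambda>n::int. q powi (18 * n\<^sup>2 + (int 15 - 18) * n + 7)) has_sum S) UNIV"
      using th[of 15 7] by auto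
    from ext[OF has_sum_int_shift[OF this, of 1] refl] show ?thesis
      by (rule that) (simp add: expand algebra_simps)
  qed
  have a: "J2 q 1 12 * J2 q 10 24 = J q 24 * (X - Y)"
  proof -
    have X1: "((\<lambda>r. q powi (18 * r\<^sup>2 - 6 * r + 3 * int 1 * r)) has_sum X) UNIV"
      by (rule ext[OF X refl]) simp
    have Y1: "((\<lambda>r. q powi (18 * r\<^sup>2 + 6 * r + 3 * int 1 * r + int 1)) has_sum Y) UNIV"
      by (rule ext[OF Y refl]) simp
    show ?thesis
      using quintuple_product[OF q, of 1, OF _ _ X1 Y1 W1] by simp
  qed
  have b: "q * (J2 q 5 12 * J2 q 2 24) = J q 24 * (Y - Z)"
  proof -
    \<comment> \<open>For \<open>e = 5\<close> the exponents are those of \<open>Y\<close> and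
      \<open>Z\<close> lowered by one; the factor \<open>q\<close> in front of
      \<open>J2 q 5 12 * J2 q 2 24\<close> compensates.\<close>
    have mv: "((\<lambda>r::int. q powi (e r - 1)) has_sum q powi (- 1) * v) UNIV" if "((\<lambda>r. q powi (e r)) has_sum v) UNIV" for e v
    proof -
      have "q powi (e r - 1) = q powi (- 1) * q powi (e r)" for r
        by (simp only: padd[symmetric] uminus_add_conv_diff)
      thus ?thesis
        using has_sum_cmult_right[OF that, of "q powi (- 1)"] by simp
    qed
    have Y5: "((\<lambda>r. q powi (18 * r\<^sup>2 - 6 * r + 3 * int 5 * r)) has_sum q powi (- 1) * Y) UNIV"
      by (rule ext[OF mv[OF Y] refl]) simp
    have Z5: "((\<lambda>r. q powi (18 * r\<^sup>2 + 6 * r + 3 * int 5 * r + int 5)) has_sum q powi (- 1) * Z) UNIV"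
      by (rule ext[OF has_sum_int_shift[OF mv[OF Z], of 1] refl]) (simp add: expand algebra_simps)
    have "J2 q 5 12 * J2 q 2 24 = J q 24 * (q powi (- 1) * Y - q powi (- 1) * Z)"
      using quintuple_product[OF q, of 5, OF _ _ Y5 Z5 W5] by simp
    thus ?thesis
      using q by (simp add: power_int_minus field_simps)
  qed
  have tri: "2 * r * (2 * r - 1) div 2 = r * (2 * r - 1)" "(2 * r - 1) * (2 * r - 1 - 1) div 2 = (2 * r - 1) * (r - 1)"
    "3 * (2 * r) * (3 * (2 * r) - 1) div 2 = 3 * r * (6 * r - 1)"
    "3 * (2 * r - 1) * (3 * (2 * r - 1) - 1) div 2 = (6 * r - 3) * (3 * r - 2)"
    "(3 * (2 * r) + 2) * (3 * (2 * r) + 2 - 1) div 2 = (3 * r + 1) * (6 * r + 1)"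
    "(3 * (2 * r - 1) + 2) * (3 * (2 * r - 1) + 2 - 1) div 2 = (6 * r - 1) * (3 * r - 1)" for r :: int
  proof -
    have half: "a div 2 = b" if "a = 2 * b" for a b :: int
      using that by simp
    show "2 * r * (2 * r - 1) div 2 = r * (2 * r - 1)" "(2 * r - 1) * (2 * r - 1 - 1) div 2 = (2 * r - 1) * (r - 1)"
      "3 * (2 * r) * (3 * (2 * r) - 1) div 2 = 3 * r * (6 * r - 1)"
      "3 * (2 * r - 1) * (3 * (2 * r - 1) - 1) div 2 = (6 * r - 3) * (3 * r - 2)"
      "(3 * (2 * r) + 2) * (3 * (2 * r) + 2 - 1) div 2 = (3 * r + 1) * (6 * r + 1)"
      "(3 * (2 * r - 1) + 2) * (3 * (2 * r - 1) + 2 - 1) div 2 = (6 * r - 1) * (3 * r - 1)"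
      by (rule half; simp add: algebra_simps)+
  qed
  have pw: "norm (q ^ n) < 1" if "n > 0" for n
    using q that by (simp add: norm_power power_less_one_iff)
  \<comment> \<open>\<open>(q^3;q^3)_inf\<close> is the product of the classes 3, 6, 9 modulo 9, a
    theta series with signs. Its terms with even index sum to \<open>X\<close> and those with odd
    index to \<open>- Z\<close>.\<close>
  have XZ: "J q 3 = X - Z"
  proof -
    let ?f = "\<lambda>k. ?s k * q powi (int 9 * (k * (k - 1) div 2) + int 6 * k)"
    have "(?f has_sum (qpoch_inf (q ^ 6) (q ^ 9) * qpoch_inf (q ^ 3) (q ^ 9) * qpoch_inf (q ^ 9) (q ^ 9))) UNIV"
      using theta_has_sum[OF q, of 6 9 "-1"] by simp
    moreover have "qpoch_inf (q ^ 6) (q ^ 9) * qpoch_inf (q ^ 3) (q ^ 9) * qpoch_inf (q ^ 9) (q ^ 9) = J q 3"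
      using qpoch_thirds[OF pw[of 3]] P_nonzero[OF pw[of 9]]
      by (simp add: J_eq_P field_simps flip: power_mult) (simp add: P_def mult_ac)
    moreover have "(?f has_sum (X + (- Z))) UNIV"
    proof (rule has_sum_int_parity)
      have "((\<lambda>r. q powi (int 9 * (2 * r * (2 * r - 1) div 2) + int 6 * (2 * r))) has_sum X) UNIV"
        by (rule ext[OF has_sum_int_reflect[OF X, of 0] refl]) (simp add: tri power2_eq_square algebra_simps)
      thus "((\<lambda>r. ?f (2 * r)) has_sum X) UNIV"
        by simp
      have "((\<lambda>r. q powi (int 9 * ((2 * r - 1) * (2 * r - 1 - 1) div 2) + int 6 * (2 * r - 1))) has_sum Z) UNIV"
        by (rule ext[OF Z refl]) (simp add: tri power2_eq_square algebra_simps)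
      moreover have "?s (2 * r - 1) = - 1" for r
        by (simp add: power_int_diff)
      ultimately show "((\<lambda>r. ?f (2 * r - 1)) has_sum - Z) UNIV"
        using has_sum_uminusI by (simp only: mult_minus1) blast
    qed
    ultimately show ?thesis
      using has_sum_unique by fastforce
  qed
  define w :: complex where "w = Complex (- 1 / 2) (sqrt 3 / 2)"
  have w: "1 + w + w\<^sup>2 = 0"
    by (simp add: w_def complex_eq_iff power2_eq_square field_simps)
  hence w1: "1 + w = - (w\<^sup>2)"
    by (simp add: eq_neg_iff_add_eq_0)
  have w3: "w ^ 3 = 1"
    using arg_cong[OF w, of "\<lambda>z. z * (w - 1)"] by (simp add: power2_eq_square power3_eq_cube algebra_simps)
  have w0: "w \<noteq> 0"
    using w3 by auto
  have nw: "norm w = 1"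
    using power_eq_imp_eq_base[of "norm w" 3 1] w3 by (simp flip: norm_power)
  \<comment> \<open>In the theta series at \<open>y = w\<close> the triangular exponents agree, up
    to reflection, on the classes 0 and 1 modulo 3 and give \<open>X + Z\<close> with weights 1 and
    \<open>w\<close>. The class 2 gives \<open>Y\<close> twice with weight \<open>w^2\<close>. As
    \<open>1 + w = - w^2\<close>, the total is \<open>- w^2 (X + Z - 2 Y)\<close>.\<close>
  have XYZ: "X + Z - 2 * Y = J q 6 * (J q 1)\<^sup>2 / (J q 3 * J q 2)"
  proof -
    have "(theta_term w q has_sum qpoch_inf (- w) q * qpoch_inf (- (q / w)) q * qpoch_inf q q) UNIV"
      using nw by (intro jacobi_triple_product q) (use q in simp)
    moreover have "(theta_term w q has_sum (X + Z) + w * (X + Z) + w\<^sup>2 * (Y + Y)) UNIV"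
    proof (rule has_sum_int_mod3)
      have w3r: "w powi (3 * r) = 1" for r
        using w3 by (simp add: power_int_mult)
      have U: "((\<lambda>r. q powi (3 * r * (3 * r - 1) div 2)) has_sum (X + Z)) UNIV"
      proof (rule has_sum_int_parity)
        show "((\<lambda>r. q powi (3 * (2 * r) * (3 * (2 * r) - 1) div 2)) has_sum X) UNIV"
          by (rule ext[OF X refl]) (simp add: tri power2_eq_square algebra_simps)
        show "((\<lambda>r. q powi (3 * (2 * r - 1) * (3 * (2 * r - 1) - 1) div 2)) has_sum Z) UNIV"
          by (rule ext[OF has_sum_int_reflect[OF Z, of 1] refl]) (simp add: tri expand power2_eq_square algebra_simps)
      qed
      show "((\<lambda>r. theta_term w q (3 * r)) has_sum (X + Z)) UNIV"
        using U by (simp add: theta_term_def w3r)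
      have "((\<lambda>r. q powi ((3 * r + 1) * (3 * r + 1 - 1) div 2)) has_sum (X + Z)) UNIV"
        by (rule ext[OF has_sum_int_reflect[OF U, of 0] refl], rule arg_cong[of _ _ "\<lambda>z. z div 2"]) (simp add: algebra_simps)
      from has_sum_cmult_right[OF this, of w]
      show "((\<lambda>r. theta_term w q (3 * r + 1)) has_sum w * (X + Z)) UNIV"
        using w0 by (simp add: theta_term_def w3r power_int_add)
      have "((\<lambda>r. q powi ((3 * r + 2) * (3 * r + 2 - 1) div 2)) has_sum (Y + Y)) UNIV"
      proof (rule has_sum_int_parity)
        show "((\<lambda>r. q powi ((3 * (2 * r) + 2) * (3 * (2 * r) + 2 - 1) div 2)) has_sum Y) UNIV"
          by (rule ext[OF Y refl]) (simp only: tri, simp add: power2_eq_square algebra_simps)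
        show "((\<lambda>r. q powi ((3 * (2 * r - 1) + 2) * (3 * (2 * r - 1) + 2 - 1) div 2)) has_sum Y) UNIV"
          by (rule ext[OF has_sum_int_reflect[OF Y, of 0] refl]) (simp only: tri, simp add: power2_eq_square algebra_simps)
      qed
      from has_sum_cmult_right[OF this, of "w\<^sup>2"]
      show "((\<lambda>r. theta_term w q (3 * r + 2)) has_sum w\<^sup>2 * (Y + Y)) UNIV"
        using w0 by (simp add: theta_term_def w3r power_int_add)
    qed
    ultimately have "qpoch_inf (- w) q * qpoch_inf (- (q / w)) q * qpoch_inf q q = (1 + w) * (X + Z) + w\<^sup>2 * (Y + Y)"
      using has_sum_unique by (fastforce simp: algebra_simps)
    also have "\<dots> = - (w\<^sup>2) * (X + Z - 2 * Y)"
      unfolding w1 by (simp add: algebra_simps)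
    also have "q / w = w\<^sup>2 * q"
      using w0 w3 by (simp add: field_simps power2_eq_square power3_eq_cube)
    \<comment> \<open>The first factor \<open>1 + w\<close> of the product is the same unit
      \<open>- w^2\<close> that stands before the series side.\<close>
    also have "qpoch_inf (- w) q = - (w\<^sup>2) * qpoch_inf (- (w * q)) q"
      using qpoch_inf_unfold[OF q(1), of "- w"] w1 by simp
    finally have main: "X + Z - 2 * Y = qpoch_inf (- (w * q)) q * qpoch_inf (- (w\<^sup>2 * q)) q * P q"
      using w0 by (simp add: P_def mult_ac)
    \<comment> \<open>Factor by factor:
      \<open>(1 + x) (1 + w x) (1 + w^2 x) = 1 + x^3\<close>.\<close>
    have "qpoch_inf (- q) q * qpoch_inf (- (w * q)) q * qpoch_inf (- (w\<^sup>2 * q)) q = qpoch_inf (- (q ^ 3)) (q ^ 3)"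
    proof (rule LIMSEQ_unique)
      show "(\<lambda>n. qpoch (- q) q n * qpoch (- (w * q)) q n * qpoch (- (w\<^sup>2 * q)) q n) \<longlonglongrightarrow>
          qpoch_inf (- q) q * qpoch_inf (- (w * q)) q * qpoch_inf (- (w\<^sup>2 * q)) q"
        by (intro tendsto_mult qpoch_tendsto q)
      have "qpoch (- q) q n * qpoch (- (w * q)) q n * qpoch (- (w\<^sup>2 * q)) q n = qpoch (- (q ^ 3)) (q ^ 3) n" for n
      proof -
        have "(1 - (- q) * q ^ k) * (1 - (- (w * q)) * q ^ k) * (1 - (- (w\<^sup>2 * q)) * q ^ k) = 1 - (- (q ^ 3)) * (q ^ 3) ^ k" for k
        proof -
          have eq: "(1 - (- q) * x) * (1 - (- (w * q)) * x) * (1 - (- (w\<^sup>2 * q)) * x)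
            = 1 + q ^ 3 * x ^ 3 * w ^ 3 + (1 + w + w\<^sup>2) * (q * x + w * (q * x)\<^sup>2)" for x
            by algebra
          have pk: "(q ^ 3) ^ k = (q ^ k) ^ 3"
            by (simp add: mult.commute flip: power_mult)
          show ?thesis
            unfolding eq w w3 pk by simp
        qed
        thus ?thesis
          unfolding qpoch_def prod.distrib[symmetric] by simp
      qed
      thus "(\<lambda>n. qpoch (- q) q n * qpoch (- (w * q)) q n * qpoch (- (w\<^sup>2 * q)) q n) \<longlonglongrightarrow> qpoch_inf (- (q ^ 3)) (q ^ 3)"
        using qpoch_tendsto[OF pw[of 3]] by simp
    qed
    hence "(P (q\<^sup>2) / P q) * (qpoch_inf (- (w * q)) q * qpoch_inf (- (w\<^sup>2 * q)) q) = P (q ^ 6) / P (q ^ 3)"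
      using qpoch_minus_base[OF q(1)] qpoch_minus_base[OF pw[of 3]] by (simp add: mult.assoc flip: power_mult)
    thus ?thesis
      unfolding main J_eq_P using P_nonzero[OF q(1)] P_nonzero[OF pw[of 2]] P_nonzero[OF pw[of 3]]
      by (simp add: field_simps power2_eq_square)
  qed
  show ?T1
    unfolding a b XZ by (simp add: algebra_simps)
  have "J2 q 1 12 * J2 q 10 24 - q * (J2 q 5 12 * J2 q 2 24) = J q 24 * (X + Z - 2 * Y)"
    unfolding a b by (simp add: algebra_simps)
  thus ?T2
    unfolding XYZ by (simp add: mult_ac)
qed

lemma norm_power_less_one:
  fixes q :: complex
  assumes "norm q < 1" "n > 0"
  shows "norm (q ^ n) < 1"
  using assms by (simp add: norm_power power_less_one_iff)

section \<open>Ramanujan's theta functions psi and phi as bilateral series\<close>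

lemma psi_has_sum:
  assumes q: "norm q < 1" "q \<noteq> 0"
  shows "((\<lambda>i::int. q powi (2 * i\<^sup>2 + i)) has_sum ((P (q\<^sup>2))\<^sup>2 / P q)) UNIV"
proof -
  have pw: "norm (q\<^sup>2) < 1" "norm (q ^ 4) < 1"
    using q by (auto intro: norm_power_less_one)
  have e: "- q * q\<^sup>2 = - (q ^ 3)"
    by (simp add: power2_eq_square power3_eq_cube)
  have e': "(q\<^sup>2)\<^sup>2 = q ^ 4"
    by (simp flip: power_mult)
  have "qpoch_inf (- (q ^ 3)) (q ^ 4) * qpoch_inf (- q) (q ^ 4) * P (q ^ 4) = (P (q\<^sup>2))\<^sup>2 / (P q * P (q ^ 4)) * P (q ^ 4)"
    using qpoch_inf_split2[OF pw(1), of "- q"] unfolding e e' qpoch_minus_odd[OF q(1)] by (simp add: mult.commute)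
  also have "\<dots> = (P (q\<^sup>2))\<^sup>2 / P q"
    using P_nonzero[OF pw(2)] by simp
  finally have v: "qpoch_inf (- (q ^ 3)) (q ^ 4) * qpoch_inf (- q) (q ^ 4) * P (q ^ 4) = (P (q\<^sup>2))\<^sup>2 / P q" .
  have ex: "int 2 * (k * (k - 1)) + int 3 * k = 2 * k\<^sup>2 + k" for k
    by (simp add: power2_eq_square algebra_simps)
  have "((\<lambda>k. 1 powi k * q powi (int 2 * (k * (k - 1)) + int 3 * k)) has_sum
      qpoch_inf (- 1 * q ^ 3) (q ^ (2 * 2)) * qpoch_inf (- 1 * q ^ (2 * 2 - 3)) (q ^ (2 * 2)) * qpoch_inf (q ^ (2 * 2)) (q ^ (2 * 2))) UNIV"
    by (rule theta_has_sum_even[OF q]) auto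
  thus ?thesis
    using v unfolding ex by (simp add: P_def)
qed

lemma phi_has_sum:
  assumes q: "norm q < 1" "q \<noteq> 0"
  shows "((\<lambda>i::int. q powi (i\<^sup>2)) has_sum (P (q\<^sup>2) ^ 5 / ((P q)\<^sup>2 * (P (q ^ 4))\<^sup>2))) UNIV"
proof -
  have "qpoch_inf (- q) (q\<^sup>2) * qpoch_inf (- q) (q\<^sup>2) * P (q\<^sup>2) = P (q\<^sup>2) ^ 5 / ((P q)\<^sup>2 * (P (q ^ 4))\<^sup>2)"
    unfolding qpoch_minus_odd[OF q(1)] by (simp add: power2_eq_square power_numeral_reduce mult_ac)
  moreover have "k * (k - 1) + k = k\<^sup>2" for k :: int
    by (simp add: power2_eq_square algebra_simps)
  ultimately show ?thesis
    using theta_has_sum_even[OF q, of 1 1 1] by (simp add: P_def)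
qed

text \<open>In Ramanujan's notation
  \<open>psi(q) psi(q^3) + psi(-q) psi(-q^3) = 2 psi(q^4) phi(q^6)\<close>. As
  \<open>psi(-q) psi(-q^3)\<close> is \<open>J_1 J_3\<close> times a function of \<open>q^2\<close>,
  this is the even part of the dissection of \<open>J_1 J_3\<close>. In the double series only
  \<open>i\<close>, \<open>j\<close> of equal parity survive; the classes of \<open>i - j\<close>
  modulo 4 produce the even and the odd part of \<open>phi(q^6)\<close>.\<close>

lemma psi_product:
  assumes q: "norm q < 1" "q \<noteq> 0"
  shows "(P (q\<^sup>2))\<^sup>2 / P q * ((P ((q ^ 3)\<^sup>2))\<^sup>2 / P (q ^ 3))
      + (P ((- q)\<^sup>2))\<^sup>2 / P (- q) * ((P (((- q) ^ 3)\<^sup>2))\<^sup>2 / P ((- q) ^ 3))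
    = 2 * ((P ((q ^ 4)\<^sup>2))\<^sup>2 / P (q ^ 4) * (P ((q ^ 6)\<^sup>2) ^ 5 / ((P (q ^ 6))\<^sup>2 * (P ((q ^ 6) ^ 4))\<^sup>2)))"
    (is "?a * ?b + ?a' * ?b' = 2 * (?A * ?V)")
proof -
  note padd = power_int_add[of q, OF disjI1[OF q(2)]]
  let ?s = "\<lambda>k::int. (- 1 :: complex) powi k"
  have pw: "norm (q ^ 3) < 1" "norm (q ^ 4) < 1" "norm (q ^ 6) < 1" "norm (q ^ 24) < 1" "norm (q ^ 48) < 1"
    using q by (auto intro!: norm_power_less_one)
  have abs: "(\<lambda>k. norm (h k)) summable_on UNIV" if "(h has_sum v) UNIV" for h :: "int \<Rightarrow> complex" and v
    by (rule summable_on_iff_abs_summable_on_complex[THEN iffD1, OF has_sum_imp_summable[OF that]])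
  let ?f = "\<lambda>i::int. q powi (2 * i\<^sup>2 + i)" and ?g = "\<lambda>j::int. (q ^ 3) powi (2 * j\<^sup>2 + j)"
  let ?f' = "\<lambda>i::int. (- q) powi (2 * i\<^sup>2 + i)" and ?g' = "\<lambda>j::int. ((- q) ^ 3) powi (2 * j\<^sup>2 + j)"
  have sums: "(?f has_sum ?a) UNIV" "(?g has_sum ?b) UNIV" "(?f' has_sum ?a') UNIV" "(?g' has_sum ?b') UNIV"
    by (rule psi_has_sum; use q pw in simp)+
  let ?h = "\<lambda>(i, j). ?f i * ?g j + ?f' i * ?g' j"
  have "((\<lambda>z. (case z of (i, j) \<Rightarrow> ?f i * ?g j) + (case z of (i, j) \<Rightarrow> ?f' i * ?g' j)) has_sum (?a * ?b + ?a' * ?b')) (UNIV \<times> UNIV)"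
    by (intro has_sum_add has_sum_times abs sums; rule sums)
  hence total: "(?h has_sum (?a * ?b + ?a' * ?b')) UNIV"
    by (simp add: case_prod_unfold)
  \<comment> \<open>\<open>2 i^2 + i\<close> has the parity of \<open>i\<close>, so replacing
    \<open>q\<close> by \<open>- q\<close> multiplies the term by the sign of
    \<open>i + j\<close>.\<close>
  have hval: "?h (i, j) = (1 + ?s (i + j)) * q powi (2 * i\<^sup>2 + i + 6 * j\<^sup>2 + 3 * j)" for i j
  proof -
    have sg: "?s (2 * i\<^sup>2 + i) = ?s i" for i
      by (simp add: power_int_add)
    have "?g j = q powi (6 * j\<^sup>2 + 3 * j)" for j
      unfolding power_int_power by (simp add: algebra_simps)
    moreover have "?f' i = ?s i * ?f i" for i
      using power_int_mult_distrib[of "-1" q "2 * i\<^sup>2 + i"] by (simp add: sg)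
    moreover have "?g' j = ?s j * ?g j" for j
      using power_int_mult_distrib[of "-1" "q ^ 3" "2 * j\<^sup>2 + j"] by (simp add: sg)
    moreover have "q powi (2 * i\<^sup>2 + i + 6 * j\<^sup>2 + 3 * j) = ?f i * q powi (6 * j\<^sup>2 + 3 * j)"
      by (simp only: padd[symmetric] add.assoc)
    moreover have "?s (i + j) = ?s i * ?s j"
      by (simp add: power_int_add)
    ultimately show ?thesis
      by (simp add: algebra_simps)
  qed
  have se: "?s k = (if even k then 1 else - 1)" for k
    by (auto elim!: evenE oddE simp: power_int_add)
  have A: "((\<lambda>u::int. q powi (8 * u\<^sup>2 + 4 * u)) has_sum ?A) UNIV"
  proof -
    have "(q ^ 4) powi (2 * u\<^sup>2 + u) = q powi (8 * u\<^sup>2 + 4 * u)" for u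
      unfolding power_int_power by (simp add: algebra_simps)
    thus ?thesis
      using psi_has_sum[OF pw(2)] q by simp
  qed
  obtain V0 where V0: "((\<lambda>v::int. q powi (24 * v\<^sup>2)) has_sum V0) UNIV"
    using phi_has_sum[OF pw(4)] q unfolding power_int_power by auto
  \<comment> \<open>This is the case of linear coefficient 0, outside the range \<open>0 < a\<close>
    of the theta lemmas; only summability is needed.\<close>
  obtain V1 where V1: "((\<lambda>v::int. q powi (24 * v\<^sup>2 - 24 * v + 6)) has_sum V1) UNIV"
  proof -
    obtain S where "(theta_term 1 (q ^ 48) has_sum S) UNIV"
      using abs_summable_summable[OF theta_term_abs_summable[OF pw(5)], of 1] q by (auto simp: summable_on_def)
    from has_sum_cmult_right[OF this, of "q powi 6"]
    have S: "((\<lambda>v. q powi 6 * theta_term 1 (q ^ 48) v) has_sum q powi 6 * S) UNIV" .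
    have "q powi 6 * theta_term 1 (q ^ 48) v = q powi (24 * v\<^sup>2 - 24 * v + 6)" for v
    proof -
      have "48 * (v * (v - 1) div 2) = 24 * (v * (v - 1))"
        using two_int_triangle[of v] by linarith
      hence "q powi 6 * theta_term 1 (q ^ 48) v = q powi (6 + 24 * (v * (v - 1)))"
        unfolding theta_term_def power_int_power padd by (simp only: power_int_1_left mult_1_left of_nat_numeral)
      also have "6 + 24 * (v * (v - 1)) = 24 * v\<^sup>2 - 24 * v + 6"
        by (simp add: power2_eq_square algebra_simps)
      finally show ?thesis .
    qed
    thus ?thesis
      using S that by simp
  qed
  have V: "?V = V0 + V1"
  proof -
    have "((\<lambda>k::int. q powi (6 * k\<^sup>2)) has_sum ?V) UNIV"
      using phi_has_sum[OF pw(3)] q unfolding power_int_power by simp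
    moreover have "((\<lambda>k::int. q powi (6 * k\<^sup>2)) has_sum (V0 + V1)) UNIV"
    proof (rule has_sum_int_parity)
      have "6 * (2 * r)\<^sup>2 = 24 * r\<^sup>2" "6 * (2 * r - 1)\<^sup>2 = 24 * r\<^sup>2 - 24 * r + 6" for r :: int
        by (simp_all add: power2_eq_square algebra_simps)
      thus "((\<lambda>r::int. q powi (6 * (2 * r)\<^sup>2)) has_sum V0) UNIV" "((\<lambda>r::int. q powi (6 * (2 * r - 1)\<^sup>2)) has_sum V1) UNIV"
        using V0 V1 by simp_all
    qed
    ultimately show ?thesis
      by (rule has_sum_unique)
  qed
  \<comment> \<open>\<open>i = u + 3 v\<close>, \<open>j = u - v\<close> turns
    \<open>2 i^2 + 6 j^2\<close> into \<open>8 u^2 + 24 v^2\<close>, and the linear part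
    \<open>i + 3 j\<close> into \<open>4 u\<close>.\<close>
  have "(?h has_sum (2 * ?A * V0)) {(i, j). (i - j) mod 4 = 0}"
  proof (rule has_sum_bijI[where h = "\<lambda>(u, v). (u + 3 * v, u - v)" and g = "\<lambda>(i, j). (j + (i - j) div 4, (i - j) div 4)"])
    have "((\<lambda>(u, v). 2 * q powi (8 * u\<^sup>2 + 4 * u) * q powi (24 * v\<^sup>2)) has_sum (2 * ?A * V0)) (UNIV \<times> UNIV)"
      by (intro has_sum_times abs[OF has_sum_cmult_right[OF A]] abs[OF V0] has_sum_cmult_right A V0)
    moreover have "?h (u + 3 * v, u - v) = 2 * q powi (8 * u\<^sup>2 + 4 * u) * q powi (24 * v\<^sup>2)" for u v
    proof -
      have "2 * (u + 3 * v)\<^sup>2 + (u + 3 * v) + 6 * (u - v)\<^sup>2 + 3 * (u - v) = (8 * u\<^sup>2 + 4 * u) + 24 * v\<^sup>2"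
        by (simp add: power2_eq_square algebra_simps)
      moreover have "even ((u + 3 * v) + (u - v))"
        by presburger
      ultimately show ?thesis
        unfolding hval se by (simp only: padd if_True mult.assoc) simp
    qed
    ultimately show "((\<lambda>z. ?h ((\<lambda>(u, v). (u + 3 * v, u - v)) z)) has_sum (2 * ?A * V0)) (UNIV \<times> UNIV)"
      by (simp add: case_prod_unfold)
  next
    fix y :: "int \<times> int" assume "y \<in> {(i, j). (i - j) mod 4 = 0}"
    moreover obtain i j where ij: "y = (i, j)" by (cases y)
    ultimately have "4 * ((i - j) div 4) = i - j" by auto
    thus "(\<lambda>(u, v). (u + 3 * v, u - v)) ((\<lambda>(i, j). (j + (i - j) div 4, (i - j) div 4)) y) = y"
      by (simp add: ij)
  qed auto
  \<comment> \<open>The reflected substitution is chosen so that the \<open>u\<close> part is again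
    \<open>8 u^2 + 4 u\<close>; the \<open>v\<close> part becomes
    \<open>6 (2 v - 1)^2\<close>.\<close>
  moreover have "(?h has_sum (2 * ?A * V1)) {(i, j). (i - j) mod 4 = 2}"
  proof (rule has_sum_bijI[where h = "\<lambda>(u, v). (- 2 - u + 3 * v, - u - v)" and g = "\<lambda>(i, j). (- j - (i - j + 2) div 4, (i - j + 2) div 4)"])
    have "((\<lambda>(u, v). 2 * q powi (8 * u\<^sup>2 + 4 * u) * q powi (24 * v\<^sup>2 - 24 * v + 6)) has_sum (2 * ?A * V1)) (UNIV \<times> UNIV)"
      by (intro has_sum_times abs[OF has_sum_cmult_right[OF A]] abs[OF V1] has_sum_cmult_right A V1)
    moreover have "?h (- 2 - u + 3 * v, - u - v) = 2 * q powi (8 * u\<^sup>2 + 4 * u) * q powi (24 * v\<^sup>2 - 24 * v + 6)" for u v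
    proof -
      have "2 * (- 2 - u + 3 * v)\<^sup>2 + (- 2 - u + 3 * v) + 6 * (- u - v)\<^sup>2 + 3 * (- u - v) = (8 * u\<^sup>2 + 4 * u) + (24 * v\<^sup>2 - 24 * v + 6)"
        by (simp add: power2_eq_square algebra_simps)
      moreover have "even ((- 2 - u + 3 * v) + (- u - v))"
        by presburger
      ultimately show ?thesis
        unfolding hval se by (simp only: padd if_True mult.assoc) simp
    qed
    ultimately show "((\<lambda>z. ?h ((\<lambda>(u, v). (- 2 - u + 3 * v, - u - v)) z)) has_sum (2 * ?A * V1)) (UNIV \<times> UNIV)"
      by (simp add: case_prod_unfold)
  next
    fix y :: "int \<times> int" assume "y \<in> {(i, j). (i - j) mod 4 = 2}"
    moreover obtain i j where ij: "y = (i, j)" by (cases y)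
    ultimately have "4 * ((i - j + 2) div 4) = i - j + 2" by simp presburger
    thus "(\<lambda>(u, v). (- 2 - u + 3 * v, - u - v)) ((\<lambda>(i, j). (- j - (i - j + 2) div 4, (i - j + 2) div 4)) y) = y"
      by (simp add: ij)
  next
    fix x :: "int \<times> int"
    obtain u v where uv: "x = (u, v)" by (cases x)
    have "(- 2 - u + 3 * v) - (- u - v) = 4 * v - 2" by simp
    moreover have "(4 * v - 2) mod 4 = 2" by presburger
    ultimately show "(\<lambda>(u, v). (- 2 - u + 3 * v, - u - v)) x \<in> {(i, j). (i - j) mod 4 = 2}"
      by (simp add: uv)
  qed auto
  ultimately have "(?h has_sum (2 * ?A * V0 + 2 * ?A * V1)) ({(i, j). (i - j) mod 4 = 0} \<union> {(i, j). (i - j) mod 4 = 2})"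
    by (rule has_sum_Un_disjoint) auto
  also have "?this \<longleftrightarrow> (?h has_sum (2 * ?A * V0 + 2 * ?A * V1)) UNIV"
  proof (rule has_sum_cong_neutral)
    fix z :: "int \<times> int"
    assume z: "z \<in> UNIV - ({(i, j). (i - j) mod 4 = 0} \<union> {(i, j). (i - j) mod 4 = 2})"
    obtain i j where ij: "z = (i, j)" by (cases z)
    have "(i - j) mod 4 \<noteq> 0" "(i - j) mod 4 \<noteq> 2"
      using z by (auto simp: ij)
    hence "odd (i + j)" by presburger
    thus "?h z = 0"
      unfolding ij hval se by simp
  qed auto
  finally have "?a * ?b + ?a' * ?b' = 2 * ?A * V0 + 2 * ?A * V1"
    by (rule has_sum_unique[OF total])
  thus ?thesis
    unfolding V by (simp only: distrib_left mult.assoc)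
qed

lemma qpoch_inf_tendsto_prod:
  assumes "norm p < 1"
  shows "(\<lambda>n. \<Prod>j<n. 1 - a * p ^ j) \<longlonglongrightarrow> qpoch_inf a p"
  using qpoch_tendsto[OF assms, of a] by (simp add: qpoch_def)

section \<open>Families with denominators of period three\<close>

text \<open>At \<open>s = 1\<close> the product of the first \<open>n\<close> ratios, each times
  \<open>q ^ k\<close>, is
  \<open>(-1;q)_n (-q^2;q^2)_n q^(n(n+1)/2) / ((q;q^2)_n (q^3;q^3)_n)\<close>. Denominators have the
  form \<open>1 - q * u\<close> so that the bounds for \<open>norm u \<le> 1\<close> apply
  directly.\<close>

definition rF' :: "complex \<Rightarrow> complex \<Rightarrow> complex \<Rightarrow> complex" where
  "rF' q s X = (1 + s * X) * (s + q\<^sup>2 * X\<^sup>2) * q / ((1 - q * (s\<^sup>2 * X\<^sup>2)) * (1 - q * (q\<^sup>2 * X ^ 3)))"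

definition F' :: "complex \<Rightarrow> complex \<Rightarrow> complex" where
  "F' q s = (\<Sum>n. (\<Prod>k<n. rF' q s (q ^ k) * q ^ k))"

text \<open>Under \<open>s -> s q^2\<close> the factors in \<open>s X\<close> move two steps in the
  index and \<open>s + q^2 X^2\<close> moves one step back, so both members are rational multiples
  of one product, with ratio \<open>?e\<close> and multipliers \<open>?\<phi>\<close> and
  \<open>?\<psi>\<close>. The condition \<open>s \<noteq> -1\<close> permits cancelling the common
  factor \<open>1 + s\<close> of their values at \<open>X = 1\<close>.\<close>

lemma F'_step:
  assumes q: "norm q < 1" and s: "norm s \<le> 1" "s \<noteq> -1"
  shows "(1 - q * s\<^sup>2) * (1 - q ^ 3 * s\<^sup>2) * F' q s = (1 + q ^ 3 * s ^ 3) * (1 + s * q) * F' q (s * q\<^sup>2)"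
proof -
  let ?e = "\<lambda>X. (1 + s * X) * (s + X\<^sup>2) * q / ((1 - q * (q ^ 4 * s\<^sup>2 * X\<^sup>2)) * (1 - q * (q\<^sup>2 * X ^ 3)))"
  let ?\<phi> = "\<lambda>X. (s + X\<^sup>2) * (1 - q * (s\<^sup>2 * X\<^sup>2)) * (1 - q * (q\<^sup>2 * s\<^sup>2 * X\<^sup>2))"
  let ?\<psi> = "\<lambda>X. X\<^sup>2 * (1 + s * X) * (1 + s * q * X)"
  have nz: "1 - q * (s\<^sup>2 * (q ^ n)\<^sup>2) \<noteq> 0" "1 - q * (q\<^sup>2 * (q ^ n) ^ 3) \<noteq> 0"
    "1 - q * (q\<^sup>2 * s\<^sup>2 * (q ^ n)\<^sup>2) \<noteq> 0" "1 - q * (q ^ 4 * s\<^sup>2 * (q ^ n)\<^sup>2) \<noteq> 0" for n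
    by (rule one_minus_mult_neq_0[OF q];
        simp add: norm_mult norm_power mult_le_one power_le_one q s less_imp_le[OF q])+
  have aux: "a * b * q / (c * d) * x * (e * c * f) = a * e * q / (g * d) * x * (b * f * g)"
    if "c \<noteq> 0" "d \<noteq> 0" "g \<noteq> 0" for a b c d e f g x :: complex
    using that by simp
  have T1: "(\<Prod>k<n. rF' q s (q ^ k) * q ^ k) * ((s + 1) * (1 - q * s\<^sup>2) * (1 - q * (q\<^sup>2 * s\<^sup>2)))
    = (\<Prod>k<n. ?e (q ^ k) * q ^ k) * ?\<phi> (q ^ n)" for n
  proof -
    have "(\<Prod>k<n. rF' q s (q ^ k) * q ^ k) * ?\<phi> (q ^ 0) = (\<Prod>k<n. ?e (q ^ k) * q ^ k) * ?\<phi> (q ^ n)"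
    proof (rule prod_gauge)
      fix k
      have "?\<phi> (q ^ Suc k) = (s + q\<^sup>2 * (q ^ k)\<^sup>2) * (1 - q * (q\<^sup>2 * s\<^sup>2 * (q ^ k)\<^sup>2)) * (1 - q * (q ^ 4 * s\<^sup>2 * (q ^ k)\<^sup>2))"
        by (simp add: power_mult_distrib) algebra
      thus "rF' q s (q ^ k) * q ^ k * ?\<phi> (q ^ k) = ?e (q ^ k) * q ^ k * ?\<phi> (q ^ Suc k)"
        unfolding rF'_def by (simp only: aux nz not_False_eq_True)
    qed
    thus ?thesis by simp
  qed
  have T2: "(\<Prod>k<n. rF' q (s * q\<^sup>2) (q ^ k) * q ^ k) * ((1 + s) * (1 + s * q))
    = (\<Prod>k<n. ?e (q ^ k) * q ^ k) * ?\<psi> (q ^ n)" for n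
  proof -
    have "(\<Prod>k<n. rF' q (s * q\<^sup>2) (q ^ k) * q ^ k) * ?\<psi> (q ^ 0) = (\<Prod>k<n. ?e (q ^ k) * q ^ k) * ?\<psi> (q ^ n)"
    proof (rule prod_gauge)
      fix k
      have *: "q * ((s * q\<^sup>2)\<^sup>2 * (q ^ k)\<^sup>2) = q * (q ^ 4 * s\<^sup>2 * (q ^ k)\<^sup>2)"
        by algebra
      have **: "(1 + s * q\<^sup>2 * X) * (s * q\<^sup>2 + q\<^sup>2 * X\<^sup>2) * (X\<^sup>2 * (1 + s * X) * (1 + s * q * X))
          = (1 + s * X) * (s + X\<^sup>2) * ((q * X)\<^sup>2 * (1 + s * (q * X)) * (1 + s * q * (q * X)))" for X
        by algebra
      show "rF' q (s * q\<^sup>2) (q ^ k) * q ^ k * ?\<psi> (q ^ k) = ?e (q ^ k) * q ^ k * ?\<psi> (q ^ Suc k)"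
        unfolding rF'_def * using **[of "q ^ k"] by (simp add: mult_ac)
    qed
    thus ?thesis by simp
  qed
  have cont: "isCont ?e 0"
    by (intro continuous_intros) auto
  have sum1: "summable (\<lambda>n. \<Prod>k<n. rF' q s' (q ^ k) * q ^ k)" for s'
    using summable_norm_cancel[OF qseries_summable[OF q, of "rF' q s'" "\<lambda>_. 1"]]
    by (simp add: rF'_def[abs_def] continuous_intros)
  \<comment> \<open>The factor \<open>1 - X ^ 3\<close> makes the certificate vanish at
    \<open>n = 0\<close>; at \<open>q * X\<close> it and the quadratic factor cancel the two
    denominators of \<open>?e\<close>.\<close>
  have "(\<Sum>n. (\<Prod>k<n. ?e (q ^ k) * q ^ k) * ?\<phi> (q ^ n))
      - (\<Sum>n. (\<Prod>k<n. ?e (q ^ k) * q ^ k) * ((1 + q ^ 3 * s ^ 3) * ?\<psi> (q ^ n))) = - 0"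
  proof (rule qseries_telescope[OF q cont, where v = ?\<phi> and w = "\<lambda>X. (1 + q ^ 3 * s ^ 3) * ?\<psi> X"
        and G = "\<lambda>X. - (s + q * s\<^sup>2 * X) * (1 - q * (q\<^sup>2 * s\<^sup>2 * X\<^sup>2)) * (1 - X ^ 3)"])
    fix n
    define X where "X = q ^ n"
    have *: "?e X * X * (- (s + q * s\<^sup>2 * (q * X)) * (1 - q * (q\<^sup>2 * s\<^sup>2 * (q * X)\<^sup>2)) * (1 - (q * X) ^ 3))
       = (1 + s * X) * (s + X\<^sup>2) * q * X * (- (s + q * s\<^sup>2 * (q * X)))"
    proof -
      have "a / (c * d) * x * (b * c * d) = a * x * b" if "c \<noteq> 0" "d \<noteq> 0" for a b c d x :: complex
        using that by simp
      moreover have "1 - q * (q\<^sup>2 * s\<^sup>2 * (q * X)\<^sup>2) = 1 - q * (q ^ 4 * s\<^sup>2 * X\<^sup>2)"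
        "1 - (q * X) ^ 3 = 1 - q * (q\<^sup>2 * X ^ 3)"
        by algebra+
      ultimately show ?thesis
        using nz[of n] by (simp only: X_def not_False_eq_True)
    qed
    show "?\<phi> (q ^ n) - (1 + q ^ 3 * s ^ 3) * ?\<psi> (q ^ n) = ?e (q ^ n) * q ^ n *
        (- (s + q * s\<^sup>2 * (q * q ^ n)) * (1 - q * (q\<^sup>2 * s\<^sup>2 * (q * q ^ n)\<^sup>2)) * (1 - (q * q ^ n) ^ 3))
       - (- (s + q * s\<^sup>2 * q ^ n) * (1 - q * (q\<^sup>2 * s\<^sup>2 * (q ^ n)\<^sup>2)) * (1 - (q ^ n) ^ 3))"
      unfolding X_def[symmetric] * by algebra
  qed (auto intro!: continuous_intros)
  hence "(\<Sum>n. (\<Prod>k<n. ?e (q ^ k) * q ^ k) * ?\<phi> (q ^ n))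
      = (\<Sum>n. (\<Prod>k<n. ?e (q ^ k) * q ^ k) * ((1 + q ^ 3 * s ^ 3) * ?\<psi> (q ^ n)))"
    by simp
  also have "(\<Sum>n. (\<Prod>k<n. ?e (q ^ k) * q ^ k) * ?\<phi> (q ^ n))
      = (s + 1) * (1 - q * s\<^sup>2) * (1 - q * (q\<^sup>2 * s\<^sup>2)) * F' q s"
    unfolding T1[symmetric] F'_def by (subst suminf_mult[OF sum1, symmetric]) (simp add: mult_ac)
  also have "(\<Sum>n. (\<Prod>k<n. ?e (q ^ k) * q ^ k) * ((1 + q ^ 3 * s ^ 3) * ?\<psi> (q ^ n)))
      = (1 + q ^ 3 * s ^ 3) * ((1 + s) * (1 + s * q)) * F' q (s * q\<^sup>2)"
    unfolding F'_def suminf_mult[OF sum1, symmetric]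
    by (rule suminf_cong) (use T2 in \<open>simp add: mult_ac\<close>)
  finally have "(1 + s) * ((1 - q * s\<^sup>2) * (1 - q * (q\<^sup>2 * s\<^sup>2)) * F' q s)
      = (1 + s) * ((1 + q ^ 3 * s ^ 3) * (1 + s * q) * F' q (s * q\<^sup>2))"
    by (simp only: mult_ac add_ac)
  moreover have "1 + s \<noteq> 0"
    using s by (simp add: add_eq_0_iff2 add.commute) (metis add.commute add_eq_0_iff)
  ultimately show ?thesis
    by (simp add: power3_eq_cube power2_eq_square mult.assoc)
qed

section \<open>Bounds uniform in the parameter, and the limit at parameter 0\<close>

lemma norm_mult_le_mult:
  fixes a b :: complex
  assumes "norm a \<le> A" "norm b \<le> B"
  shows "norm (a * b) \<le> A * B"
  unfolding norm_mult
  using assms by (intro mult_mono) (auto intro: order_trans[OF norm_ge_zero assms(1)])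

lemma mult_le_norm_mult:
  fixes a b :: complex
  assumes "A \<le> norm a" "B \<le> norm b" "0 \<le> A" "0 \<le> B"
  shows "A * B \<le> norm (a * b)"
  unfolding norm_mult using assms by (intro mult_mono) auto

lemma norm_add_le_two:
  fixes a b :: complex
  assumes "norm a \<le> 1" "norm b \<le> 1"
  shows "norm (a + b) \<le> 2"
  using norm_triangle_ineq[of a b] assms by linarith

lemma norm_mult_le_one:
  fixes a b :: complex
  assumes "norm a \<le> 1" "norm b \<le> 1"
  shows "norm (a * b) \<le> 1"
  using norm_mult_le_mult[OF assms] by simp

lemma norm_pow_le_one:
  fixes a :: complex
  assumes "norm a \<le> 1"
  shows "norm (a ^ n) \<le> 1"
  using assms by (simp add: norm_power power_le_one)

text \<open>Bounds on the closed unit disc in both the parameter and \<open>X\<close> give one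
  majorant for all members; at the limit parameter only continuity of each single factor is
  needed.\<close>

lemma family_tendsto:
  fixes r w :: "complex \<Rightarrow> complex \<Rightarrow> complex" and s :: "nat \<Rightarrow> complex"
  assumes q: "norm q < 1"
    and r: "\<And>x X. norm x \<le> 1 \<Longrightarrow> norm X \<le> 1 \<Longrightarrow> norm (r x X) \<le> C"
    and w: "\<And>x X. norm x \<le> 1 \<Longrightarrow> norm X \<le> 1 \<Longrightarrow> norm (w x X) \<le> B"
    and cont: "\<And>k. isCont (\<lambda>x. r x (q ^ k)) 0" "\<And>k. isCont (\<lambda>x. w x (q ^ k)) 0"
    and s: "\<And>j. norm (s j) \<le> 1" "s \<longlonglongrightarrow> 0"
  shows "(\<lambda>j. \<Sum>n. (\<Prod>k<n. r (s j) (q ^ k) * q ^ k) * w (s j) (q ^ n))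
    \<longlonglongrightarrow> (\<Sum>n. (\<Prod>k<n. r 0 (q ^ k) * q ^ k) * w 0 (q ^ n))"
proof (rule suminf_prod_tendsto)
  show "norm (r (s j) (q ^ k) * q ^ k) \<le> C * norm q ^ k" for j k
    by (intro norm_mult_power_le r s norm_power_le_one q)
  show "norm (w (s j) (q ^ n)) \<le> B" for j n
    by (intro w s norm_power_le_one q)
  show "0 \<le> C"
    using order_trans[OF norm_ge_zero r[of 0 0]] by simp
  show "(\<lambda>j. r (s j) (q ^ k) * q ^ k) \<longlonglongrightarrow> r 0 (q ^ k) * q ^ k" for k
    by (intro tendsto_mult tendsto_const isCont_tendsto_compose[OF cont(1) s(2)])
  show "(\<lambda>j. w (s j) (q ^ n)) \<longlonglongrightarrow> w 0 (q ^ n)" for n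
    by (rule isCont_tendsto_compose[OF cont(2) s(2)])
qed (use q in auto)

lemma geometric_to_0:
  fixes p :: complex
  assumes "norm p < 1"
  shows "(\<lambda>j. x * p ^ j) \<longlonglongrightarrow> 0"
  using tendsto_mult_left[OF LIMSEQ_power_zero[OF assms], of x] by simp

lemma eq_divide_multI:
  fixes a b x y :: complex
  assumes "a * x = b * y" "a \<noteq> 0"
  shows "x = b / a * y"
  using assms by (simp add: field_simps)

text \<open>The step is iterated along \<open>s = q^(2j)\<close>, which never equals -1. The powers
  \<open>s^2\<close> and \<open>s^3\<close> account for the bases \<open>q^4\<close> and
  \<open>q^6\<close>.\<close>

lemma F'_one:
  assumes q: "norm q < 1"
  shows "F' q 1 = qpoch_inf (- (q ^ 3)) (q ^ 6) * qpoch_inf (- q) (q\<^sup>2)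
      / (qpoch_inf q (q ^ 4) * qpoch_inf (q ^ 3) (q ^ 4)) * qpoch_inf (- (q ^ 3)) (q ^ 3)"
proof -
  let ?c = "\<lambda>j. (1 - (- (q ^ 3)) * (q ^ 6) ^ j) * (1 - (- q) * (q\<^sup>2) ^ j)
      / ((1 - q * (q ^ 4) ^ j) * (1 - q ^ 3 * (q ^ 4) ^ j))"
  have q': "norm (q\<^sup>2) < 1" "norm (q ^ 3) < 1" "norm (q ^ 4) < 1" "norm (q ^ 6) < 1"
    by (rule norm_power_less_one[OF q]; simp)+
  have nz: "1 - q * (q ^ 4) ^ j \<noteq> 0" "1 - q ^ 3 * (q ^ 4) ^ j \<noteq> 0" for j
    using one_minus_mult_neq_0[OF q, of "(q ^ 4) ^ j"] one_minus_mult_neq_0[OF q'(2), of "(q ^ 4) ^ j"] q'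
    by auto
  have "F' q ((q\<^sup>2) ^ 0) = qpoch_inf (- (q ^ 3)) (q ^ 6) * qpoch_inf (- q) (q\<^sup>2)
      / (qpoch_inf q (q ^ 4) * qpoch_inf (q ^ 3) (q ^ 4)) * qpoch_inf (- (q ^ 3)) (q ^ 3)"
  proof (rule iterate_first_order[where c = ?c])
    show "F' q ((q\<^sup>2) ^ j) = ?c j * F' q ((q\<^sup>2) ^ Suc j)" for j
    proof -
      have n1: "(q\<^sup>2) ^ j \<noteq> - 1"
      proof (cases "j = 0")
        case False
        hence "norm ((q\<^sup>2) ^ j) < 1"
          using norm_power_less_one[OF q'(1)] by simp
        thus ?thesis by (metis less_irrefl norm_minus_cancel norm_one)
      qed simp
      have "((q\<^sup>2) ^ j)\<^sup>2 = (q ^ 4) ^ j" "((q\<^sup>2) ^ j) ^ 3 = (q ^ 6) ^ j"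
        by (simp_all flip: power_mult add: mult.commute)
      hence "(1 - q * (q ^ 4) ^ j) * (1 - q ^ 3 * (q ^ 4) ^ j) * F' q ((q\<^sup>2) ^ j)
        = (1 + q ^ 3 * (q ^ 6) ^ j) * (1 + (q\<^sup>2) ^ j * q) * F' q ((q\<^sup>2) ^ j * q\<^sup>2)"
        using F'_step[OF q _ n1] q' by simp
      thus ?thesis
        using nz[of j] by (intro eq_divide_multI) (simp_all add: mult_ac)
    qed
    show "(\<lambda>n. prod ?c {..<n}) \<longlonglongrightarrow> qpoch_inf (- (q ^ 3)) (q ^ 6) * qpoch_inf (- q) (q\<^sup>2)
      / (qpoch_inf q (q ^ 4) * qpoch_inf (q ^ 3) (q ^ 4))"
      unfolding prod_dividef prod.distrib
      by (intro tendsto_intros qpoch_inf_tendsto_prod q')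
        (auto simp: qpoch_inf_nonzero' q q')
    have "(\<lambda>j. \<Sum>n. (\<Prod>k<n. rF' q ((q\<^sup>2) ^ j) (q ^ k) * q ^ k) * 1)
        \<longlonglongrightarrow> (\<Sum>n. (\<Prod>k<n. rF' q 0 (q ^ k) * q ^ k) * 1)"
    proof (rule family_tendsto[where B = 1, OF q])
      fix x X :: complex assume x: "norm x \<le> 1" "norm X \<le> 1"
      show "norm (rF' q x X) \<le> (2 * 2 * 1) / ((1 - norm q) * (1 - norm q))"
        unfolding rF'_def using q x
        by (intro norm_divide_le norm_mult_le_mult mult_le_norm_mult norm_add_le_two
            norm_one_minus_ge norm_mult_le_one norm_pow_le_one mult_pos_pos) auto
    next
      show "isCont (\<lambda>x. rF' q x (q ^ k)) 0" for k
        using one_minus_mult_neq_0[OF q, of "q\<^sup>2 * (q ^ k) ^ 3"] q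
        unfolding rF'_def by (intro continuous_intros) (auto simp: norm_mult_le_one norm_pow_le_one)
      show "(\<lambda>j. (q\<^sup>2) ^ j) \<longlonglongrightarrow> 0"
        by (rule LIMSEQ_power_zero[OF q'(1)])
    qed (use q' in auto)
    \<comment> \<open>At \<open>s = 0\<close> the numerator collapses to \<open>q^2 X^2\<close>, so
      the limit is Euler's series in the base \<open>q^3\<close>.\<close>
    moreover have "(\<Prod>k<n. rF' q 0 (q ^ k) * q ^ k) = (\<Prod>k<n. q ^ 3 / (1 - q ^ 3 * (q ^ 3) ^ k) * (q ^ 3) ^ k)" for n
      unfolding rF'_def
      by (intro prod.cong refl) (simp add: power3_eq_cube power2_eq_square power_mult_distrib mult_ac)
    ultimately show "(\<lambda>j. F' q ((q\<^sup>2) ^ j)) \<longlonglongrightarrow> qpoch_inf (- (q ^ 3)) (q ^ 3)"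
      using euler_sums[OF q'(2), of "q ^ 3"] by (simp add: F'_def)
  qed
  thus ?thesis by simp
qed

text \<open>At \<open>t = 1\<close> the product of the first \<open>n\<close> ratios, each times
  \<open>q ^ k\<close>, is
  \<open>(-q;q)_n (-1;q^2)_n q^(n(n+1)/2) / ((q;q^2)_n (q^3;q^3)_n)\<close>. The cubic factor
  \<open>1 - q^3 X^3\<close> is split, and the parameter enters only its quadratic part.\<close>

definition rH :: "complex \<Rightarrow> complex \<Rightarrow> complex \<Rightarrow> complex" where
  "rH q t X = (1 + t * q * X) * (1 + t ^ 3 * X\<^sup>2) * q
     / ((1 - q * (t\<^sup>2 * X\<^sup>2)) * (1 - q * X) * (1 + q * (t * X) + (q * (t * X))\<^sup>2))"

definition H :: "complex \<Rightarrow> complex \<Rightarrow> complex" where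
  "H q t = (\<Sum>n. (\<Prod>k<n. rH q t (q ^ k) * q ^ k) * (1 + t * q ^ n))"

text \<open>Replacing \<open>t\<close> by \<open>t q^2\<close> essentially shifts the index by two,
  so the ratio at index \<open>k\<close> is matched with \<open>e\<close> at index
  \<open>k + 2\<close>; the step must be a square of \<open>q\<close> because \<open>t^3 X^2\<close>
  has to move by whole steps. The factor \<open>1 + t^3 = (1 + t) (1 - t + t^2)\<close> explains the
  hypothesis on \<open>t\<close>: its quadratic part lies in \<open>A\<close>, which is
  cancelled.\<close>

lemma H_step:
  assumes q: "norm q < 1" "q \<noteq> 0" and t: "norm t \<le> 1" "1 - t + t\<^sup>2 \<noteq> 0"
  shows "(1 - q * t\<^sup>2) * (1 - q ^ 3 * t\<^sup>2) * (1 + q * t + (q * t)\<^sup>2) * (1 + q * (t * q) + (q * (t * q))\<^sup>2) * H q t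
     = (1 + t) * (1 + t * q\<^sup>2) * (1 + t ^ 3 * q\<^sup>2) * (1 + t ^ 3 * q ^ 4) * H q (t * q\<^sup>2)"
proof -
  define D1 D2 D3 where "D1 = (\<lambda>X. 1 - q * (t\<^sup>2 * X\<^sup>2))" and "D2 = (\<lambda>X. 1 - q * X)"
    and "D3 = (\<lambda>X. 1 + q * (t * X) + (q * (t * X))\<^sup>2)"
  define e where "e = (\<lambda>X. (1 + t * q * X) * (1 + t ^ 3 * X\<^sup>2) / (q * (D1 X * D2 X * D3 X)))"
  \<comment> \<open>The zeros at \<open>X = 1\<close> and \<open>X = q\<close> remove the first two
    terms of the sum over \<open>e\<close>, which is what the shift by two needs.\<close>
  define \<phi> where "\<phi> = (\<lambda>X. (q - X) * (1 - X) * (1 + t ^ 3 * X\<^sup>2))"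
  define A where "A = (1 + q * t) * (1 - t + t\<^sup>2)"
  have nz: "D1 (q ^ n) \<noteq> 0" "D2 (q ^ n) \<noteq> 0" "D3 (q ^ n) \<noteq> 0" for n
    unfolding D1_def D2_def D3_def
    by (rule one_minus_mult_neq_0[OF q(1)] cyclotomic3_neq_0[OF q(1)];
        simp add: norm_mult_le_one norm_pow_le_one q t)+
  have rHD: "rH q t X = (1 + t * q * X) * (1 + t ^ 3 * X\<^sup>2) * q / (D1 X * D2 X * D3 X)" for X
    by (simp only: rH_def D1_def D2_def D3_def)
  have T1: "(\<Prod>k<n. rH q t (q ^ k) * q ^ k) = (\<Prod>k<n. e (q ^ k) * q ^ k) * (q ^ n)\<^sup>2" for n
  proof -
    have "(\<Prod>k<n. rH q t (q ^ k) * q ^ k) * (q ^ 0)\<^sup>2 = (\<Prod>k<n. e (q ^ k) * q ^ k) * (q ^ n)\<^sup>2"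
    proof (rule prod_gauge)
      fix k
      show "rH q t (q ^ k) * q ^ k * (q ^ k)\<^sup>2 = e (q ^ k) * q ^ k * (q ^ Suc k)\<^sup>2"
        unfolding rHD e_def using nz[of k] q by (simp add: power2_eq_square mult_ac)
    qed
    thus ?thesis by simp
  qed
  have T2: "(\<Prod>k<n. rH q (t * q\<^sup>2) (q ^ k) * q ^ k) * \<phi> (q ^ (0 + 2))
      = (\<Prod>k<n. e (q ^ (k + 2)) * q ^ (k + 2)) * \<phi> (q ^ (n + 2))" for n
  proof (rule prod_gauge)
    fix k
    define Y where "Y = q ^ k"
    have Y: "q ^ (k + 2) = q\<^sup>2 * Y" "q ^ (Suc k + 2) = q ^ 3 * Y" "q ^ (k + 1) = q * Y"
      by (simp_all add: Y_def power_add power2_eq_square power3_eq_cube)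
    have nzY: "D1 (q\<^sup>2 * Y) \<noteq> 0" "D2 (q\<^sup>2 * Y) \<noteq> 0" "D2 Y \<noteq> 0" "D3 (q\<^sup>2 * Y) \<noteq> 0"
      using nz[of "k + 2"] nz(2)[of k] by (auto simp only: Y Y_def[symmetric])
    have r: "rH q (t * q\<^sup>2) Y = (1 + t * q * (q\<^sup>2 * Y)) * (1 + t ^ 3 * q ^ 6 * Y\<^sup>2) * q
        / (D1 (q\<^sup>2 * Y) * D2 Y * D3 (q\<^sup>2 * Y))"
    proof -
      have "1 + t * q\<^sup>2 * q * Y = 1 + t * q * (q\<^sup>2 * Y)" "1 + (t * q\<^sup>2) ^ 3 * Y\<^sup>2 = 1 + t ^ 3 * q ^ 6 * Y\<^sup>2"
        "1 - q * ((t * q\<^sup>2)\<^sup>2 * Y\<^sup>2) = D1 (q\<^sup>2 * Y)" "1 - q * Y = D2 Y"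
        "1 + q * (t * q\<^sup>2 * Y) + (q * (t * q\<^sup>2 * Y))\<^sup>2 = D3 (q\<^sup>2 * Y)"
        unfolding D1_def D2_def D3_def by algebra+
      thus ?thesis unfolding rH_def by (simp only:)
    qed
    have p: "\<phi> (q\<^sup>2 * Y) = q * D2 Y * D2 (q * Y) * (1 + t ^ 3 * (q\<^sup>2 * Y)\<^sup>2)"
      "\<phi> (q ^ 3 * Y) = q * D2 (q * Y) * D2 (q\<^sup>2 * Y) * (1 + t ^ 3 * q ^ 6 * Y\<^sup>2)"
      unfolding \<phi>_def D2_def by algebra+
    show "rH q (t * q\<^sup>2) (q ^ k) * q ^ k * \<phi> (q ^ (k + 2))
        = e (q ^ (k + 2)) * q ^ (k + 2) * \<phi> (q ^ (Suc k + 2))"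
      unfolding Y Y_def[symmetric] r p e_def using nzY q
      by (simp add: power2_eq_square)
  qed
  have contD: "isCont D1 0" "isCont D2 0" "isCont D3 0" "D1 0 = 1" "D2 0 = 1" "D3 0 = 1"
    unfolding D1_def D2_def D3_def by (auto intro!: continuous_intros)
  have cont: "isCont e 0"
    unfolding e_def using q by (intro continuous_intros contD) (auto simp: contD)
  have sumH: "summable (\<lambda>n. (\<Prod>k<n. rH q s (q ^ k) * q ^ k) * (1 + s * q ^ n))" for s
    using summable_norm_cancel[OF qseries_summable[OF q(1), of "rH q s" "\<lambda>X. 1 + s * X"]]
    by (simp add: rH_def[abs_def] continuous_intros)
  let ?v = "\<lambda>X. (1 + t * X) * \<phi> X"
  have "(\<Sum>n. (\<Prod>k<n. e (q ^ k) * q ^ k) * ?v (q ^ n))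
      - (\<Sum>n. (\<Prod>k<n. e (q ^ k) * q ^ k) * (A * (1 + t * q ^ n) * (q ^ n)\<^sup>2)) = - 0"
  proof (rule qseries_telescope[OF q(1) cont, where v = ?v and w = "\<lambda>X. A * (1 + t * X) * X\<^sup>2"
        and G = "\<lambda>X. - (q - t\<^sup>2 * X\<^sup>2) * (1 - X) * (1 + t * X + t\<^sup>2 * X\<^sup>2)"])
    fix n
    define X where "X = q ^ n"
    have "q - t\<^sup>2 * (q * X)\<^sup>2 = q * D1 X" "1 - q * X = D2 X"
      "1 + t * (q * X) + t\<^sup>2 * (q * X)\<^sup>2 = D3 X"
      unfolding D1_def D2_def D3_def by algebra+
    hence *: "e X * X * (- (q - t\<^sup>2 * (q * X)\<^sup>2) * (1 - q * X) * (1 + t * (q * X) + t\<^sup>2 * (q * X)\<^sup>2))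
        = - ((1 + t * q * X) * (1 + t ^ 3 * X\<^sup>2) * X)"
      using nz[of n] q by (simp add: e_def X_def)
    show "?v (q ^ n) - A * (1 + t * q ^ n) * (q ^ n)\<^sup>2 = e (q ^ n) * q ^ n *
        (- (q - t\<^sup>2 * (q * q ^ n)\<^sup>2) * (1 - q * q ^ n) * (1 + t * (q * q ^ n) + t\<^sup>2 * (q * q ^ n)\<^sup>2))
       - (- (q - t\<^sup>2 * (q ^ n)\<^sup>2) * (1 - q ^ n) * (1 + t * q ^ n + t\<^sup>2 * (q ^ n)\<^sup>2))"
      unfolding X_def[symmetric] * \<phi>_def A_def by algebra
  qed (auto intro!: continuous_intros simp: \<phi>_def)
  hence "(\<Sum>n. (\<Prod>k<n. e (q ^ k) * q ^ k) * ?v (q ^ n))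
      = (\<Sum>n. (\<Prod>k<n. e (q ^ k) * q ^ k) * (A * (1 + t * q ^ n) * (q ^ n)\<^sup>2))"
    by simp
  also have "\<dots> = A * H q t"
    unfolding H_def suminf_mult[OF sumH, symmetric]
    unfolding T1 by (rule suminf_cong) (simp only: mult_ac)
  also have "(\<Sum>n. (\<Prod>k<n. e (q ^ k) * q ^ k) * ?v (q ^ n))
      = (\<Sum>n. (\<Prod>k<n + 2. e (q ^ k) * q ^ k) * ?v (q ^ (n + 2)))"
  proof -
    have "isCont ?v 0"
      unfolding \<phi>_def by (intro continuous_intros)
    hence "summable (\<lambda>n. (\<Prod>k<n. e (q ^ k) * q ^ k) * ?v (q ^ n))"
      by (intro summable_norm_cancel[OF qseries_summable] q cont)
    from suminf_split_initial_segment[OF this, of 2] show ?thesis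
      by (simp add: numeral_2_eq_2 \<phi>_def)
  qed
  also have "\<dots> = e 1 * (e q * q) * \<phi> (q\<^sup>2) * H q (t * q\<^sup>2)"
    unfolding H_def suminf_mult[OF sumH, symmetric]
  proof (rule suminf_cong)
    fix n
    have "(\<Prod>k<n + 2. e (q ^ k) * q ^ k) = e 1 * (e q * q) * (\<Prod>k<n. e (q ^ (k + 2)) * q ^ (k + 2))"
      by (simp add: prod.lessThan_Suc_shift numeral_2_eq_2 mult.assoc del: prod.lessThan_Suc)
    hence "(\<Prod>k<n + 2. e (q ^ k) * q ^ k) * ?v (q ^ (n + 2))
        = e 1 * (e q * q) * (1 + t * q ^ (n + 2)) * ((\<Prod>k<n. e (q ^ (k + 2)) * q ^ (k + 2)) * \<phi> (q ^ (n + 2)))"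
      by (simp only: mult_ac)
    also have "\<dots> = e 1 * (e q * q) * (1 + t * q ^ (n + 2)) * ((\<Prod>k<n. rH q (t * q\<^sup>2) (q ^ k) * q ^ k) * \<phi> (q\<^sup>2))"
      by (simp only: T2[of n, symmetric] add_0)
    also have "\<dots> = e 1 * (e q * q) * \<phi> (q\<^sup>2) * ((\<Prod>k<n. rH q (t * q\<^sup>2) (q ^ k) * q ^ k) * (1 + t * q\<^sup>2 * q ^ n))"
    proof -
      have "t * q ^ (n + 2) = t * q\<^sup>2 * q ^ n"
        by (simp add: power_add power2_eq_square)
      thus ?thesis by (simp only: mult_ac)
    qed
    finally show "(\<Prod>k<n + 2. e (q ^ k) * q ^ k) * ?v (q ^ (n + 2))
        = e 1 * (e q * q) * \<phi> (q\<^sup>2) * ((\<Prod>k<n. rH q (t * q\<^sup>2) (q ^ k) * q ^ k) * (1 + t * q\<^sup>2 * q ^ n))" .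
  qed
  finally have main: "e 1 * (e q * q) * \<phi> (q\<^sup>2) * H q (t * q\<^sup>2) = A * H q t" .
  have p2: "\<phi> (q\<^sup>2) = q * D2 1 * D2 q * (1 + t ^ 3 * q ^ 4)"
    unfolding \<phi>_def D2_def by algebra
  have "e 1 * (e q * q) * \<phi> (q\<^sup>2) * (D1 1 * D1 q * D3 1 * D3 q)
      = (1 + q * t) * (1 + t ^ 3) * (1 + t * q\<^sup>2) * (1 + t ^ 3 * q\<^sup>2) * (1 + t ^ 3 * q ^ 4)"
    unfolding p2 e_def using nz[of 0] nz[of 1] q by (simp add: power2_eq_square mult_ac)
  also have "\<dots> = A * ((1 + t) * (1 + t * q\<^sup>2) * (1 + t ^ 3 * q\<^sup>2) * (1 + t ^ 3 * q ^ 4))"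
    unfolding A_def by algebra
  finally have P: "e 1 * (e q * q) * \<phi> (q\<^sup>2) * (D1 1 * D1 q * D3 1 * D3 q)
      = A * ((1 + t) * (1 + t * q\<^sup>2) * (1 + t ^ 3 * q\<^sup>2) * (1 + t ^ 3 * q ^ 4))" .
  have "A * ((1 + t) * (1 + t * q\<^sup>2) * (1 + t ^ 3 * q\<^sup>2) * (1 + t ^ 3 * q ^ 4) * H q (t * q\<^sup>2))
      = (e 1 * (e q * q) * \<phi> (q\<^sup>2) * (D1 1 * D1 q * D3 1 * D3 q)) * H q (t * q\<^sup>2)"
    unfolding P by (simp only: mult.assoc)
  also have "\<dots> = (e 1 * (e q * q) * \<phi> (q\<^sup>2) * H q (t * q\<^sup>2)) * (D1 1 * D1 q * D3 1 * D3 q)"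
    by (simp only: mult_ac)
  also have "\<dots> = A * ((D1 1 * D1 q * D3 1 * D3 q) * H q t)"
    unfolding main by (simp only: mult_ac)
  finally have "A * ((1 + t) * (1 + t * q\<^sup>2) * (1 + t ^ 3 * q\<^sup>2) * (1 + t ^ 3 * q ^ 4) * H q (t * q\<^sup>2))
      = A * ((D1 1 * D1 q * D3 1 * D3 q) * H q t)" .
  moreover have "1 + q * t \<noteq> 0"
    using one_minus_mult_neq_0[OF q(1), of "- t"] t by simp
  hence "A \<noteq> 0"
    using t by (simp add: A_def)
  ultimately show ?thesis
    by (simp add: D1_def D3_def power3_eq_cube power2_eq_square mult_ac)
qed

text \<open>The quadratic denominators become infinite products after multiplication by
  \<open>1 - q t\<close> and \<open>1 - q^2 t\<close>, which complete them to
  \<open>1 - q^3 t^3\<close> and \<open>1 - q^6 t^3\<close>; along \<open>t = q^(2j)\<close> these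
  have base \<open>q^6\<close>. The added numerators form \<open>(q;q^2)_inf (q^2;q^2)_inf\<close>.
  At \<open>t = 0\<close> Euler's series at \<open>z = q\<close> is left.\<close>

lemma H_one:
  assumes q: "norm q < 1" "q \<noteq> 0"
  shows "H q 1 = qpoch_inf (- 1) (q\<^sup>2) * qpoch_inf (- (q\<^sup>2)) (q\<^sup>2)
      * qpoch_inf (- (q\<^sup>2)) (q ^ 6) * qpoch_inf (- (q ^ 4)) (q ^ 6)
      * qpoch_inf q (q\<^sup>2) * qpoch_inf (q\<^sup>2) (q\<^sup>2)
      / (qpoch_inf q (q ^ 4) * qpoch_inf (q ^ 3) (q ^ 4) * qpoch_inf (q ^ 3) (q ^ 6) * qpoch_inf (q ^ 6) (q ^ 6))
      * qpoch_inf (- q) q" (is "_ = ?P * _")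
proof -
  let ?c = "\<lambda>j. (1 - (- 1) * (q\<^sup>2) ^ j) * (1 - (- (q\<^sup>2)) * (q\<^sup>2) ^ j)
      * (1 - (- (q\<^sup>2)) * (q ^ 6) ^ j) * (1 - (- (q ^ 4)) * (q ^ 6) ^ j)
      * (1 - q * (q\<^sup>2) ^ j) * (1 - q\<^sup>2 * (q\<^sup>2) ^ j)
      / ((1 - q * (q ^ 4) ^ j) * (1 - q ^ 3 * (q ^ 4) ^ j) * (1 - q ^ 3 * (q ^ 6) ^ j) * (1 - q ^ 6 * (q ^ 6) ^ j))"
  have q': "norm (q\<^sup>2) < 1" "norm (q ^ 3) < 1" "norm (q ^ 4) < 1" "norm (q ^ 6) < 1"
    by (rule norm_power_less_one[OF q(1)]; simp)+
  have nz: "1 - q * (q ^ 4) ^ j \<noteq> 0" "1 - q ^ 3 * (q ^ 4) ^ j \<noteq> 0"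
     "1 - q ^ 3 * (q ^ 6) ^ j \<noteq> 0" "1 - q ^ 6 * (q ^ 6) ^ j \<noteq> 0" for j
    by (rule one_minus_mult_neq_0; use q q' in simp)+
  have "H q ((q\<^sup>2) ^ 0) = ?P * qpoch_inf (- q) q"
  proof (rule iterate_first_order[where c = ?c])
    show "H q ((q\<^sup>2) ^ j) = ?c j * H q ((q\<^sup>2) ^ Suc j)" for j
    proof -
      define t where "t = (q\<^sup>2) ^ j"
      have t1: "norm t \<le> 1"
        using q' by (simp add: t_def)
      have t2: "1 - t + t\<^sup>2 \<noteq> 0"
      proof (cases "j = 0")
        case False
        hence "norm t < 1"
          using norm_power_less_one[OF q'(1)] by (simp add: t_def)
        from cyclotomic3_neq_0[OF this, of "- 1"] show ?thesis by simp
      qed (simp add: t_def)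
      have pw: "(q ^ 4) ^ j = t\<^sup>2" "(q ^ 6) ^ j = t ^ 3"
        by (simp_all add: t_def flip: power_mult add: mult.commute)
      have cy: "(1 + q * t + (q * t)\<^sup>2) * (1 - q * t) = 1 - q ^ 3 * t ^ 3"
        "(1 + q * (t * q) + (q * (t * q))\<^sup>2) * (1 - q\<^sup>2 * t) = 1 - q ^ 6 * t ^ 3"
        by algebra+
      have "((1 - q * t\<^sup>2) * (1 - q ^ 3 * t\<^sup>2) * (1 - q ^ 3 * t ^ 3) * (1 - q ^ 6 * t ^ 3)) * H q t
        = ((1 - q * t\<^sup>2) * (1 - q ^ 3 * t\<^sup>2) * (1 + q * t + (q * t)\<^sup>2) * (1 + q * (t * q) + (q * (t * q))\<^sup>2) * H q t)
           * ((1 - q * t) * (1 - q\<^sup>2 * t))"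
        unfolding cy[symmetric] by (simp only: mult_ac)
      also have "\<dots> = ((1 - (- 1) * t) * (1 - (- (q\<^sup>2)) * t)
          * (1 - (- (q\<^sup>2)) * t ^ 3) * (1 - (- (q ^ 4)) * t ^ 3)
          * (1 - q * t) * (1 - q\<^sup>2 * t)) * H q (t * q\<^sup>2)"
        unfolding H_step[OF q t1 t2] by (simp add: mult_ac)
      finally have "H q t = ((1 - (- 1) * t) * (1 - (- (q\<^sup>2)) * t)
          * (1 - (- (q\<^sup>2)) * t ^ 3) * (1 - (- (q ^ 4)) * t ^ 3)
          * (1 - q * t) * (1 - q\<^sup>2 * t))
        / ((1 - q * t\<^sup>2) * (1 - q ^ 3 * t\<^sup>2) * (1 - q ^ 3 * t ^ 3) * (1 - q ^ 6 * t ^ 3)) * H q (t * q\<^sup>2)"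
        using nz[of j] unfolding pw by (intro eq_divide_multI) simp_all
      thus ?thesis
        unfolding pw t_def[symmetric] by (simp add: t_def mult.commute)
    qed
    show "(\<lambda>n. prod ?c {..<n}) \<longlonglongrightarrow> ?P"
      unfolding prod_dividef prod.distrib
      by (intro tendsto_intros qpoch_inf_tendsto_prod q')
        (auto simp: qpoch_inf_nonzero' q q')
    have "(\<lambda>j. \<Sum>n. (\<Prod>k<n. rH q ((q\<^sup>2) ^ j) (q ^ k) * q ^ k) * (1 + (q\<^sup>2) ^ j * q ^ n))
        \<longlonglongrightarrow> (\<Sum>n. (\<Prod>k<n. rH q 0 (q ^ k) * q ^ k) * (1 + 0 * q ^ n))"
    proof (rule family_tendsto[where w = "\<lambda>x X. 1 + x * X" and B = 2, OF q(1)])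
      fix x X :: complex assume x: "norm x \<le> 1" "norm X \<le> 1"
      show "norm (1 + x * X) \<le> 2"
        by (intro norm_add_le_two norm_mult_le_one x) auto
      show "norm (rH q x X) \<le> (2 * 2 * 1) / ((1 - norm q) * (1 - norm q) * ((1 - norm q) / 2))"
        unfolding rH_def using q x
        by (intro norm_divide_le norm_mult_le_mult mult_le_norm_mult norm_add_le_two norm_cyclotomic3_ge
            norm_one_minus_ge norm_mult_le_one norm_pow_le_one mult_pos_pos mult_nonneg_nonneg) auto
    next
      show "isCont (\<lambda>x. rH q x (q ^ k)) 0" for k
        using one_minus_mult_neq_0[OF q(1), of "q ^ k"] q
        unfolding rH_def by (intro continuous_intros) auto
      show "(\<lambda>j. (q\<^sup>2) ^ j) \<longlonglongrightarrow> 0"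
        by (rule LIMSEQ_power_zero[OF q'(1)])
      show "isCont (\<lambda>x. 1 + x * q ^ k) 0" for k
        by (intro continuous_intros)
    qed (use q' in auto)
    moreover have "(\<Prod>k<n. rH q 0 (q ^ k) * q ^ k) = (\<Prod>k<n. q / (1 - q * q ^ k) * q ^ k)" for n
      by (simp add: rH_def)
    ultimately show "(\<lambda>j. H q ((q\<^sup>2) ^ j)) \<longlonglongrightarrow> qpoch_inf (- q) q"
      using euler_sums[OF q(1), of q] by (simp add: H_def)
  qed
  thus ?thesis by simp
qed

section \<open>Families of the first two identities\<close>

text \<open>The variable \<open>X\<close> now runs through powers of \<open>q^2\<close>. The member
  \<open>b = - q^6\<close> is, up to a constant, the common summand of the first two sums with the
  weight \<open>1 + q^2 X^2\<close>.\<close>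

definition rB :: "complex \<Rightarrow> complex \<Rightarrow> complex \<Rightarrow> complex" where
  "rB q b X = - (1 - q * X) * (1 - b * X\<^sup>2) * q ^ 3 / ((1 - q * (q ^ 3 * X\<^sup>2)) * (1 - q * (q\<^sup>2 * b * X ^ 3)))"

definition B :: "complex \<Rightarrow> complex \<Rightarrow> complex" where
  "B q b = (\<Sum>n. (\<Prod>k<n. rB q b ((q\<^sup>2) ^ k) * (q\<^sup>2) ^ k))"

text \<open>One index step multiplies \<open>X^2\<close> by \<open>q^4\<close> and
  \<open>X^3\<close> by \<open>q^6\<close>. The step \<open>q^12\<close>, their least common
  multiple, moves \<open>1 - b X^2\<close> by three and the cubic factor by two whole steps. The
  ratio of the member \<open>b\<close> itself serves as common ratio, and \<open>\<phi>\<close>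
  collects the shifted factors; the final cancellation is by \<open>1 - b\<close>.\<close>

lemma B_step:
  assumes q: "norm q < 1" and b: "norm b \<le> 1" "b \<noteq> 1"
  shows "(1 - q ^ 3 * b) * (1 - q ^ 9 * b) * B q b = (1 - q ^ 4 * b) * (1 - q ^ 8 * b) * B q (b * q ^ 12)"
proof -
  define D E M where "D = (\<lambda>X. 1 - q * (q ^ 3 * X\<^sup>2))" and "E = (\<lambda>X. 1 - q * (q\<^sup>2 * b * X ^ 3))"
    and "M = (\<lambda>X. 1 - b * X\<^sup>2)"
  define \<phi> where "\<phi> = (\<lambda>X. M X * M (q\<^sup>2 * X) * M (q ^ 4 * X) / (E X * E (q\<^sup>2 * X)))"
  have q2: "norm (q\<^sup>2) < 1"
    by (rule norm_power_less_one[OF q]) simp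
  have nz: "D ((q\<^sup>2) ^ n) \<noteq> 0" "E ((q\<^sup>2) ^ n) \<noteq> 0" "E (q\<^sup>2 * (q\<^sup>2) ^ n) \<noteq> 0" "E (q ^ 4 * (q\<^sup>2) ^ n) \<noteq> 0" for n
    unfolding D_def E_def
    by (rule one_minus_mult_neq_0[OF q];
        simp add: norm_mult_le_one norm_pow_le_one q q2 b)+
  have r: "rB q b X = - (1 - q * X) * M X * q ^ 3 / (D X * E X)" for X
    unfolding rB_def D_def E_def M_def ..
  have r': "rB q (b * q ^ 12) X = - (1 - q * X) * M (q ^ 6 * X) * q ^ 3 / (D X * E (q ^ 4 * X))" for X
  proof -
    have "1 - b * q ^ 12 * X\<^sup>2 = M (q ^ 6 * X)" "1 - q * (q\<^sup>2 * (b * q ^ 12) * X ^ 3) = E (q ^ 4 * X)"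
      unfolding M_def E_def by algebra+
    thus ?thesis unfolding rB_def D_def by simp
  qed
  have T: "(\<Prod>k<n. rB q (b * q ^ 12) ((q\<^sup>2) ^ k) * (q\<^sup>2) ^ k) * \<phi> 1
    = (\<Prod>k<n. rB q b ((q\<^sup>2) ^ k) * (q\<^sup>2) ^ k) * \<phi> ((q\<^sup>2) ^ n)" for n
  proof -
    have "(\<Prod>k<n. rB q (b * q ^ 12) ((q\<^sup>2) ^ k) * (q\<^sup>2) ^ k) * \<phi> ((q\<^sup>2) ^ 0)
      = (\<Prod>k<n. rB q b ((q\<^sup>2) ^ k) * (q\<^sup>2) ^ k) * \<phi> ((q\<^sup>2) ^ n)"
    proof (rule prod_gauge)
      fix k
      define X where "X = (q\<^sup>2) ^ k"
      have X: "(q\<^sup>2) ^ Suc k = q\<^sup>2 * X"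
        by (simp add: X_def)
      have sh: "q\<^sup>2 * (q\<^sup>2 * X) = q ^ 4 * X" "q ^ 4 * (q\<^sup>2 * X) = q ^ 6 * X"
        by algebra+
      show "rB q (b * q ^ 12) ((q\<^sup>2) ^ k) * (q\<^sup>2) ^ k * \<phi> ((q\<^sup>2) ^ k)
          = rB q b ((q\<^sup>2) ^ k) * (q\<^sup>2) ^ k * \<phi> ((q\<^sup>2) ^ Suc k)"
        unfolding X X_def[symmetric] r r' \<phi>_def sh using nz[of k] unfolding X_def[symmetric]
        by (simp add: mult_ac)
    qed
    thus ?thesis by simp
  qed
  have contD: "isCont D 0" "isCont E 0" "isCont M 0" "D 0 = 1" "E 0 = 1"
    unfolding D_def E_def M_def by (auto intro!: continuous_intros)
  have contE: "isCont (\<lambda>X. E (c * X)) 0" "isCont (\<lambda>X. M (c * X)) 0" for c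
    unfolding E_def M_def by (intro continuous_intros)+
  have cont: "isCont (rB q b) 0"
    unfolding r by (intro continuous_intros contD) (auto simp: contD)
  have cont\<phi>: "isCont \<phi> 0"
    unfolding \<phi>_def by (intro continuous_intros contD contE) (auto simp: contD)
  have sumB: "summable (\<lambda>n. \<Prod>k<n. rB q c ((q\<^sup>2) ^ k) * (q\<^sup>2) ^ k)" for c
    using summable_norm_cancel[OF qseries_summable[OF q2, of "rB q c" "\<lambda>X. 1"]]
    by (simp add: rB_def[abs_def] continuous_intros)
  have "(\<Sum>n. (\<Prod>k<n. rB q b ((q\<^sup>2) ^ k) * (q\<^sup>2) ^ k) * (1 - b))
      - (\<Sum>n. (\<Prod>k<n. rB q b ((q\<^sup>2) ^ k) * (q\<^sup>2) ^ k) * \<phi> ((q\<^sup>2) ^ n)) = - 0"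
  proof (rule qseries_telescope[OF q2 cont, where v = "\<lambda>_. 1 - b" and w = \<phi>
        and G = "\<lambda>X. b * (1 - q ^ 3 * X) * (1 - X\<^sup>2) / E X"])
    fix n
    define X where "X = (q\<^sup>2) ^ n"
    note nz = nz[of n, folded X_def]
    have "1 - (q\<^sup>2 * X)\<^sup>2 = D X"
      unfolding D_def by algebra
    hence *: "rB q b X * X * (b * (1 - q ^ 3 * (q\<^sup>2 * X)) * (1 - (q\<^sup>2 * X)\<^sup>2) / E (q\<^sup>2 * X))
       = - (1 - q * X) * M X * q ^ 3 * X * (b * (1 - q ^ 5 * X)) / (E X * E (q\<^sup>2 * X))"
      using nz by (simp add: r power_add[symmetric] flip: power_Suc power_add mult.assoc)
    have **: "- (1 - q * X) * M X * q ^ 3 * X * (b * (1 - q ^ 5 * X)) - b * (1 - q ^ 3 * X) * (1 - X\<^sup>2) * E (q\<^sup>2 * X)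
      = (1 - b) * (E X * E (q\<^sup>2 * X)) - M X * M (q\<^sup>2 * X) * M (q ^ 4 * X)"
      unfolding M_def E_def by algebra
    have "(1 - b) - \<phi> X = ((1 - b) * (E X * E (q\<^sup>2 * X)) - M X * M (q\<^sup>2 * X) * M (q ^ 4 * X)) / (E X * E (q\<^sup>2 * X))"
      unfolding \<phi>_def using nz by (simp add: diff_divide_distrib)
    also have "\<dots> = rB q b X * X * (b * (1 - q ^ 3 * (q\<^sup>2 * X)) * (1 - (q\<^sup>2 * X)\<^sup>2) / E (q\<^sup>2 * X))
       - b * (1 - q ^ 3 * X) * (1 - X\<^sup>2) / E X"
      unfolding * **[symmetric] using nz by (simp add: diff_divide_distrib)
    finally show "(1 - b) - \<phi> ((q\<^sup>2) ^ n) = rB q b ((q\<^sup>2) ^ n) * (q\<^sup>2) ^ n *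
        (b * (1 - q ^ 3 * (q\<^sup>2 * (q\<^sup>2) ^ n)) * (1 - (q\<^sup>2 * (q\<^sup>2) ^ n)\<^sup>2) / E (q\<^sup>2 * (q\<^sup>2) ^ n))
        - b * (1 - q ^ 3 * (q\<^sup>2) ^ n) * (1 - ((q\<^sup>2) ^ n)\<^sup>2) / E ((q\<^sup>2) ^ n)"
      unfolding X_def .
  qed (use cont\<phi> in \<open>auto intro!: continuous_intros contD simp: contD\<close>)
  moreover have "(\<Sum>n. (\<Prod>k<n. rB q b ((q\<^sup>2) ^ k) * (q\<^sup>2) ^ k) * (1 - b)) = (1 - b) * B q b"
    unfolding B_def suminf_mult[OF sumB, symmetric] by (simp add: mult.commute)
  moreover have "(\<Sum>n. (\<Prod>k<n. rB q b ((q\<^sup>2) ^ k) * (q\<^sup>2) ^ k) * \<phi> ((q\<^sup>2) ^ n)) = \<phi> 1 * B q (b * q ^ 12)"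
    unfolding B_def suminf_mult[OF sumB, symmetric] T[symmetric] by (simp add: mult.commute)
  ultimately have main: "(1 - b) * B q b = \<phi> 1 * B q (b * q ^ 12)"
    by simp
  have "\<phi> 1 * (E 1 * E (q\<^sup>2)) = (1 - b) * ((1 - q ^ 4 * b) * (1 - q ^ 8 * b))"
    using nz[of 0] by (simp add: \<phi>_def M_def mult_ac flip: power_mult)
  moreover have "(1 - b) * ((E 1 * E (q\<^sup>2)) * B q b) = (\<phi> 1 * (E 1 * E (q\<^sup>2))) * B q (b * q ^ 12)"
    using arg_cong[OF main, of "\<lambda>z. z * (E 1 * E (q\<^sup>2))"] by (simp only: mult_ac)
  ultimately have "(1 - b) * ((E 1 * E (q\<^sup>2)) * B q b) = (1 - b) * (((1 - q ^ 4 * b) * (1 - q ^ 8 * b)) * B q (b * q ^ 12))"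
    by (simp only: mult.assoc)
  moreover have "q * (q\<^sup>2 * b * 1 ^ 3) = q ^ 3 * b" "q * (q\<^sup>2 * b * (q\<^sup>2) ^ 3) = q ^ 9 * b"
    by (simp_all flip: power_mult add: power_numeral_reduce)
  hence "E 1 = 1 - q ^ 3 * b" "E (q\<^sup>2) = 1 - q ^ 9 * b"
    unfolding E_def by (simp_all only:)
  ultimately show ?thesis
    using b by simp
qed

text \<open>At \<open>b = 1\<close> the telescoping behind the step \<open>b \<mapsto> b q^12\<close> degenerates; dividing its certificate by
  \<open>1 - b\<close> leaves a sum that starts at a nonzero boundary term.\<close>

lemma B_q12:
  assumes q: "norm q < 1"
  shows "(1 - q ^ 4) * (1 - q ^ 8) * B q (q ^ 12) = (1 - q ^ 3) * (1 - q ^ 9)"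
proof -
  define D E where "D = (\<lambda>X. 1 - q * (q ^ 3 * X\<^sup>2))" and "E = (\<lambda>X. 1 - q * (q\<^sup>2 * X ^ 3))"
  have q2: "norm (q\<^sup>2) < 1"
    by (rule norm_power_less_one[OF q]) simp
  have nz: "D ((q\<^sup>2) ^ n) \<noteq> 0" "D (q\<^sup>2 * (q\<^sup>2) ^ n) \<noteq> 0" "D (q ^ 4 * (q\<^sup>2) ^ n) \<noteq> 0"
    "E (q\<^sup>2 * (q\<^sup>2) ^ n) \<noteq> 0" "E (q ^ 4 * (q\<^sup>2) ^ n) \<noteq> 0" for n
    unfolding D_def E_def
    by (rule one_minus_mult_neq_0[OF q]; simp add: norm_mult_le_one norm_pow_le_one q q2)+
  have r: "rB q (q ^ 12) X = - (1 - q * X) * D (q ^ 4 * X) * q ^ 3 / (D X * E (q ^ 4 * X))" for X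
  proof -
    have "1 - q ^ 12 * X\<^sup>2 = D (q ^ 4 * X)" "1 - q * (q\<^sup>2 * q ^ 12 * X ^ 3) = E (q ^ 4 * X)"
      unfolding D_def E_def by algebra+
    thus ?thesis unfolding rB_def D_def by simp
  qed
  have contD: "isCont D 0" "isCont E 0" "D 0 = 1" "E 0 = 1"
    unfolding D_def E_def by (auto intro!: continuous_intros)
  have contE: "isCont (\<lambda>X. E (c * X)) 0" "isCont (\<lambda>X. D (c * X)) 0" for c
    unfolding E_def D_def by (intro continuous_intros)+
  have cont: "isCont (rB q (q ^ 12)) 0"
    unfolding r by (intro continuous_intros contD contE) (auto simp: contD)
  let ?G = "\<lambda>X. (1 - q ^ 3 * X) * E (q\<^sup>2 * X) / (D X * D (q\<^sup>2 * X))"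
  have "(\<Sum>n. (\<Prod>k<n. rB q (q ^ 12) ((q\<^sup>2) ^ k) * (q\<^sup>2) ^ k) * 0)
      - (\<Sum>n. (\<Prod>k<n. rB q (q ^ 12) ((q\<^sup>2) ^ k) * (q\<^sup>2) ^ k) * 1) = - ?G 1"
  proof (rule qseries_telescope[OF q2 cont, where v = "\<lambda>_. 0" and w = "\<lambda>_. 1" and G = ?G])
    fix n
    define X where "X = (q\<^sup>2) ^ n"
    note nz = nz[of n, folded X_def]
    have sh: "q\<^sup>2 * (q\<^sup>2 * X) = q ^ 4 * X"
      by algebra
    have *: "rB q (q ^ 12) X * X * ?G (q\<^sup>2 * X)
       = - (1 - q * X) * q ^ 3 * X * (1 - q ^ 5 * X) / (D X * D (q\<^sup>2 * X))"
      unfolding r sh using nz by (simp add: power_add[symmetric] flip: mult.assoc power_add)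
    have **: "- (1 - q * X) * q ^ 3 * X * (1 - q ^ 5 * X) - (1 - q ^ 3 * X) * E (q\<^sup>2 * X)
      = - (D X * D (q\<^sup>2 * X))"
      unfolding D_def E_def by algebra
    have "rB q (q ^ 12) X * X * ?G (q\<^sup>2 * X) - ?G X = - (D X * D (q\<^sup>2 * X)) / (D X * D (q\<^sup>2 * X))"
      unfolding * **[symmetric] by (simp only: diff_divide_distrib)
    also have "\<dots> = 0 - 1"
      using nz by simp
    finally show "0 - 1 = rB q (q ^ 12) ((q\<^sup>2) ^ n) * (q\<^sup>2) ^ n * ?G (q\<^sup>2 * (q\<^sup>2) ^ n) - ?G ((q\<^sup>2) ^ n)"
      unfolding X_def by (rule sym)
  qed (auto intro!: continuous_intros contD contE simp: contD)
  hence "B q (q ^ 12) = ?G 1"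
    by (simp add: B_def)
  moreover have "E (q\<^sup>2) = 1 - q ^ 9" "D 1 = 1 - q ^ 4" "D (q\<^sup>2) = 1 - q ^ 8"
    unfolding E_def D_def by (simp_all flip: power_mult add: power_numeral_reduce)
  ultimately show ?thesis
    using nz(1,2)[of 0] by simp
qed

text \<open>At \<open>x = 1\<close> the last two denominators multiply to
  \<open>1 + q^9 X^3\<close>, and the ratio is that of the common summand of the first two sums. At
  \<open>x = - q^2\<close> the numerator vanishes for \<open>X = 1\<close>.\<close>

definition rI :: "complex \<Rightarrow> complex \<Rightarrow> complex \<Rightarrow> complex" where
  "rI q x X = - (1 - q * X) * (x + q\<^sup>2 * X\<^sup>2) * q ^ 3
     / ((1 - q * (q ^ 3 * X\<^sup>2)) * (1 - q * (- (q\<^sup>2 * x * X))) * (1 + q * (- (q\<^sup>2 * X)) + (q * (- (q\<^sup>2 * X)))\<^sup>2))"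

definition I :: "complex \<Rightarrow> complex \<Rightarrow> complex" where
  "I q x = (\<Sum>n. (\<Prod>k<n. rI q x ((q\<^sup>2) ^ k) * (q\<^sup>2) ^ k) * (1 - q * (q\<^sup>2) ^ n)\<^sup>2)"

text \<open>For \<open>x -> x q^4\<close> the factor \<open>1 + q^3 x X\<close> moves two steps and
  \<open>x + q^2 X^2\<close> one step back. The common ratio \<open>e\<close> also shifts
  \<open>1 - q X\<close>, which absorbs one power of the weight \<open>(1 - q X)^2\<close> into
  \<open>\<psi>\<close> and \<open>\<phi>\<close>.\<close>

lemma I_step:
  assumes q: "norm q < 1" and x: "norm x \<le> 1"
  shows "(1 + q ^ 3 * x) * (1 + q ^ 5 * x) * I q x = (1 - q ^ 4 * x + q ^ 8 * x\<^sup>2) * I q (x * q ^ 4)"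
proof -
  define D E M N where "D = (\<lambda>X. 1 - q * (q ^ 3 * X\<^sup>2))" and "E = (\<lambda>X. 1 - q * (- (q\<^sup>2 * x * X)))"
    and "M = (\<lambda>X. 1 + q * (- (q\<^sup>2 * X)) + (q * (- (q\<^sup>2 * X)))\<^sup>2)" and "N = (\<lambda>X. 1 - q * X)"
  define e where "e = (\<lambda>X. - N (q\<^sup>2 * X) * (q\<^sup>2 * x + X\<^sup>2) * q / (D X * E (q ^ 4 * X) * M X))"
  define \<psi> where "\<psi> = (\<lambda>X. (X\<^sup>2 + q\<^sup>2 * x) * E X * E (q\<^sup>2 * X) / N X)"
  define \<phi> where "\<phi> = (\<lambda>X. X\<^sup>2 / N X)"
  define C where "C = (1 + q\<^sup>2 * x) * (1 - q ^ 4 * x + q ^ 8 * x\<^sup>2)"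
  have q2: "norm (q\<^sup>2) < 1"
    by (rule norm_power_less_one[OF q]) simp
  have nz: "D ((q\<^sup>2) ^ n) \<noteq> 0" "E ((q\<^sup>2) ^ n) \<noteq> 0" "E (q\<^sup>2 * (q\<^sup>2) ^ n) \<noteq> 0" "E (q ^ 4 * (q\<^sup>2) ^ n) \<noteq> 0"
    "M ((q\<^sup>2) ^ n) \<noteq> 0" "N ((q\<^sup>2) ^ n) \<noteq> 0" "N (q\<^sup>2 * (q\<^sup>2) ^ n) \<noteq> 0" for n
    unfolding D_def E_def M_def N_def
    by (rule one_minus_mult_neq_0[OF q] cyclotomic3_neq_0[OF q];
        simp add: norm_mult_le_one norm_pow_le_one q q2 x)+
  have r: "rI q x X = - N X * (x + q\<^sup>2 * X\<^sup>2) * q ^ 3 / (D X * E X * M X)" for X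
    unfolding rI_def D_def E_def M_def N_def ..
  have r': "rI q (x * q ^ 4) X = - N X * (x * q ^ 4 + q\<^sup>2 * X\<^sup>2) * q ^ 3 / (D X * E (q ^ 4 * X) * M X)" for X
    unfolding rI_def D_def E_def M_def N_def by (simp add: mult_ac)
  have sh: "q\<^sup>2 * (q\<^sup>2 * X) = q ^ 4 * X" for X
    by algebra
  have T1: "(\<Prod>k<n. rI q x ((q\<^sup>2) ^ k) * (q\<^sup>2) ^ k) * \<psi> 1
    = (\<Prod>k<n. e ((q\<^sup>2) ^ k) * (q\<^sup>2) ^ k) * \<psi> ((q\<^sup>2) ^ n)" for n
  proof -
    have "(\<Prod>k<n. rI q x ((q\<^sup>2) ^ k) * (q\<^sup>2) ^ k) * \<psi> ((q\<^sup>2) ^ 0)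
      = (\<Prod>k<n. e ((q\<^sup>2) ^ k) * (q\<^sup>2) ^ k) * \<psi> ((q\<^sup>2) ^ n)"
    proof (rule prod_gauge)
      fix k
      define X where "X = (q\<^sup>2) ^ k"
      note nz = nz[of k, folded X_def]
      have X: "(q\<^sup>2) ^ Suc k = q\<^sup>2 * X"
        by (simp add: X_def)
      have p: "(q\<^sup>2 * X)\<^sup>2 + q\<^sup>2 * x = q\<^sup>2 * (x + q\<^sup>2 * X\<^sup>2)"
        by algebra
      have "rI q x X * X * \<psi> X
          = - ((x + q\<^sup>2 * X\<^sup>2) * q ^ 3 * X * (X\<^sup>2 + q\<^sup>2 * x) * E (q\<^sup>2 * X)) / (D X * M X)"
        unfolding r \<psi>_def using nz by (simp add: mult_ac)
      also have "\<dots> = e X * X * \<psi> (q\<^sup>2 * X)"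
        unfolding e_def \<psi>_def sh p using nz
        by (simp add: mult_ac power2_eq_square power3_eq_cube add_ac)
      finally show "rI q x ((q\<^sup>2) ^ k) * (q\<^sup>2) ^ k * \<psi> ((q\<^sup>2) ^ k)
          = e ((q\<^sup>2) ^ k) * (q\<^sup>2) ^ k * \<psi> ((q\<^sup>2) ^ Suc k)"
        unfolding X X_def[symmetric] .
    qed
    thus ?thesis by simp
  qed
  have T2: "(\<Prod>k<n. rI q (x * q ^ 4) ((q\<^sup>2) ^ k) * (q\<^sup>2) ^ k) * \<phi> 1
    = (\<Prod>k<n. e ((q\<^sup>2) ^ k) * (q\<^sup>2) ^ k) * \<phi> ((q\<^sup>2) ^ n)" for n
  proof -
    have "(\<Prod>k<n. rI q (x * q ^ 4) ((q\<^sup>2) ^ k) * (q\<^sup>2) ^ k) * \<phi> ((q\<^sup>2) ^ 0)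
      = (\<Prod>k<n. e ((q\<^sup>2) ^ k) * (q\<^sup>2) ^ k) * \<phi> ((q\<^sup>2) ^ n)"
    proof (rule prod_gauge)
      fix k
      define X where "X = (q\<^sup>2) ^ k"
      note nz = nz[of k, folded X_def]
      have X: "(q\<^sup>2) ^ Suc k = q\<^sup>2 * X"
        by (simp add: X_def)
      have p: "x * q ^ 4 + q\<^sup>2 * X\<^sup>2 = q\<^sup>2 * (q\<^sup>2 * x + X\<^sup>2)"
        by algebra
      have "rI q (x * q ^ 4) X * X * \<phi> X
          = - ((q\<^sup>2 * x + X\<^sup>2) * q ^ 5 * X ^ 3) / (D X * E (q ^ 4 * X) * M X)"
        unfolding r' p \<phi>_def using nz by (simp add: mult_ac power2_eq_square power_numeral_reduce)
      also have "\<dots> = e X * X * \<phi> (q\<^sup>2 * X)"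
        unfolding e_def \<phi>_def using nz by (simp add: mult_ac power2_eq_square power_numeral_reduce)
      finally show "rI q (x * q ^ 4) ((q\<^sup>2) ^ k) * (q\<^sup>2) ^ k * \<phi> ((q\<^sup>2) ^ k)
          = e ((q\<^sup>2) ^ k) * (q\<^sup>2) ^ k * \<phi> ((q\<^sup>2) ^ Suc k)"
        unfolding X X_def[symmetric] .
    qed
    thus ?thesis by simp
  qed
  have contD: "isCont D 0" "isCont E 0" "isCont M 0" "isCont N 0" "D 0 = 1" "E 0 = 1" "M 0 = 1" "N 0 = 1"
    unfolding D_def E_def M_def N_def by (auto intro!: continuous_intros)
  have contE: "isCont (\<lambda>X. E (c * X)) 0" "isCont (\<lambda>X. N (c * X)) 0" for c
    unfolding E_def N_def by (intro continuous_intros)+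
  have cont: "isCont e 0"
    unfolding e_def by (intro continuous_intros contD contE) (auto simp: contD)
  have sumI: "summable (\<lambda>n. (\<Prod>k<n. rI q c ((q\<^sup>2) ^ k) * (q\<^sup>2) ^ k) * (1 - q * (q\<^sup>2) ^ n)\<^sup>2)" for c
    using summable_norm_cancel[OF qseries_summable[OF q2, of "rI q c" "\<lambda>X. (1 - q * X)\<^sup>2"]]
    by (simp add: rI_def[abs_def] continuous_intros)
  let ?v = "\<lambda>X. N X * (X\<^sup>2 + q\<^sup>2 * x) * E X * E (q\<^sup>2 * X)"
  have "(\<Sum>n. (\<Prod>k<n. e ((q\<^sup>2) ^ k) * (q\<^sup>2) ^ k) * ?v ((q\<^sup>2) ^ n))
      - (\<Sum>n. (\<Prod>k<n. e ((q\<^sup>2) ^ k) * (q\<^sup>2) ^ k) * (C * (((q\<^sup>2) ^ n)\<^sup>2 * N ((q\<^sup>2) ^ n)))) = - 0"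
  proof (rule qseries_telescope[OF q2 cont, where v = ?v and w = "\<lambda>X. C * (X\<^sup>2 * N X)"
        and G = "\<lambda>X. - (q\<^sup>2 * x * (1 - X\<^sup>2) * E (q\<^sup>2 * X) * (1 - q * X + q\<^sup>2 * X\<^sup>2))"])
    fix n
    define X where "X = (q\<^sup>2) ^ n"
    note nz = nz[of n, folded X_def]
    have "1 - (q\<^sup>2 * X)\<^sup>2 = D X" "1 - q * (q\<^sup>2 * X) + q\<^sup>2 * (q\<^sup>2 * X)\<^sup>2 = M X"
      unfolding D_def M_def by algebra+
    hence *: "e X * X * (- (q\<^sup>2 * x * (1 - (q\<^sup>2 * X)\<^sup>2) * E (q\<^sup>2 * (q\<^sup>2 * X)) * (1 - q * (q\<^sup>2 * X) + q\<^sup>2 * (q\<^sup>2 * X)\<^sup>2)))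
       = N (q\<^sup>2 * X) * (q\<^sup>2 * x + X\<^sup>2) * q * X * (q\<^sup>2 * x)"
      using nz by (simp add: e_def sh)
    have "?v X - C * (X\<^sup>2 * N X)
      = e X * X * (- (q\<^sup>2 * x * (1 - (q\<^sup>2 * X)\<^sup>2) * E (q\<^sup>2 * (q\<^sup>2 * X)) * (1 - q * (q\<^sup>2 * X) + q\<^sup>2 * (q\<^sup>2 * X)\<^sup>2)))
        - (- (q\<^sup>2 * x * (1 - X\<^sup>2) * E (q\<^sup>2 * X) * (1 - q * X + q\<^sup>2 * X\<^sup>2)))"
      unfolding *
      unfolding C_def E_def N_def by algebra
    thus "?v ((q\<^sup>2) ^ n) - C * (((q\<^sup>2) ^ n)\<^sup>2 * N ((q\<^sup>2) ^ n))
      = e ((q\<^sup>2) ^ n) * (q\<^sup>2) ^ n * (- (q\<^sup>2 * x * (1 - (q\<^sup>2 * (q\<^sup>2) ^ n)\<^sup>2) * E (q\<^sup>2 * (q\<^sup>2 * (q\<^sup>2) ^ n)) *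
          (1 - q * (q\<^sup>2 * (q\<^sup>2) ^ n) + q\<^sup>2 * (q\<^sup>2 * (q\<^sup>2) ^ n)\<^sup>2)))
        - (- (q\<^sup>2 * x * (1 - ((q\<^sup>2) ^ n)\<^sup>2) * E (q\<^sup>2 * (q\<^sup>2) ^ n) * (1 - q * (q\<^sup>2) ^ n + q\<^sup>2 * ((q\<^sup>2) ^ n)\<^sup>2)))"
      unfolding X_def .
  qed (auto intro!: continuous_intros contD contE)
  hence "(\<Sum>n. (\<Prod>k<n. e ((q\<^sup>2) ^ k) * (q\<^sup>2) ^ k) * ?v ((q\<^sup>2) ^ n))
      = (\<Sum>n. (\<Prod>k<n. e ((q\<^sup>2) ^ k) * (q\<^sup>2) ^ k) * (C * (((q\<^sup>2) ^ n)\<^sup>2 * N ((q\<^sup>2) ^ n))))"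
    by simp
  also have "(\<Sum>n. (\<Prod>k<n. e ((q\<^sup>2) ^ k) * (q\<^sup>2) ^ k) * ?v ((q\<^sup>2) ^ n)) = \<psi> 1 * I q x"
    unfolding I_def suminf_mult[OF sumI, symmetric]
  proof (rule suminf_cong)
    fix n
    show "(\<Prod>k<n. e ((q\<^sup>2) ^ k) * (q\<^sup>2) ^ k) * ?v ((q\<^sup>2) ^ n)
       = \<psi> 1 * ((\<Prod>k<n. rI q x ((q\<^sup>2) ^ k) * (q\<^sup>2) ^ k) * (1 - q * (q\<^sup>2) ^ n)\<^sup>2)"
      using arg_cong[OF T1[of n], of "\<lambda>z. z * (N ((q\<^sup>2) ^ n))\<^sup>2"] nz[of n]
      by (simp add: \<psi>_def power2_eq_square mult_ac) (simp add: N_def mult_ac)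
  qed
  also have "(\<Sum>n. (\<Prod>k<n. e ((q\<^sup>2) ^ k) * (q\<^sup>2) ^ k) * (C * (((q\<^sup>2) ^ n)\<^sup>2 * N ((q\<^sup>2) ^ n))))
     = C * \<phi> 1 * I q (x * q ^ 4)"
    unfolding I_def suminf_mult[OF sumI, symmetric]
  proof (rule suminf_cong)
    fix n
    show "(\<Prod>k<n. e ((q\<^sup>2) ^ k) * (q\<^sup>2) ^ k) * (C * (((q\<^sup>2) ^ n)\<^sup>2 * N ((q\<^sup>2) ^ n)))
       = C * \<phi> 1 * ((\<Prod>k<n. rI q (x * q ^ 4) ((q\<^sup>2) ^ k) * (q\<^sup>2) ^ k) * (1 - q * (q\<^sup>2) ^ n)\<^sup>2)"
      using arg_cong[OF T2[of n], of "\<lambda>z. z * (N ((q\<^sup>2) ^ n))\<^sup>2 * C"] nz[of n]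
      by (simp add: \<phi>_def power2_eq_square mult_ac) (simp add: N_def mult_ac)
  qed
  finally have main: "\<psi> 1 * I q x = C * \<phi> 1 * I q (x * q ^ 4)" .
  have "\<psi> 1 * N 1 = (1 + q\<^sup>2 * x) * (E 1 * E (q\<^sup>2))" "\<phi> 1 * N 1 = 1"
    using nz(6)[of 0] by (simp_all add: \<psi>_def \<phi>_def mult_ac)
  moreover have "(\<psi> 1 * N 1) * I q x = C * (\<phi> 1 * N 1) * I q (x * q ^ 4)"
    using arg_cong[OF main, of "\<lambda>z. z * N 1"] by (simp only: mult_ac)
  ultimately have "(1 + q\<^sup>2 * x) * (E 1 * E (q\<^sup>2) * I q x)
      = (1 + q\<^sup>2 * x) * ((1 - q ^ 4 * x + q ^ 8 * x\<^sup>2) * I q (x * q ^ 4))"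
    by (simp add: C_def mult.assoc)
  moreover have "1 + q\<^sup>2 * x \<noteq> 0"
    using one_minus_mult_neq_0[OF q2, of "- x"] x by simp
  ultimately have "E 1 * E (q\<^sup>2) * I q x = (1 - q ^ 4 * x + q ^ 8 * x\<^sup>2) * I q (x * q ^ 4)"
    by simp
  moreover have "E 1 = 1 + q ^ 3 * x" "E (q\<^sup>2) = 1 + q ^ 5 * x"
    unfolding E_def by (simp_all add: power_numeral_reduce mult_ac)
  ultimately show ?thesis by simp
qed

lemma first_order_iterate_from:
  fixes f :: "complex \<Rightarrow> complex" and c :: "nat \<Rightarrow> complex"
  assumes "\<And>j. f (x * p ^ j) = c j * f (x * p ^ Suc j)"
    "(\<lambda>j. f (x * p ^ j)) \<longlonglongrightarrow> L" "(\<lambda>n. \<Prod>j<n. c j) \<longlonglongrightarrow> R"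
  shows "f x = R * L"
  using iterate_first_order[of "\<lambda>j. f (x * p ^ j)" c L R] assms by simp

text \<open>The limit \<open>I q 0\<close> is not an Euler series and stays as an unknown constant;
  it is eliminated later by taking \<open>x = 1\<close> and \<open>x = - q^2\<close>.\<close>

lemma I_value:
  assumes q: "norm q < 1" and x: "norm x \<le> 1"
  shows "I q x = qpoch_inf (- (q ^ 12 * x ^ 3)) (q ^ 12)
      / (qpoch_inf (- (q ^ 4 * x)) (q ^ 4) * qpoch_inf (- (q ^ 3 * x)) (q ^ 4) * qpoch_inf (- (q ^ 5 * x)) (q ^ 4)) * I q 0"
proof (rule first_order_iterate_from[where f = "I q" and p = "q ^ 4"
      and c = "\<lambda>j. (1 - (- (q ^ 12 * x ^ 3)) * (q ^ 12) ^ j)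
      / ((1 - (- (q ^ 4 * x)) * (q ^ 4) ^ j) * (1 - (- (q ^ 3 * x)) * (q ^ 4) ^ j) * (1 - (- (q ^ 5 * x)) * (q ^ 4) ^ j))"])
  have q': "norm (q\<^sup>2) < 1" "norm (q ^ 3) < 1" "norm (q ^ 4) < 1" "norm (q ^ 5) < 1" "norm (q ^ 12) < 1"
    by (rule norm_power_less_one[OF q]; simp)+
  have xj: "norm (x * (q ^ 4) ^ j) \<le> 1" for j
    by (intro norm_mult_le_one x norm_pow_le_one) (use q in simp)
  have nx: "norm (q ^ n * x) < 1" if "n > 0" for n
  proof -
    have "norm (q ^ n * x) \<le> norm (q ^ n) * 1"
      unfolding norm_mult using x by (intro mult_left_mono) auto
    thus ?thesis using norm_power_less_one[OF q that] by simp
  qed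
  show "I q (x * (q ^ 4) ^ j) = (1 - (- (q ^ 12 * x ^ 3)) * (q ^ 12) ^ j)
      / ((1 - (- (q ^ 4 * x)) * (q ^ 4) ^ j) * (1 - (- (q ^ 3 * x)) * (q ^ 4) ^ j) * (1 - (- (q ^ 5 * x)) * (q ^ 4) ^ j))
      * I q (x * (q ^ 4) ^ Suc j)" for j
  proof -
    define y where "y = x * (q ^ 4) ^ j"
    have y: "norm y \<le> 1"
      using xj by (simp add: y_def)
    have y3: "y ^ 3 = x ^ 3 * (q ^ 12) ^ j"
      by (simp add: y_def power_mult_distrib flip: power_mult)
    \<comment> \<open>Multiplication by \<open>1 + q^4 y\<close> completes the quadratic numerator
      to a cube, hence the base \<open>q^12\<close>.\<close>
    have cy: "(1 - q ^ 4 * y + q ^ 8 * y\<^sup>2) * (1 + q ^ 4 * y) = 1 + q ^ 12 * y ^ 3"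
      by algebra
    have nz: "1 + q ^ 3 * y \<noteq> 0" "1 + q ^ 4 * y \<noteq> 0" "1 + q ^ 5 * y \<noteq> 0"
      using one_minus_mult_neq_0[OF q'(2), of "- y"] one_minus_mult_neq_0[OF q'(3), of "- y"]
        one_minus_mult_neq_0[OF q'(4), of "- y"] y by auto
    have "((1 + q ^ 4 * y) * (1 + q ^ 3 * y) * (1 + q ^ 5 * y)) * I q y
      = (1 + q ^ 4 * y) * ((1 + q ^ 3 * y) * (1 + q ^ 5 * y) * I q y)"
      by (simp only: mult_ac)
    also have "\<dots> = (1 + q ^ 12 * y ^ 3) * I q (y * q ^ 4)"
      unfolding I_step[OF q y] cy[symmetric] by (simp only: mult_ac)
    finally have "I q y = (1 + q ^ 12 * y ^ 3) / ((1 + q ^ 4 * y) * (1 + q ^ 3 * y) * (1 + q ^ 5 * y)) * I q (y * q ^ 4)"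
      using nz by (intro eq_divide_multI) simp_all
    thus ?thesis
      unfolding y3 by (simp add: y_def mult_ac)
  qed
  have "(\<lambda>j. \<Sum>n. (\<Prod>k<n. rI q (x * (q ^ 4) ^ j) ((q\<^sup>2) ^ k) * (q\<^sup>2) ^ k) * (1 - q * (q\<^sup>2) ^ n)\<^sup>2)
      \<longlonglongrightarrow> (\<Sum>n. (\<Prod>k<n. rI q 0 ((q\<^sup>2) ^ k) * (q\<^sup>2) ^ k) * (1 - q * (q\<^sup>2) ^ n)\<^sup>2)"
  proof (rule family_tendsto[where w = "\<lambda>x X. (1 - q * X)\<^sup>2" and B = "2 * 2", OF q'(1)])
    fix x X :: complex assume x: "norm x \<le> 1" "norm X \<le> 1"
    have b: "norm (1 - q * X) \<le> 2"
      using norm_add_le_two[of 1 "- (q * X)"] norm_mult_le_one[of q X] q x by simp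
    show "norm ((1 - q * X)\<^sup>2) \<le> 2 * 2"
      unfolding power2_eq_square by (intro norm_mult_le_mult b)
    have b': "norm (- (1 - q * X)) \<le> 2"
      using b by (simp add: norm_minus_commute)
    show "norm (rI q x X) \<le> (2 * 2 * 1) / ((1 - norm q) * (1 - norm q) * ((1 - norm q) / 2))"
      unfolding rI_def using q x b'
      by (intro norm_divide_le norm_mult_le_mult mult_le_norm_mult norm_add_le_two norm_cyclotomic3_ge
          norm_one_minus_ge norm_mult_le_one norm_pow_le_one mult_pos_pos mult_nonneg_nonneg)
        (auto simp: norm_mult_le_one norm_pow_le_one)
  next
    show "isCont (\<lambda>x. rI q x ((q\<^sup>2) ^ k)) 0" for k
      using one_minus_mult_neq_0[OF q, of "q ^ 3 * ((q\<^sup>2) ^ k)\<^sup>2"]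
        cyclotomic3_neq_0[OF q, of "- (q\<^sup>2 * (q\<^sup>2) ^ k)"] q q'
      unfolding rI_def by (intro continuous_intros) (auto simp: norm_mult_le_one norm_pow_le_one)
    show "(\<lambda>j. x * (q ^ 4) ^ j) \<longlonglongrightarrow> 0"
      by (rule geometric_to_0[OF q'(3)])
  qed (use xj in auto)
  thus "(\<lambda>j. I q (x * (q ^ 4) ^ j)) \<longlonglongrightarrow> I q 0"
    by (simp add: I_def)
  show "(\<lambda>n. \<Prod>j<n. (1 - (- (q ^ 12 * x ^ 3)) * (q ^ 12) ^ j)
      / ((1 - (- (q ^ 4 * x)) * (q ^ 4) ^ j) * (1 - (- (q ^ 3 * x)) * (q ^ 4) ^ j) * (1 - (- (q ^ 5 * x)) * (q ^ 4) ^ j)))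
    \<longlonglongrightarrow> qpoch_inf (- (q ^ 12 * x ^ 3)) (q ^ 12)
      / (qpoch_inf (- (q ^ 4 * x)) (q ^ 4) * qpoch_inf (- (q ^ 3 * x)) (q ^ 4) * qpoch_inf (- (q ^ 5 * x)) (q ^ 4))"
    unfolding prod_dividef prod.distrib
    by (intro tendsto_intros qpoch_inf_tendsto_prod q')
      (auto simp: qpoch_inf_nonzero' q q' nx)
qed

text \<open>The numerator factor at \<open>k = 0\<close> is \<open>x + q^2 = 0\<close>, so only the
  term \<open>n = 0\<close> remains. This is the known member that determines
  \<open>I q 0\<close>.\<close>

lemma I_terminating:
  "I q (- (q\<^sup>2)) = (1 - q)\<^sup>2"
proof -
  have "rI q (- (q\<^sup>2)) ((q\<^sup>2) ^ 0) = 0"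
    by (simp add: rI_def)
  hence "(\<Prod>k<n. rI q (- (q\<^sup>2)) ((q\<^sup>2) ^ k) * (q\<^sup>2) ^ k) = 0" if "n \<noteq> 0" for n
    using that by (intro prod_zero) (auto intro!: bexI[of _ 0])
  hence "(\<lambda>n. (\<Prod>k<n. rI q (- (q\<^sup>2)) ((q\<^sup>2) ^ k) * (q\<^sup>2) ^ k) * (1 - q * (q\<^sup>2) ^ n)\<^sup>2)
    sums (\<Sum>n\<in>{0}. (\<Prod>k<n. rI q (- (q\<^sup>2)) ((q\<^sup>2) ^ k) * (q\<^sup>2) ^ k) * (1 - q * (q\<^sup>2) ^ n)\<^sup>2)"
    by (intro sums_finite) auto
  thus ?thesis
    by (simp add: I_def sums_iff)
qed

text \<open>\<open>norm b < 1\<close> keeps every iterate away from the exceptional point 1. The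
  constant \<open>B q 0\<close> is determined later from the member \<open>b = q^12\<close>.\<close>

lemma B_value:
  assumes q: "norm q < 1" and b: "norm b < 1"
  shows "B q b = qpoch_inf (q ^ 4 * b) (q ^ 12) * qpoch_inf (q ^ 8 * b) (q ^ 12)
      / (qpoch_inf (q ^ 3 * b) (q ^ 12) * qpoch_inf (q ^ 9 * b) (q ^ 12)) * B q 0"
proof (rule first_order_iterate_from[where f = "B q" and p = "q ^ 12"
      and c = "\<lambda>j. (1 - (q ^ 4 * b) * (q ^ 12) ^ j) * (1 - (q ^ 8 * b) * (q ^ 12) ^ j)
      / ((1 - (q ^ 3 * b) * (q ^ 12) ^ j) * (1 - (q ^ 9 * b) * (q ^ 12) ^ j))"])
  have q': "norm (q\<^sup>2) < 1" "norm (q ^ 3) < 1" "norm (q ^ 9) < 1" "norm (q ^ 12) < 1"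
    by (rule norm_power_less_one[OF q]; simp)+
  have xj: "norm (b * (q ^ 12) ^ j) < 1" for j
  proof -
    have "norm (b * (q ^ 12) ^ j) \<le> norm b * 1"
      unfolding norm_mult by (intro mult_left_mono norm_pow_le_one) (use q in auto)
    thus ?thesis using b by simp
  qed
  have nx: "norm (q ^ n * b) < 1" if "n > 0" for n
  proof -
    have "norm (q ^ n * b) \<le> norm (q ^ n) * 1"
      unfolding norm_mult using b by (intro mult_left_mono) auto
    thus ?thesis using norm_power_less_one[OF q that] by simp
  qed
  show "B q (b * (q ^ 12) ^ j) = (1 - (q ^ 4 * b) * (q ^ 12) ^ j) * (1 - (q ^ 8 * b) * (q ^ 12) ^ j)
      / ((1 - (q ^ 3 * b) * (q ^ 12) ^ j) * (1 - (q ^ 9 * b) * (q ^ 12) ^ j)) * B q (b * (q ^ 12) ^ Suc j)" for j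
  proof -
    define y where "y = b * (q ^ 12) ^ j"
    have y: "norm y \<le> 1" "y \<noteq> 1"
      using xj[of j] by (auto simp: y_def)
    have nz: "1 - q ^ 3 * y \<noteq> 0" "1 - q ^ 9 * y \<noteq> 0"
      using one_minus_mult_neq_0[OF q'(2), of y] one_minus_mult_neq_0[OF q'(3), of y] y by auto
    have "B q y = (1 - q ^ 4 * y) * (1 - q ^ 8 * y) / ((1 - q ^ 3 * y) * (1 - q ^ 9 * y)) * B q (y * q ^ 12)"
      using nz B_step[OF q y] by (intro eq_divide_multI) simp_all
    thus ?thesis
      by (simp add: y_def mult_ac)
  qed
  have "(\<lambda>j. \<Sum>n. (\<Prod>k<n. rB q (b * (q ^ 12) ^ j) ((q\<^sup>2) ^ k) * (q\<^sup>2) ^ k) * 1)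
      \<longlonglongrightarrow> (\<Sum>n. (\<Prod>k<n. rB q 0 ((q\<^sup>2) ^ k) * (q\<^sup>2) ^ k) * 1)"
  proof (rule family_tendsto[where B = 1, OF q'(1)])
    fix x X :: complex assume x: "norm x \<le> 1" "norm X \<le> 1"
    have b': "norm (- (1 - q * X)) \<le> 2" "norm (1 - x * X\<^sup>2) \<le> 2"
      using norm_add_le_two[of 1 "- (q * X)"] norm_mult_le_one[of q X]
        norm_add_le_two[of 1 "- (x * X\<^sup>2)"] norm_mult_le_one[of x "X\<^sup>2"] q x norm_pow_le_one[of X 2]
      by (auto simp: norm_minus_commute)
    show "norm (rB q x X) \<le> (2 * 2 * 1) / ((1 - norm q) * (1 - norm q))"
      unfolding rB_def using q x b'
      by (intro norm_divide_le norm_mult_le_mult mult_le_norm_mult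
          norm_one_minus_ge norm_mult_le_one norm_pow_le_one mult_pos_pos mult_nonneg_nonneg) auto
  next
    show "isCont (\<lambda>x. rB q x ((q\<^sup>2) ^ k)) 0" for k
      using one_minus_mult_neq_0[OF q, of "q ^ 3 * ((q\<^sup>2) ^ k)\<^sup>2"] q q'
      unfolding rB_def by (intro continuous_intros) (auto simp: norm_mult_le_one norm_pow_le_one)
    show "(\<lambda>j. b * (q ^ 12) ^ j) \<longlonglongrightarrow> 0"
      by (rule geometric_to_0[OF q'(4)])
    show "norm (b * (q ^ 12) ^ j) \<le> 1" for j
      using xj[of j] by simp
  qed auto
  thus "(\<lambda>j. B q (b * (q ^ 12) ^ j)) \<longlonglongrightarrow> B q 0"
    by (simp add: B_def)
  show "(\<lambda>n. \<Prod>j<n. (1 - (q ^ 4 * b) * (q ^ 12) ^ j) * (1 - (q ^ 8 * b) * (q ^ 12) ^ j)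
      / ((1 - (q ^ 3 * b) * (q ^ 12) ^ j) * (1 - (q ^ 9 * b) * (q ^ 12) ^ j)))
    \<longlonglongrightarrow> qpoch_inf (q ^ 4 * b) (q ^ 12) * qpoch_inf (q ^ 8 * b) (q ^ 12)
      / (qpoch_inf (q ^ 3 * b) (q ^ 12) * qpoch_inf (q ^ 9 * b) (q ^ 12))"
    unfolding prod_dividef prod.distrib
    by (intro tendsto_intros qpoch_inf_tendsto_prod q')
      (auto simp: qpoch_inf_nonzero' q q' nx)
qed

section \<open>Products over residue classes modulo 12\<close>

lemma qpoch_2_mod_12:
  assumes x: "norm x < 1"
  shows "qpoch_inf (x\<^sup>2) (x ^ 12) * qpoch_inf (x ^ 10) (x ^ 12) = P (x\<^sup>2) * P (x ^ 12) / (P (x ^ 4) * P (x ^ 6))"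
proof -
  have pw: "norm (x ^ n) < 1" if "n > 0" for n
    using x that by (rule norm_power_less_one)
  have e: "x\<^sup>2 * x ^ 4 = x ^ 6" "x\<^sup>2 * (x ^ 4)\<^sup>2 = x ^ 10" "(x ^ 4) ^ 3 = x ^ 12" "(x\<^sup>2)\<^sup>2 = x ^ 4" "(x ^ 6)\<^sup>2 = x ^ 12"
    by (simp_all flip: power_mult power_add)
  have "P (x\<^sup>2) / P (x ^ 4) = qpoch_inf (x\<^sup>2) (x ^ 12) * (P (x ^ 6) / P (x ^ 12)) * qpoch_inf (x ^ 10) (x ^ 12)"
    using qpoch_inf_split3[OF pw[of 4], of "x\<^sup>2"] qpoch_odd[OF pw[of 2]] qpoch_odd[OF pw[of 6]] unfolding e by simp
  thus ?thesis
    using P_nonzero[OF pw[of 6]] P_nonzero[OF pw[of 12]] P_nonzero[OF pw[of 4]] by (simp add: field_simps)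
qed

lemma qpoch_3_mod_12:
  assumes x: "norm x < 1"
  shows "qpoch_inf (x ^ 3) (x ^ 12) * qpoch_inf (x ^ 9) (x ^ 12) = P (x ^ 3) / P (x ^ 6)"
proof -
  have pw: "norm (x ^ n) < 1" if "n > 0" for n
    using x that by (rule norm_power_less_one)
  have e: "x ^ 3 * x ^ 6 = x ^ 9" "(x ^ 3)\<^sup>2 = x ^ 6" "(x ^ 6)\<^sup>2 = x ^ 12"
    by (simp_all flip: power_mult power_add)
  show ?thesis
    using qpoch_inf_split2[OF pw[of 6], of "x ^ 3"] qpoch_odd[OF pw[of 3]] unfolding e by simp
qed

text \<open>The classes 1, 5, 7, 11 are the odd ones prime to 3: from \<open>(x;x^2)_inf\<close> the
  odd multiples of 3, \<open>(x^3;x^6)_inf\<close>, are removed.\<close>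

lemma qpoch_15_mod_12:
  assumes x: "norm x < 1"
  shows "(qpoch_inf x (x ^ 12) * qpoch_inf (x ^ 11) (x ^ 12)) * (qpoch_inf (x ^ 5) (x ^ 12) * qpoch_inf (x ^ 7) (x ^ 12))
    = P x * P (x ^ 6) / (P (x\<^sup>2) * P (x ^ 3))"
proof -
  have pw: "norm (x ^ n) < 1" if "n > 0" for n
    using x that by (rule norm_power_less_one)
  have e: "x * x\<^sup>2 = x ^ 3" "x * (x\<^sup>2)\<^sup>2 = x ^ 5" "(x\<^sup>2) ^ 3 = x ^ 6" "(x ^ 6)\<^sup>2 = x ^ 12" "x * x ^ 6 = x ^ 7"
     "x ^ 5 * x ^ 6 = x ^ 11" "(x ^ 3)\<^sup>2 = x ^ 6"
    by (simp_all flip: power_mult power_add power_Suc)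
  have "P x / P (x\<^sup>2) = (qpoch_inf x (x ^ 12) * qpoch_inf (x ^ 7) (x ^ 12)) * (P (x ^ 3) / P (x ^ 6))
      * (qpoch_inf (x ^ 5) (x ^ 12) * qpoch_inf (x ^ 11) (x ^ 12))"
    using qpoch_inf_split3[OF pw[of 2], of x] qpoch_odd[OF x] qpoch_odd[OF pw[of 3]]
      qpoch_inf_split2[OF pw[of 6], of x] qpoch_inf_split2[OF pw[of 6], of "x ^ 5"] unfolding e by simp
  thus ?thesis
    using P_nonzero[OF pw[of 6]] P_nonzero[OF pw[of 3]] P_nonzero[OF pw[of 2]] by (simp add: field_simps)
qed

text \<open>With \<open>r = q^2\<close>, subtracting the two identities of \<open>theta_pair\<close>
  at the base \<open>- r\<close> isolates \<open>J_{5,12} J_{2,24}\<close> at that base. The class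
  factors 5 and 7 link this product to \<open>J2 q 2 24\<close>, which is \<open>J_{1,12}\<close> at
  \<open>r\<close>.\<close>

lemma theta_difference:
  assumes q: "norm q < 1" "q \<noteq> 0"
  shows "2 * q\<^sup>2 * J2 q 2 24 = P (q ^ 4) ^ 3 / (P (q\<^sup>2) * P (q ^ 8))
    - P (q\<^sup>2) * P (q ^ 8) * P (q ^ 12) ^ 5 / ((P (q ^ 4))\<^sup>2 * (P (q ^ 6))\<^sup>2 * (P (q ^ 24))\<^sup>2)"
proof -
  define r where "r = q\<^sup>2"
  have r: "norm r < 1" "r \<noteq> 0"
    using q by (auto simp: r_def norm_power power_less_one_iff)
  have pw: "norm (r ^ n) < 1" if "n > 0" for n
    using r(1) that by (rule norm_power_less_one)
  have nz: "P r \<noteq> 0" "P (r\<^sup>2) \<noteq> 0" "P (r ^ 3) \<noteq> 0" "P (r ^ 4) \<noteq> 0" "P (r ^ 6) \<noteq> 0" "P (r ^ 12) \<noteq> 0" "P (r ^ 24) \<noteq> 0"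
    by (rule P_nonzero; use r pw in simp)+
  have qr: "q ^ 4 = r\<^sup>2" "q ^ 8 = r ^ 4" "q ^ 12 = r ^ 6" "q ^ 6 = r ^ 3" "q ^ 24 = r ^ 12" "q ^ 22 = r ^ 11"
    by (simp_all add: r_def flip: power_mult)
  define L where "L = J2 q 2 24"
  have L: "L = qpoch_inf r (r ^ 12) * qpoch_inf (r ^ 11) (r ^ 12) * P (r ^ 12)"
    by (simp add: L_def J2_def P_def qr r_def[symmetric])
  define b where "b = J2 (- r) 5 12 * J2 (- r) 2 24"
  have "- r \<noteq> 0" "norm (- r) < 1"
    using r by auto
  note T = theta_pair[OF this(2,1), folded b_def]
  have ev: "J (- r) 24 = P (r ^ 24)" "J (- r) 6 = P (r ^ 6)" "J (- r) 2 = P (r\<^sup>2)"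
    by (simp_all add: J_eq_P)
  have J1: "J (- r) 1 = P (r\<^sup>2) ^ 3 / (P r * P (r ^ 4))"
    using P_minus[OF r(1)] by (simp add: J_eq_P)
  have "(- r) ^ 3 = - (r ^ 3)" "(r ^ 3)\<^sup>2 = r ^ 6" "(r ^ 3) ^ 4 = r ^ 12"
    by (simp_all flip: power_mult)
  hence J3: "J (- r) 3 = P (r ^ 6) ^ 3 / (P (r ^ 3) * P (r ^ 12))"
    using P_minus[OF pw[of 3]] by (simp add: J_eq_P)
  have "2 * (- r) * b = J (- r) 3 * J (- r) 24 - J (- r) 24 * (J (- r) 1)\<^sup>2 * J (- r) 6 / (J (- r) 2 * J (- r) 3)"
    using T(1)[symmetric] T(2)[symmetric] by (simp add: algebra_simps)
  hence main: "2 * r * b = P (r ^ 24) * ((P (r\<^sup>2) ^ 3 / (P r * P (r ^ 4)))\<^sup>2 * P (r ^ 6) / (P (r\<^sup>2) * (P (r ^ 6) ^ 3 / (P (r ^ 3) * P (r ^ 12))))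
      - P (r ^ 6) ^ 3 / (P (r ^ 3) * P (r ^ 12)))"
    unfolding ev J1 J3 by (simp add: algebra_simps)
  \<comment> \<open>This cofactor serves twice: \<open>L * c\<close> contains the classes 1, 5, 7,
    11, and in \<open>c * b\<close> the factors at \<open>r^5\<close> and \<open>- r^5\<close>
    (likewise \<open>r^7\<close>) merge to squares, completing the classes 2 and 10 modulo
    12.\<close>
  define c where "c = qpoch_inf (r ^ 5) (r ^ 12) * qpoch_inf (r ^ 7) (r ^ 12)"
  have b: "c * b = P (r ^ 12) * P (r ^ 24) * (P (r\<^sup>2) * P (r ^ 12) / (P (r ^ 4) * P (r ^ 6)))"
  proof -
    have e: "(r ^ 5)\<^sup>2 = r ^ 10" "(r ^ 7)\<^sup>2 = r ^ 14" "(r ^ 12)\<^sup>2 = r ^ 24" "r\<^sup>2 * r ^ 12 = r ^ 14" "r ^ 10 * r ^ 12 = r ^ 22"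
      by (simp_all flip: power_mult power_add)
    have m: "(- r) ^ 5 = - (r ^ 5)" "(- r) ^ 7 = - (r ^ 7)" "(- r) ^ 12 = r ^ 12" "(- r)\<^sup>2 = r\<^sup>2" "(- r) ^ 22 = r ^ 22" "(- r) ^ 24 = r ^ 24"
      by simp_all
    have "c * b = (qpoch_inf (r ^ 5) (r ^ 12) * qpoch_inf (- (r ^ 5)) (r ^ 12)) * (qpoch_inf (r ^ 7) (r ^ 12) * qpoch_inf (- (r ^ 7)) (r ^ 12))
        * qpoch_inf (r\<^sup>2) (r ^ 24) * qpoch_inf (r ^ 22) (r ^ 24) * P (r ^ 12) * P (r ^ 24)"
      unfolding b_def c_def J2_def P_def by (simp add: m mult_ac)
    also have "\<dots> = (qpoch_inf (r\<^sup>2) (r ^ 24) * qpoch_inf (r ^ 14) (r ^ 24)) * (qpoch_inf (r ^ 10) (r ^ 24) * qpoch_inf (r ^ 22) (r ^ 24))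
        * P (r ^ 12) * P (r ^ 24)"
      using qpoch_inf_square[OF pw[of 12], of "r ^ 5"] qpoch_inf_square[OF pw[of 12], of "r ^ 7"] unfolding e by simp
    also have "\<dots> = (qpoch_inf (r\<^sup>2) (r ^ 12) * qpoch_inf (r ^ 10) (r ^ 12)) * P (r ^ 12) * P (r ^ 24)"
      using qpoch_inf_split2[OF pw[of 12], of "r\<^sup>2"] qpoch_inf_split2[OF pw[of 12], of "r ^ 10"] unfolding e by simp
    finally show ?thesis
      unfolding qpoch_2_mod_12[OF r(1)] by (simp only: mult_ac)
  qed
  have c: "L * c = P r * P (r ^ 6) * P (r ^ 12) / (P (r\<^sup>2) * P (r ^ 3))"
    using qpoch_15_mod_12[OF r(1)] unfolding L c_def by (simp add: mult_ac)
  have "L * (c * b) = (L * c) * b"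
    by (simp only: mult.assoc)
  hence Lb: "L * (P (r ^ 12) * P (r ^ 24) * (P (r\<^sup>2) * P (r ^ 12) / (P (r ^ 4) * P (r ^ 6))))
     = P r * P (r ^ 6) * P (r ^ 12) / (P (r\<^sup>2) * P (r ^ 3)) * b"
    unfolding b c .
  have gen: "2 * r * L = p2 ^ 3 / (p1 * p4) - p1 * p4 * p6 ^ 5 / (p2\<^sup>2 * p3\<^sup>2 * p12\<^sup>2)"
    if m: "2 * r * b = p24 * ((p2 ^ 3 / (p1 * p4))\<^sup>2 * p6 / (p2 * (p6 ^ 3 / (p3 * p12))) - p6 ^ 3 / (p3 * p12))"
      and l: "L * (p12 * p24 * (p2 * p12 / (p4 * p6))) = p1 * p6 * p12 / (p2 * p3) * b"
      and nz: "p1 \<noteq> 0" "p2 \<noteq> 0" "p3 \<noteq> 0" "p4 \<noteq> 0" "p6 \<noteq> 0" "p12 \<noteq> 0" "p24 \<noteq> 0"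
    for p1 p2 p3 p4 p6 p12 p24 :: complex
  proof -
    have "L = p1 * p4 * p6\<^sup>2 / (p2\<^sup>2 * p3 * p12 * p24) * b"
      using l nz by (simp add: field_simps power2_eq_square)
    hence "2 * r * L = p1 * p4 * p6\<^sup>2 / (p2\<^sup>2 * p3 * p12 * p24) * (2 * r * b)"
      by simp
    also have "\<dots> = p2 ^ 3 / (p1 * p4) - p1 * p4 * p6 ^ 5 / (p2\<^sup>2 * p3\<^sup>2 * p12\<^sup>2)"
      unfolding m using nz by (simp add: field_simps power2_eq_square power_numeral_reduce)
    finally show ?thesis .
  qed
  show ?thesis
    unfolding L_def[symmetric] qr r_def[symmetric] by (rule gen[OF main Lb nz])
qed

text \<open>The third claim comes from \<open>psi_product\<close> multiplied by
  \<open>J_2 J_6 / (J_1 J_3 J_4 J_12)\<close>: the term \<open>psi(q) psi(q^3)\<close> becomes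
  \<open>F' q 1\<close> and \<open>psi(-q) psi(-q^3)\<close> becomes 1. Both
  \<open>F' q 1 + 1\<close> and \<open>H q 1\<close> are then
  \<open>2 J_6 J_8 / (J_1 J_3 J_12)\<close> times one of the two terms of
  \<open>theta_difference\<close>.\<close>

lemma F'_H_values:
  assumes q: "norm q < 1" "q \<noteq> 0"
  shows "F' q 1 = (J q 2) ^ 3 * (J q 6) ^ 3 / ((J q 1)\<^sup>2 * (J q 3)\<^sup>2 * J q 4 * J q 12)" (is ?F)
    and "H q 1 = 2 * (J q 4) ^ 3 * J q 6 / (J q 1 * J q 2 * J q 3 * J q 12)" (is ?H)
    and "H q 1 - F' q 1 - 1 = 4 * q\<^sup>2 * (J q 6 * J q 8 * J2 q 2 24 / (J q 1 * J q 3 * J q 12))" (is ?D)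
proof -
  have pw: "norm (q ^ n) < 1" if "n > 0" for n
    using q(1) that by (rule norm_power_less_one)
  have nz: "P q \<noteq> 0" "P (q\<^sup>2) \<noteq> 0" "P (q ^ 3) \<noteq> 0" "P (q ^ 4) \<noteq> 0" "P (q ^ 6) \<noteq> 0" "P (q ^ 8) \<noteq> 0" "P (q ^ 12) \<noteq> 0" "P (q ^ 24) \<noteq> 0"
    by (rule P_nonzero; use q pw in simp)+
  have e: "(q\<^sup>2)\<^sup>2 = q ^ 4" "(q ^ 3)\<^sup>2 = q ^ 6" "(q ^ 3) ^ 4 = q ^ 12" "(q\<^sup>2) ^ 3 = q ^ 6" "(q\<^sup>2) ^ 6 = q ^ 12" "(q ^ 4)\<^sup>2 = q ^ 8"
    "(q ^ 6)\<^sup>2 = q ^ 12" "(q ^ 6) ^ 4 = q ^ 24"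
    by (simp_all flip: power_mult)
  have qq: "q * q\<^sup>2 = q ^ 3"
    by (simp add: power2_eq_square power3_eq_cube)
  have odd4: "qpoch_inf q (q ^ 4) * qpoch_inf (q ^ 3) (q ^ 4) = P q / P (q\<^sup>2)"
    using qpoch_inf_split2[OF pw[of 2], of q] qpoch_odd[OF q(1)] unfolding e qq by simp
  have v: "qpoch_inf (- q) (q\<^sup>2) = (P (q\<^sup>2))\<^sup>2 / (P q * P (q ^ 4))"
    "qpoch_inf (- (q ^ 3)) (q ^ 6) = (P (q ^ 6))\<^sup>2 / (P (q ^ 3) * P (q ^ 12))"
    "qpoch_inf (- (q ^ 3)) (q ^ 3) = P (q ^ 6) / P (q ^ 3)" "qpoch_inf (- q) q = P (q\<^sup>2) / P q"
    "qpoch_inf (- (q\<^sup>2)) (q\<^sup>2) = P (q ^ 4) / P (q\<^sup>2)" "qpoch_inf q (q\<^sup>2) = P q / P (q\<^sup>2)"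
    "qpoch_inf (q ^ 3) (q ^ 6) = P (q ^ 3) / P (q ^ 6)"
    using qpoch_minus_odd[OF q(1)] qpoch_minus_odd[OF pw[of 3]] qpoch_minus_base[OF pw[of 3]] qpoch_minus_base[OF q(1)]
      qpoch_minus_base[OF pw[of 2]] qpoch_odd[OF q(1)] qpoch_odd[OF pw[of 3]] unfolding e by simp_all
  have v6: "qpoch_inf (- (q\<^sup>2)) (q ^ 6) * qpoch_inf (- (q ^ 4)) (q ^ 6) = P (q ^ 4) * P (q ^ 6) / (P (q\<^sup>2) * P (q ^ 12))"
    using qpoch_minus_thirds[OF pw[of 2]] unfolding e by simp
  have v1: "qpoch_inf (- 1) (q\<^sup>2) = 2 * (P (q ^ 4) / P (q\<^sup>2))"
    using qpoch_inf_unfold[OF pw[of 2], of "- 1"] v(5) by simp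
  show F: ?F
    unfolding F'_one[OF q(1)] odd4 v J_eq_P using nz
    by (simp add: field_simps power2_eq_square power3_eq_cube)
  have "H q 1 = qpoch_inf (- 1) (q\<^sup>2) * qpoch_inf (- (q\<^sup>2)) (q\<^sup>2)
      * (qpoch_inf (- (q\<^sup>2)) (q ^ 6) * qpoch_inf (- (q ^ 4)) (q ^ 6)) * qpoch_inf q (q\<^sup>2) * P (q\<^sup>2)
      / ((qpoch_inf q (q ^ 4) * qpoch_inf (q ^ 3) (q ^ 4)) * qpoch_inf (q ^ 3) (q ^ 6) * P (q ^ 6)) * qpoch_inf (- q) q"
    unfolding H_one[OF q] P_def by (simp only: mult.assoc)
  thus H: ?H
    unfolding odd4 v v1 v6 J_eq_P using nz
    by (simp add: field_simps power2_eq_square power3_eq_cube)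
  have m: "(- q)\<^sup>2 = q\<^sup>2" "(- q) ^ 3 = - (q ^ 3)" "(- (q ^ 3))\<^sup>2 = q ^ 6"
    by (simp_all flip: power_mult)
  have psi: "(P (q\<^sup>2))\<^sup>2 / P q * ((P (q ^ 6))\<^sup>2 / P (q ^ 3))
      + (P (q\<^sup>2))\<^sup>2 / (P (q\<^sup>2) ^ 3 / (P q * P (q ^ 4))) * ((P (q ^ 6))\<^sup>2 / (P (q ^ 6) ^ 3 / (P (q ^ 3) * P (q ^ 12))))
    = 2 * ((P (q ^ 8))\<^sup>2 / P (q ^ 4) * (P (q ^ 12) ^ 5 / ((P (q ^ 6))\<^sup>2 * (P (q ^ 24))\<^sup>2)))"
    using psi_product[OF q] P_minus[OF q(1)] P_minus[OF pw[of 3]] unfolding m e by simp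
  \<comment> \<open>Abstracting the values of \<open>P\<close> to variables leaves a rational
    identity that field normalisation can treat without touching powers of \<open>q\<close>.\<close>
  have gen: "2 * p4 ^ 3 * p6 / (p1 * p2 * p3 * p12) - p2 ^ 3 * p6 ^ 3 / (p1\<^sup>2 * p3\<^sup>2 * p4 * p12) - 1
      = 2 * (p6 * p8 / (p1 * p3 * p12)) * l"
    if ps: "p2\<^sup>2 / p1 * (p6\<^sup>2 / p3) + p2\<^sup>2 / (p2 ^ 3 / (p1 * p4)) * (p6\<^sup>2 / (p6 ^ 3 / (p3 * p12)))
        = 2 * (p8\<^sup>2 / p4 * (p12 ^ 5 / (p6\<^sup>2 * p24\<^sup>2)))"
      and l: "l = p4 ^ 3 / (p2 * p8) - p2 * p8 * p12 ^ 5 / (p4\<^sup>2 * p6\<^sup>2 * p24\<^sup>2)"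
      and nz: "p1 \<noteq> 0" "p2 \<noteq> 0" "p3 \<noteq> 0" "p4 \<noteq> 0" "p6 \<noteq> 0" "p8 \<noteq> 0" "p12 \<noteq> 0" "p24 \<noteq> 0"
    for p1 p2 p3 p4 p6 p8 p12 p24 l :: complex
  proof -
    have "p2 ^ 3 * p6 ^ 3 / (p1\<^sup>2 * p3\<^sup>2 * p4 * p12) + 1
        = (p2\<^sup>2 / p1 * (p6\<^sup>2 / p3) + p2\<^sup>2 / (p2 ^ 3 / (p1 * p4)) * (p6\<^sup>2 / (p6 ^ 3 / (p3 * p12)))) * (p2 * p6 / (p1 * p3 * p4 * p12))"
      using nz by (simp add: field_simps power2_eq_square power3_eq_cube)
    also have "\<dots> = 2 * (p6 * p8 / (p1 * p3 * p12)) * (p2 * p8 * p12 ^ 5 / (p4\<^sup>2 * p6\<^sup>2 * p24\<^sup>2))"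
      unfolding ps using nz by (simp add: field_simps power2_eq_square)
    finally have 1: "p2 ^ 3 * p6 ^ 3 / (p1\<^sup>2 * p3\<^sup>2 * p4 * p12) + 1
       = 2 * (p6 * p8 / (p1 * p3 * p12)) * (p2 * p8 * p12 ^ 5 / (p4\<^sup>2 * p6\<^sup>2 * p24\<^sup>2))" .
    have 2: "2 * p4 ^ 3 * p6 / (p1 * p2 * p3 * p12) = 2 * (p6 * p8 / (p1 * p3 * p12)) * (p4 ^ 3 / (p2 * p8))"
      using nz by (simp add: field_simps)
    have "2 * (p6 * p8 / (p1 * p3 * p12)) * l = 2 * p4 ^ 3 * p6 / (p1 * p2 * p3 * p12) - (p2 ^ 3 * p6 ^ 3 / (p1\<^sup>2 * p3\<^sup>2 * p4 * p12) + 1)"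
      unfolding 1 2 l by (simp only: right_diff_distrib)
    thus ?thesis by simp
  qed
  have "H q 1 - F' q 1 - 1 = 2 * (P (q ^ 6) * P (q ^ 8) / (P q * P (q ^ 3) * P (q ^ 12))) * (2 * q\<^sup>2 * J2 q 2 24)"
    unfolding F H J_eq_P power_one_right by (rule gen[OF psi theta_difference[OF q] nz])
  thus ?D
    by (simp add: J_eq_P)
qed

section \<open>The four series\<close>

text \<open>\<open>u\<close> is the summand that both sums share, with the denominator extended to
  index \<open>n + 1\<close>. The moments \<open>S0\<close>, \<open>S1\<close>, \<open>S2\<close> of
  \<open>u\<close> against powers of \<open>q^(2n)\<close> are known only through two combinations,
  \<open>S0 + q^2 S2\<close> from the family \<open>B\<close> and
  \<open>S0 - 2 q S1 + q^2 S2\<close> from the family \<open>I\<close>; these suffice for both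
  claims.\<close>

lemma series12:
  assumes q: "norm q < 1" "q \<noteq> 0"
  defines "u \<equiv> \<lambda>n. qpoch q (q\<^sup>2) n * qpoch (- (q\<^sup>2)) (q ^ 4) n / (qpoch (q ^ 4) (q ^ 4) n * qpoch (- (q ^ 3)) (q ^ 6) (n + 1))
       * (- 1) ^ n * q ^ (n\<^sup>2 + 2 * n)"
  shows "(\<lambda>n. u n * (1 - q * (q\<^sup>2) ^ n + (q * (q\<^sup>2) ^ n)\<^sup>2)) sums
      (J q 12 * J2 q 1 12 * J2 q 3 12 * J2 q 10 24 / (J2 q 2 12 * (J q 6)\<^sup>2 * J q 8))" (is ?S1)
    and "(\<lambda>n. u n * (q\<^sup>2) ^ n) sums
      (J q 12 * J2 q 3 12 * J2 q 5 12 * J2 q 2 24 / (J2 q 2 12 * (J q 6)\<^sup>2 * J q 8))" (is ?S2)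
    and "\<And>n. 1 + q * (q\<^sup>2) ^ n \<noteq> 0"
proof -
  have pw: "norm (q ^ n) < 1" if "n > 0" for n
    using q(1) that by (rule norm_power_less_one)
  have nz: "P q \<noteq> 0" "P (q\<^sup>2) \<noteq> 0" "P (q ^ 3) \<noteq> 0" "P (q ^ 4) \<noteq> 0" "P (q ^ 6) \<noteq> 0" "P (q ^ 8) \<noteq> 0" "P (q ^ 12) \<noteq> 0" "P (q ^ 24) \<noteq> 0"
    by (rule P_nonzero; use q pw in simp)+
  define Y where "Y = (\<lambda>n. (q\<^sup>2) ^ n)"
  have Y1: "norm (Y n) \<le> 1" for n
    using pw[of 2] by (simp add: Y_def)
  have d: "1 - q ^ 4 * (Y n)\<^sup>2 \<noteq> 0" "1 + q ^ 3 * Y n \<noteq> 0" "1 - q ^ 3 * Y n + q ^ 6 * (Y n)\<^sup>2 \<noteq> 0" "1 + q * Y n \<noteq> 0" for n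
  proof -
    show "1 - q ^ 4 * (Y n)\<^sup>2 \<noteq> 0" "1 + q ^ 3 * Y n \<noteq> 0" "1 + q * Y n \<noteq> 0"
      using one_minus_mult_neq_0[OF pw[of 4], of "(Y n)\<^sup>2"] one_minus_mult_neq_0[OF pw[of 3], of "- Y n"]
        one_minus_mult_neq_0[OF q(1), of "- Y n"] Y1 norm_pow_le_one[OF Y1, of n 2] by auto
    show "1 - q ^ 3 * Y n + q ^ 6 * (Y n)\<^sup>2 \<noteq> 0"
      using cyclotomic3_neq_0[OF pw[of 3], of "- Y n"] Y1 by (simp add: power_mult_distrib flip: power_mult)
  qed
  show "\<And>n. 1 + q * (q\<^sup>2) ^ n \<noteq> 0"
    using d(4) by (simp add: Y_def)
  have d9: "1 + q ^ 9 * Y n ^ 3 = (1 + q ^ 3 * Y n) * (1 - q ^ 3 * Y n + q ^ 6 * (Y n)\<^sup>2)" for n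
    by algebra
  have u0: "u 0 = 1 / (1 + q ^ 3)"
    by (simp add: u_def qpoch_def)
  have q3: "1 + q ^ 3 \<noteq> 0"
    using d(2)[of 0] by (simp add: Y_def)
  have canc: "x = y" if "x * (1 + q ^ 3) = (1 + q ^ 3) * y" for x y
    using that q3 by (simp add: mult.commute)
  have uS: "u (Suc n) = u n * (- (1 - q * Y n) * (1 + q\<^sup>2 * (Y n)\<^sup>2) * q ^ 3 * Y n
      / ((1 - q ^ 4 * (Y n)\<^sup>2) * (1 + q ^ 9 * Y n ^ 3)))" for n
  proof -
    have pwf: "q ^ ((Suc n)\<^sup>2 + 2 * Suc n) = q ^ (n\<^sup>2 + 2 * n) * (q ^ 3 * Y n)"
    proof -
      have "(Suc n)\<^sup>2 + 2 * Suc n = (n\<^sup>2 + 2 * n) + (3 + 2 * n)"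
        by (simp add: power2_eq_square)
      thus ?thesis
        by (simp only: power_add power_mult Y_def)
    qed
    have "(q ^ 4) ^ n = (Y n)\<^sup>2" "(q ^ 6) ^ Suc n = q ^ 6 * Y n ^ 3"
      by (simp_all add: Y_def mult.commute flip: power_mult)
    hence fs: "1 - q ^ 4 * (q ^ 4) ^ n = 1 - q ^ 4 * (Y n)\<^sup>2" "1 - - (q ^ 3) * (q ^ 6) ^ Suc n = 1 + q ^ 9 * Y n ^ 3"
      "1 - q * (q\<^sup>2) ^ n = 1 - q * Y n" "1 - - (q\<^sup>2) * (q ^ 4) ^ n = 1 + q\<^sup>2 * (Y n)\<^sup>2"
      by (simp_all add: Y_def del: power_Suc)
    have gen: "(A * a) * (E * b) / ((C * c) * (D * d)) * (- 1) ^ Suc n * (e * f) = A * E / (C * D) * (- 1) ^ n * e * (- a * b * f / (c * d))"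
      for A E C D a b c d e f :: complex
      by (simp add: mult_ac)
    show ?thesis
      unfolding u_def Suc_eq_plus1[symmetric]
        qpoch_Suc[of q _ n] qpoch_Suc[of "- (q\<^sup>2)" _ n] qpoch_Suc[of "q ^ 4" _ n] qpoch_Suc[of "- (q ^ 3)" _ "Suc n"]
      unfolding fs pwf gen by (simp only: mult.assoc)
  qed
  have TI: "(\<Prod>k<n. rI q 1 ((q\<^sup>2) ^ k) * (q\<^sup>2) ^ k) = (1 + q ^ 3) * u n" for n
  proof (induction n)
    case (Suc n)
    have "rI q 1 (Y n) * Y n = - (1 - q * Y n) * (1 + q\<^sup>2 * (Y n)\<^sup>2) * q ^ 3 * Y n / ((1 - q ^ 4 * (Y n)\<^sup>2) * (1 + q ^ 9 * Y n ^ 3))"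
    proof -
      have "(1 - q * (q ^ 3 * (Y n)\<^sup>2)) * (1 - q * (- (q\<^sup>2 * 1 * Y n))) * (1 + q * (- (q\<^sup>2 * Y n)) + (q * (- (q\<^sup>2 * Y n)))\<^sup>2)
          = (1 - q ^ 4 * (Y n)\<^sup>2) * (1 + q ^ 9 * Y n ^ 3)"
        unfolding d9 by algebra
      thus ?thesis unfolding rI_def by simp
    qed
    thus ?case
      using Suc by (simp add: uS Y_def[symmetric] mult_ac)
  qed (use q3 u0 in simp)
  \<comment> \<open>The numerator \<open>1 + q^6 X^2\<close> of the ratio is
    \<open>1 + q^2 X^2\<close> one step ahead; the quotient telescopes to the weight
    \<open>1 + q^2 (Y n)^2\<close> over its initial value \<open>1 + q^2\<close>.\<close>
  have TB: "(\<Prod>k<n. rB q (- (q ^ 6)) ((q\<^sup>2) ^ k) * (q\<^sup>2) ^ k) * (1 + q\<^sup>2) = (1 + q ^ 3) * u n * (1 + q\<^sup>2 * (Y n)\<^sup>2)" for n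
  proof (induction n)
    case 0
    thus ?case using q3 u0 by (simp add: Y_def)
  next
    case (Suc n)
    have r: "rB q (- (q ^ 6)) (Y n) * Y n = - (1 - q * Y n) * (1 + q\<^sup>2 * (Y (Suc n))\<^sup>2) * q ^ 3 * Y n / ((1 - q ^ 4 * (Y n)\<^sup>2) * (1 + q ^ 9 * Y n ^ 3))"
    proof -
      have "(1 - q * (q ^ 3 * (Y n)\<^sup>2)) * (1 - q * (q\<^sup>2 * (- (q ^ 6)) * Y n ^ 3)) = (1 - q ^ 4 * (Y n)\<^sup>2) * (1 + q ^ 9 * Y n ^ 3)"
        by algebra
      moreover have "1 - - (q ^ 6) * (Y n)\<^sup>2 = 1 + q\<^sup>2 * (Y (Suc n))\<^sup>2"
      proof -
        have "Y (Suc n) = q\<^sup>2 * Y n" by (simp add: Y_def)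
        thus ?thesis by algebra
      qed
      ultimately show ?thesis unfolding rB_def by simp
    qed
    have "(\<Prod>k<Suc n. rB q (- (q ^ 6)) ((q\<^sup>2) ^ k) * (q\<^sup>2) ^ k) * (1 + q\<^sup>2)
        = (rB q (- (q ^ 6)) (Y n) * Y n) * ((\<Prod>k<n. rB q (- (q ^ 6)) ((q\<^sup>2) ^ k) * (q\<^sup>2) ^ k) * (1 + q\<^sup>2))"
      by (simp add: Y_def)
    also have "\<dots> = (1 + q ^ 3) * u (Suc n) * (1 + q\<^sup>2 * (Y (Suc n))\<^sup>2)"
      unfolding Suc r uS by simp
    finally show ?case .
  qed
  have sumu: "summable (\<lambda>n. u n * w (Y n))" if "isCont w 0" for w
  proof -
    have "summable (\<lambda>n. (\<Prod>k<n. rI q 1 ((q\<^sup>2) ^ k) * (q\<^sup>2) ^ k) * w ((q\<^sup>2) ^ n))"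
      by (intro summable_norm_cancel[OF qseries_summable] pw that)
        (auto simp: rI_def[abs_def] intro!: continuous_intros)
    from summable_mult[OF this, of "1 / (1 + q ^ 3)"] show ?thesis
      unfolding TI Y_def using q3 by simp
  qed
  define S0 S1 S2 where "S0 = (\<Sum>n. u n * 1)" and "S1 = (\<Sum>n. u n * Y n)" and "S2 = (\<Sum>n. u n * (Y n)\<^sup>2)"
  have s: "(\<lambda>n. u n * 1) sums S0" "(\<lambda>n. u n * Y n) sums S1" "(\<lambda>n. u n * (Y n)\<^sup>2) sums S2"
    unfolding S0_def S1_def S2_def by (rule summable_sums; rule sumu; intro continuous_intros)+
  have IB: "I q 1 = (1 + q ^ 3) * (S0 - 2 * q * S1 + q\<^sup>2 * S2)"
  proof -
    have "(\<lambda>n. (1 + q ^ 3) * (u n * 1 - 2 * q * (u n * Y n) + q\<^sup>2 * (u n * (Y n)\<^sup>2))) sums ((1 + q ^ 3) * (S0 - 2 * q * S1 + q\<^sup>2 * S2))"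
      by (intro sums_mult sums_add sums_diff s)
    moreover have "(1 + q ^ 3) * (u n * 1 - 2 * q * (u n * Y n) + q\<^sup>2 * (u n * (Y n)\<^sup>2))
        = (\<Prod>k<n. rI q 1 ((q\<^sup>2) ^ k) * (q\<^sup>2) ^ k) * (1 - q * (q\<^sup>2) ^ n)\<^sup>2" for n
      unfolding TI unfolding Y_def[symmetric] by (simp add: power2_eq_square algebra_simps)
    ultimately show ?thesis
      unfolding I_def by (simp add: sums_iff)
  qed
  have q2: "1 + q\<^sup>2 \<noteq> 0"
    using one_minus_mult_neq_0[OF pw[of 2], of "- 1"] by simp
  have BB: "(1 + q\<^sup>2) * B q (- (q ^ 6)) = (1 + q ^ 3) * (S0 + q\<^sup>2 * S2)"
  proof -
    have "(\<lambda>n. 1 / (1 + q\<^sup>2) * ((1 + q ^ 3) * (u n * 1 + q\<^sup>2 * (u n * (Y n)\<^sup>2)))) sums (1 / (1 + q\<^sup>2) * ((1 + q ^ 3) * (S0 + q\<^sup>2 * S2)))"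
      by (intro sums_mult sums_add s)
    moreover have "1 / (1 + q\<^sup>2) * ((1 + q ^ 3) * (u n * 1 + q\<^sup>2 * (u n * (Y n)\<^sup>2)))
        = (\<Prod>k<n. rB q (- (q ^ 6)) ((q\<^sup>2) ^ k) * (q\<^sup>2) ^ k)" for n
    proof -
      have "(1 + q ^ 3) * (u n * 1 + q\<^sup>2 * (u n * (Y n)\<^sup>2)) = (\<Prod>k<n. rB q (- (q ^ 6)) ((q\<^sup>2) ^ k) * (q\<^sup>2) ^ k) * (1 + q\<^sup>2)"
        unfolding TB by (simp add: algebra_simps)
      thus ?thesis using q2 by simp
    qed
    ultimately show ?thesis
      unfolding B_def using q2 by (simp add: sums_iff)
  qed
  have e: "(q\<^sup>2)\<^sup>2 = q ^ 4" "(q ^ 3)\<^sup>2 = q ^ 6" "(q ^ 6)\<^sup>2 = q ^ 12" "(q ^ 4)\<^sup>2 = q ^ 8" "(q ^ 12)\<^sup>2 = q ^ 24" "(q\<^sup>2) ^ 4 = q ^ 8"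
     "(q ^ 3) ^ 4 = q ^ 12" "(q ^ 6) ^ 4 = q ^ 24" "(q ^ 4) ^ 3 = q ^ 12"
    by (simp_all flip: power_mult)
  have ad: "q * q\<^sup>2 = q ^ 3" "q * q ^ 4 = q ^ 5" "q ^ 3 * q ^ 4 = q ^ 7" "q\<^sup>2 * q ^ 4 = q ^ 6" "q ^ 6 * q ^ 12 = q ^ 18"
    "q\<^sup>2 * q ^ 12 = q ^ 14" "q ^ 3 * q ^ 12 = q ^ 15" "q ^ 9 * q ^ 12 = q ^ 21" "q ^ 4 * q ^ 12 = q ^ 16" "q ^ 8 * q ^ 12 = q ^ 20"
    "q ^ 3 * q ^ 6 = q ^ 9" "q ^ 4 * q ^ 4 = q ^ 8" "q\<^sup>2 * q ^ 8 = q ^ 10" "q ^ 4 * q ^ 6 = q ^ 10" "q ^ 8 * q ^ 6 = q ^ 14" "q ^ 9 * q ^ 6 = q ^ 15"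
    by (simp_all flip: power_add power_Suc)
  have "J q 24 * (J q 1)\<^sup>2 * J q 4 / ((J q 2)\<^sup>2 * J q 6 * J q 8) = S0 - 2 * q * S1 + q\<^sup>2 * S2"
  proof -
    define a5 a7 a6 a18 b5 where "a5 = qpoch_inf (q ^ 5) (q ^ 4)" and "a7 = qpoch_inf (q ^ 7) (q ^ 4)"
      and "a6 = qpoch_inf (q ^ 6) (q ^ 4)" and "a18 = qpoch_inf (q ^ 18) (q ^ 12)"
      and "b5 = qpoch_inf (- (q ^ 3)) (q ^ 4) * qpoch_inf (- (q ^ 5)) (q ^ 4)"
    have i1: "I q 1 = (P (q ^ 24) / P (q ^ 12)) / ((P (q ^ 8) / P (q ^ 4)) * b5) * I q 0"
      using I_value[OF q(1), of 1] qpoch_minus_base[OF pw[of 12]] qpoch_minus_base[OF pw[of 4]]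
      unfolding e b5_def by (simp add: mult.assoc)
    have "q ^ 12 * (q\<^sup>2) ^ 3 = q ^ 18" "q ^ 4 * q\<^sup>2 = q ^ 6" "q ^ 3 * q\<^sup>2 = q ^ 5" "q ^ 5 * q\<^sup>2 = q ^ 7"
      by (simp_all flip: power_add power_mult)
    hence i2: "(1 - q)\<^sup>2 = a18 / (a6 * a5 * a7) * I q 0"
      using I_value[OF q(1), of "- (q\<^sup>2)"] pw[of 2] unfolding I_terminating a18_def a5_def a6_def a7_def
      by simp
    \<comment> \<open>The products in \<open>I_value\<close> lack their first factors; restoring
      them, here and in the next facts, yields quotients of \<open>P\<close>.\<close>
    have f18: "P (q ^ 6) / P (q ^ 12) = (1 - q ^ 6) * a18"
      using qpoch_inf_unfold[OF pw[of 12], of "q ^ 6"] qpoch_odd[OF pw[of 6]] unfolding e ad a18_def by simp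
    have f6: "P (q\<^sup>2) / P (q ^ 4) = (1 - q\<^sup>2) * a6"
      using qpoch_inf_unfold[OF pw[of 4], of "q\<^sup>2"] qpoch_odd[OF pw[of 2]] unfolding e ad a6_def by simp
    have f57: "P q / P (q\<^sup>2) = (1 - q) * (1 - q ^ 3) * (a5 * a7)"
      using qpoch_inf_split2[OF pw[of 2], of q] qpoch_odd[OF q(1)] qpoch_inf_unfold[OF pw[of 4], of q]
        qpoch_inf_unfold[OF pw[of 4], of "q ^ 3"]
      unfolding e ad a5_def a7_def by simp
    have fb: "(P (q\<^sup>2))\<^sup>2 / (P q * P (q ^ 4)) = (1 + q) * b5"
      using qpoch_inf_split2[OF pw[of 2], of "- q"] qpoch_minus_odd[OF q(1)] qpoch_inf_unfold[OF pw[of 4], of "- q"] ad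
      unfolding e b5_def by simp
    have n: "1 - q \<noteq> 0" "1 + q \<noteq> 0" "1 - q ^ 3 \<noteq> 0" "1 - q\<^sup>2 \<noteq> 0" "1 - q ^ 6 \<noteq> 0"
      using one_minus_power_neq_0[OF q(1), of 1] one_minus_power_neq_0[OF q(1), of 3] one_minus_power_neq_0[OF q(1), of 2]
        one_minus_power_neq_0[OF q(1), of 6] one_minus_mult_neq_0[OF q(1), of "- 1"] by simp_all
    \<comment> \<open>Eliminates \<open>i0 = I q 0\<close> between the members
      \<open>x = - q^2\<close> and \<open>x = 1\<close>. The restored polynomial factors in
      \<open>q\<close> combine to \<open>1 + q^3\<close>, the constant between the product of
      \<open>rI\<close> and \<open>u\<close>.\<close>
    have gen: "p24 * p1\<^sup>2 * p4 / (p2\<^sup>2 * p6 * p8) * (1 + q ^ 3) = p24 / p12 / (p8 / p4 * b) * i0"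
      if "(1 - q)\<^sup>2 = s / (x * y) * i0" "p6 / p12 = (1 - q ^ 6) * s" "p2 / p4 = (1 - q\<^sup>2) * x"
        "p1 / p2 = (1 - q) * (1 - q ^ 3) * y" "p2\<^sup>2 / (p1 * p4) = (1 + q) * b"
        "p1 \<noteq> 0" "p2 \<noteq> 0" "p4 \<noteq> 0" "p6 \<noteq> 0" "p8 \<noteq> 0" "p12 \<noteq> 0" "p24 \<noteq> 0"
      for p1 p2 p4 p6 p8 p12 p24 s x y b i0 :: complex
    proof -
      have s: "s = p6 / p12 / (1 - q ^ 6)" and x: "x = p2 / p4 / (1 - q\<^sup>2)"
        and y: "y = p1 / p2 / ((1 - q) * (1 - q ^ 3))" and b: "b = p2\<^sup>2 / (p1 * p4) / (1 + q)"
        using that(2-5) n by simp_all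
      have snz: "s \<noteq> 0" "x * y \<noteq> 0"
        using that(6-) n by (simp_all add: s x y)
      have "i0 = (1 - q)\<^sup>2 * (x * y) / s"
        using that(1) snz by (simp add: field_simps)
      also have "\<dots> = (1 - q)\<^sup>2 * (1 - q ^ 6) / ((1 - q\<^sup>2) * ((1 - q) * (1 - q ^ 3))) * (p1 * p12 / (p4 * p6))"
        unfolding s x y using that(6-) n by (simp add: mult_ac)
      also have "(1 - q)\<^sup>2 * (1 - q ^ 6) / ((1 - q\<^sup>2) * ((1 - q) * (1 - q ^ 3))) = (1 + q ^ 3) / (1 + q)"
      proof -
        have "(1 - q)\<^sup>2 * (1 - q ^ 6) * (1 + q) = (1 + q ^ 3) * ((1 - q\<^sup>2) * ((1 - q) * (1 - q ^ 3)))"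
          by algebra
        thus ?thesis using n by (simp add: frac_eq_eq)
      qed
      finally have i0: "i0 = (1 + q ^ 3) / (1 + q) * (p1 * p12 / (p4 * p6))" .
      show ?thesis
        unfolding i0 b using that(6-) n(2) by (simp add: power2_eq_square mult_ac)
    qed
    have "J q 24 * (J q 1)\<^sup>2 * J q 4 / ((J q 2)\<^sup>2 * J q 6 * J q 8) * (1 + q ^ 3) = I q 1"
      unfolding i1 J_eq_P power_one_right
      by (rule gen[OF _ f18 f6 f57 fb nz(1,2,4,5,6,7,8)]) (use i2 in \<open>simp add: mult.assoc\<close>)
    thus ?thesis
      unfolding IB by (rule canc)
  qed
  moreover have "(J q 3)\<^sup>2 * J q 4 * J q 24 / (J q 2 * J q 8 * (J q 6)\<^sup>2) = S0 + q\<^sup>2 * S2"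
  proof -
    define c16 c15 d10 d9 where "c16 = qpoch_inf (q ^ 16) (q ^ 12) * qpoch_inf (q ^ 20) (q ^ 12)"
      and "c15 = qpoch_inf (q ^ 15) (q ^ 12) * qpoch_inf (q ^ 21) (q ^ 12)"
      and "d10 = qpoch_inf (- (q ^ 10)) (q ^ 12) * qpoch_inf (- (q ^ 14)) (q ^ 12)"
      and "d9 = qpoch_inf (- (q ^ 9)) (q ^ 12) * qpoch_inf (- (q ^ 15)) (q ^ 12)"
    have b1: "B q (q ^ 12) = c16 / c15 * B q 0"
      using B_value[OF q(1) pw[of 12]] unfolding ad c16_def c15_def by simp
    have b2: "B q (- (q ^ 6)) = d10 / d9 * B q 0"
      using B_value[OF q(1), of "- (q ^ 6)"] pw[of 6] ad unfolding d10_def d9_def by simp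
    have g16: "(1 - q ^ 4) * (1 - q ^ 8) * c16 = P (q ^ 4) / P (q ^ 12)"
      using qpoch_inf_unfold[OF pw[of 12], of "q ^ 4"] qpoch_inf_unfold[OF pw[of 12], of "q ^ 8"] qpoch_thirds[OF pw[of 4]]
      unfolding e ad c16_def by (simp add: mult_ac)
    have g15: "(1 - q ^ 3) * (1 - q ^ 9) * c15 = P (q ^ 3) / P (q ^ 6)"
      using qpoch_inf_unfold[OF pw[of 12], of "q ^ 3"] qpoch_inf_unfold[OF pw[of 12], of "q ^ 9"] qpoch_3_mod_12[OF q(1)]
      unfolding e ad c15_def by (simp add: mult_ac)
    have g10: "(1 + q\<^sup>2) * d10 * ((P (q ^ 12))\<^sup>2 / (P (q ^ 6) * P (q ^ 24))) = (P (q ^ 4))\<^sup>2 / (P (q\<^sup>2) * P (q ^ 8))"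
      using qpoch_inf_split3[OF pw[of 4], of "- (q\<^sup>2)"] qpoch_minus_odd[OF pw[of 2]] qpoch_minus_odd[OF pw[of 6]]
        qpoch_inf_unfold[OF pw[of 12], of "- (q\<^sup>2)"] ad
      unfolding e d10_def by (simp add: mult_ac)
    have g9: "(1 + q ^ 3) * d9 = (P (q ^ 6))\<^sup>2 / (P (q ^ 3) * P (q ^ 12))"
      using qpoch_inf_split2[OF pw[of 6], of "- (q ^ 3)"] qpoch_minus_odd[OF pw[of 3]]
        qpoch_inf_unfold[OF pw[of 12], of "- (q ^ 3)"] ad
      unfolding e d9_def by (simp add: mult_ac)
    have n: "1 - q ^ 4 \<noteq> 0" "1 - q ^ 8 \<noteq> 0" "1 - q ^ 3 \<noteq> 0" "1 - q ^ 9 \<noteq> 0"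
      using one_minus_power_neq_0[OF q(1)] by simp_all
    \<comment> \<open>Eliminates \<open>b0 = B q 0\<close> between the members
      \<open>b = q^12\<close> and \<open>b = - q^6\<close>; the factors \<open>A\<close> and
      \<open>G\<close> are the polynomial sides of \<open>B_q12\<close>.\<close>
    have gen: "p3\<^sup>2 * p4 * p24 / (p2 * p8 * p6\<^sup>2) * (1 + q ^ 3) = (1 + q\<^sup>2) * (d / f * b0)"
      if "A * (c / g * b0) = G" "A * c = p4 / p12" "G * g = p3 / p6" "(1 + q\<^sup>2) * d * (p12\<^sup>2 / (p6 * p24)) = p4\<^sup>2 / (p2 * p8)"
        "(1 + q ^ 3) * f = p6\<^sup>2 / (p3 * p12)" "G \<noteq> 0"
        and nz: "p2 \<noteq> 0" "p3 \<noteq> 0" "p4 \<noteq> 0" "p6 \<noteq> 0" "p8 \<noteq> 0" "p12 \<noteq> 0" "p24 \<noteq> 0"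
      for p2 p3 p4 p6 p8 p12 p24 c g d f b0 A G :: complex
    proof -
      have "g \<noteq> 0"
        using that(3) nz by auto
      hence "(A * c) * b0 = G * g"
        using that(1) by (simp add: field_simps)
      hence b0: "b0 = p3 / p6 * (p12 / p4)"
        unfolding that(2,3) using nz by (simp add: field_simps)
      have d: "(1 + q\<^sup>2) * d = p4\<^sup>2 / (p2 * p8) * (p6 * p24 / p12\<^sup>2)"
        using that(4) nz by (simp add: field_simps)
      have "f = ((1 + q ^ 3) * f) / (1 + q ^ 3)"
        using q3 by simp
      hence f: "f = p6\<^sup>2 / (p3 * p12) / (1 + q ^ 3)"
        by (simp only: that(5))
      have "(1 + q\<^sup>2) * (d / f * b0) = ((1 + q\<^sup>2) * d) / f * b0"
        by simp
      also have "\<dots> = p3\<^sup>2 * p4 * p24 / (p2 * p8 * p6\<^sup>2) * (1 + q ^ 3)"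
        unfolding d f b0 using nz q3 by (simp add: power2_eq_square mult_ac)
      finally show ?thesis by simp
    qed
    have "(J q 3)\<^sup>2 * J q 4 * J q 24 / (J q 2 * J q 8 * (J q 6)\<^sup>2) * (1 + q ^ 3) = (1 + q\<^sup>2) * B q (- (q ^ 6))"
      unfolding b2 J_eq_P
      by (rule gen[OF B_q12[OF q(1), unfolded b1] g16 g15 g10 g9 _ nz(2-8)]) (use n in simp)
    thus ?thesis
      unfolding BB by (rule canc)
  qed
  \<comment> \<open>The part common to both right-hand sides, so that only the two theta products
    \<open>a\<close> and \<open>b\<close> remain to be separated.\<close>
  moreover define \<kappa> where "\<kappa> = J q 3 * J q 4 / (J q 2 * (J q 6)\<^sup>2 * J q 8)"
  have \<kappa>: "J q 12 * J2 q 3 12 / (J2 q 2 12 * (J q 6)\<^sup>2 * J q 8) = \<kappa>"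
  proof -
    have j3: "J2 q 3 12 = P (q ^ 3) / P (q ^ 6) * P (q ^ 12)"
      using qpoch_3_mod_12[OF q(1)] by (simp add: J2_def P_def)
    have j2: "J2 q 2 12 = P (q\<^sup>2) * P (q ^ 12) / (P (q ^ 4) * P (q ^ 6)) * P (q ^ 12)"
      using qpoch_2_mod_12[OF q(1)] by (simp add: J2_def P_def)
    show ?thesis
      unfolding j3 j2 \<kappa>_def J_eq_P using nz by (simp add: power2_eq_square mult_ac)
  qed
  define a b where "a = J2 q 1 12 * J2 q 10 24" and "b = J2 q 5 12 * J2 q 2 24"
  note T = theta_pair[OF q, folded a_def b_def]
  have "\<kappa> * (a + q * b) = (J q 3)\<^sup>2 * J q 4 * J q 24 / (J q 2 * J q 8 * (J q 6)\<^sup>2)"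
    unfolding T(1) \<kappa>_def by (simp add: power2_eq_square mult_ac)
  moreover have "\<kappa> * (a - q * b) = J q 24 * (J q 1)\<^sup>2 * J q 4 / ((J q 2)\<^sup>2 * J q 6 * J q 8)"
    unfolding T(2) \<kappa>_def J_eq_P using nz by (simp add: power2_eq_square mult_ac)
  ultimately have k: "\<kappa> * (a + q * b) = S0 + q\<^sup>2 * S2" "\<kappa> * (a - q * b) = S0 - 2 * q * S1 + q\<^sup>2 * S2"
    by simp_all
  have "2 * q * (\<kappa> * b) = \<kappa> * (a + q * b) - \<kappa> * (a - q * b)"
    by (simp add: algebra_simps)
  also have "\<dots> = 2 * q * S1"
    unfolding k by simp
  finally have "2 * q * (\<kappa> * b) = 2 * q * S1" .
  hence kb: "\<kappa> * b = S1"
    using q by simp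
  have ka: "\<kappa> * a = S0 - q * S1 + q\<^sup>2 * S2"
  proof -
    have "\<kappa> * a = \<kappa> * (a + q * b) - q * (\<kappa> * b)"
      by (simp add: algebra_simps)
    thus ?thesis
      unfolding k(1) kb by simp
  qed
  have "(\<lambda>n. u n * 1 - q * (u n * Y n) + q\<^sup>2 * (u n * (Y n)\<^sup>2)) sums (\<kappa> * a)"
    unfolding ka by (intro sums_add sums_diff sums_mult s)
  thus ?S1
    unfolding \<kappa>[symmetric] a_def Y_def by (simp add: algebra_simps power_mult_distrib)
  show ?S2
    using s(2) unfolding kb[symmetric] \<kappa>[symmetric] b_def Y_def by (simp add: mult_ac)
qed

text \<open>With \<open>y = q^(n+1)\<close>, the families \<open>F'\<close> and \<open>H\<close> at
  parameter 1, without their initial terms, are the sums of \<open>2 q b n\<close> with weights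
  \<open>1 + y^2\<close> and \<open>(1 + y)^2\<close>. Their difference has weight
  \<open>2 y\<close> and their sum \<open>2 (1 + y + y^2)\<close>.\<close>

lemma series34:
  assumes q: "norm q < 1" "q \<noteq> 0"
  defines "b \<equiv> \<lambda>n. qpoch (- q) q n * qpoch (- (q\<^sup>2)) (q\<^sup>2) n / (qpoch q (q\<^sup>2) (n + 1) * qpoch (q ^ 3) (q ^ 3) (n + 1))
       * q ^ ((n\<^sup>2 + 3 * n) div 2)"
  shows "(\<lambda>n. b n * q ^ n) sums (J q 6 * J q 8 * J2 q 2 24 / (J q 1 * J q 3 * J q 12))" (is ?S3)
    and "(\<lambda>n. q * b n * (1 + q * q ^ n + (q * q ^ n)\<^sup>2)) sums (1 / 4 * ((J q 2) ^ 3 * (J q 6) ^ 3 / ((J q 1)\<^sup>2 * (J q 3)\<^sup>2 * J q 4 * J q 12)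
         + 2 * (J q 4) ^ 3 * J q 6 / (J q 1 * J q 2 * J q 3 * J q 12) - 3))" (is ?S4)
proof -
  have bS: "b (Suc n) = b n * ((1 + q * q ^ n) * (1 + q\<^sup>2 * (q ^ n)\<^sup>2) * q\<^sup>2 * q ^ n / ((1 - q ^ 3 * (q ^ n)\<^sup>2) * (1 - q ^ 6 * (q ^ n) ^ 3)))" for n
  proof -
    have "((Suc n)\<^sup>2 + 3 * Suc n) = (n\<^sup>2 + 3 * n) + (n + 2) * 2"
      by (simp add: power2_eq_square)
    hence "((Suc n)\<^sup>2 + 3 * Suc n) div 2 = (n\<^sup>2 + 3 * n) div 2 + (n + 2)"
      by (simp only: div_mult_self1)
    hence pwf: "q ^ (((Suc n)\<^sup>2 + 3 * Suc n) div 2) = q ^ ((n\<^sup>2 + 3 * n) div 2) * (q\<^sup>2 * q ^ n)"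
      by (simp only: power_add mult_ac)
    have e: "(q\<^sup>2) ^ n = (q ^ n)\<^sup>2" "(q ^ 3) ^ n = (q ^ n) ^ 3"
      by (simp_all add: mult.commute flip: power_mult)
    have fs: "1 - - q * q ^ n = 1 + q * q ^ n" "1 - - (q\<^sup>2) * (q\<^sup>2) ^ n = 1 + q\<^sup>2 * (q ^ n)\<^sup>2"
      "1 - q * (q\<^sup>2) ^ Suc n = 1 - q ^ 3 * (q ^ n)\<^sup>2" "1 - q ^ 3 * (q ^ 3) ^ Suc n = 1 - q ^ 6 * (q ^ n) ^ 3"
      unfolding power_Suc e by (simp_all add: power_numeral_reduce mult_ac)
    have gen: "(A * a) * (E * b) / ((C * c) * (D * d)) * (e * f) = A * E / (C * D) * e * (a * b * f / (c * d))"
      for A E C D a b c d e f :: complex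
      by (simp add: mult_ac)
    show ?thesis
      unfolding b_def Suc_eq_plus1[symmetric]
        qpoch_Suc[of "- q" _ n] qpoch_Suc[of "- (q\<^sup>2)" _ n] qpoch_Suc[of q _ "Suc n"] qpoch_Suc[of "q ^ 3" _ "Suc n"]
      unfolding fs pwf gen by (simp only: mult.assoc)
  qed
  have b0: "b 0 = 1 / ((1 - q) * (1 - q ^ 3))"
    by (simp add: b_def qpoch_def)
  \<comment> \<open>The index is shifted because \<open>(-1;q)_(n+1) = 2 (-q;q)_n\<close>: the
    factor at \<open>k = 0\<close> gives the 2.\<close>
  have FS: "(\<Prod>k<Suc n. rF' q 1 (q ^ k) * q ^ k) = 2 * q * (1 + q\<^sup>2 * (q ^ n)\<^sup>2) * b n" for n
  proof (induction n)
    case 0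
    have "q * q\<^sup>2 = q ^ 3" by (simp add: power2_eq_square power3_eq_cube)
    thus ?case by (simp add: rF'_def b0)
  next
    case (Suc n)
    define X where "X = q ^ n"
    have r: "rF' q 1 (q ^ Suc n) * q ^ Suc n = (1 + q * X) * (1 + q\<^sup>2 * (q * X)\<^sup>2) * q\<^sup>2 * X / ((1 - q ^ 3 * X\<^sup>2) * (1 - q ^ 6 * X ^ 3))"
    proof -
      have "1 - q * (1\<^sup>2 * (q * X)\<^sup>2) = 1 - q ^ 3 * X\<^sup>2" "1 - q * (q\<^sup>2 * (q * X) ^ 3) = 1 - q ^ 6 * X ^ 3"
        by (simp_all add: power_mult_distrib power_numeral_reduce)
      thus ?thesis by (simp add: rF'_def X_def power2_eq_square mult_ac)
    qed
    show ?case
      unfolding prod.lessThan_Suc[of _ "Suc n"] Suc bS r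
      unfolding power_Suc X_def[symmetric]
      by (simp only: times_divide_eq_left times_divide_eq_right mult_ac)
  qed
  \<comment> \<open>Here the 2 comes from \<open>(-1;q^2)_(n+1) = 2 (-q^2;q^2)_n\<close>.\<close>
  have HS: "(\<Prod>k<Suc n. rH q 1 (q ^ k) * q ^ k) = 2 * q * (1 + q * q ^ n) * b n" for n
  proof (induction n)
    case 0
    have "(1 - q) * (1 + q + q\<^sup>2) = 1 - q ^ 3"
      by algebra
    thus ?case by (simp add: rH_def b0 mult.assoc)
  next
    case (Suc n)
    define X where "X = q ^ n"
    have r: "rH q 1 (q ^ Suc n) * q ^ Suc n = (1 + q * (q * X)) * (1 + q\<^sup>2 * X\<^sup>2) * q\<^sup>2 * X / ((1 - q ^ 3 * X\<^sup>2) * (1 - q ^ 6 * X ^ 3))"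
    proof -
      have "(1 - q * (1\<^sup>2 * (q * X)\<^sup>2)) * (1 - q * (q * X)) * (1 + q * (1 * (q * X)) + (q * (1 * (q * X)))\<^sup>2) = (1 - q ^ 3 * X\<^sup>2) * (1 - q ^ 6 * X ^ 3)"
      proof -
        have "1 - q ^ 6 * X ^ 3 = (1 - q * (q * X)) * (1 + q * (1 * (q * X)) + (q * (1 * (q * X)))\<^sup>2)"
          by algebra
        moreover have "1 - q * (1\<^sup>2 * (q * X)\<^sup>2) = 1 - q ^ 3 * X\<^sup>2"
          by (simp add: power_mult_distrib power_numeral_reduce)
        ultimately show ?thesis by (simp only: mult.assoc)
      qed
      thus ?thesis unfolding rH_def power_Suc X_def[symmetric] by (simp add: power2_eq_square mult_ac)
    qed
    show ?case
      unfolding prod.lessThan_Suc[of _ "Suc n"] Suc bS r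
      unfolding power_Suc X_def[symmetric]
      by (simp only: times_divide_eq_left times_divide_eq_right mult_ac)
  qed
  have sF: "(\<lambda>n. \<Prod>k<n. rF' q 1 (q ^ k) * q ^ k) sums F' q 1"
    using summable_norm_cancel[OF qseries_summable[OF q(1), of "rF' q 1" "\<lambda>_. 1"]]
    unfolding F'_def by (intro summable_sums) (simp add: rF'_def[abs_def] continuous_intros)
  have sH: "(\<lambda>n. (\<Prod>k<n. rH q 1 (q ^ k) * q ^ k) * (1 + q ^ n)) sums H q 1"
    using summable_norm_cancel[OF qseries_summable[OF q(1), of "rH q 1" "\<lambda>X. 1 + X"]]
    unfolding H_def by (simp add: rH_def[abs_def] continuous_intros summable_sums)
  have tF: "(\<lambda>n. 2 * q * (1 + q\<^sup>2 * (q ^ n)\<^sup>2) * b n) sums (F' q 1 - 1)"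
  proof -
    have "(\<lambda>n. \<Prod>k<Suc n. rF' q 1 (q ^ k) * q ^ k) sums (F' q 1 - 1)"
      by (rule sums_Suc_iff[of "\<lambda>n. \<Prod>k<n. rF' q 1 (q ^ k) * q ^ k", THEN iffD2]) (use sF in simp)
    thus ?thesis unfolding FS .
  qed
  \<comment> \<open>The removed term \<open>n = 0\<close> is 2 rather than 1, because of the weight
    \<open>1 + q ^ n\<close>. This accounts for the constant 3 in the fourth identity.\<close>
  have tH: "(\<lambda>n. 2 * q * (1 + q * q ^ n) * b n * (1 + q * q ^ n)) sums (H q 1 - 2)"
  proof -
    have "(\<lambda>n. (\<Prod>k<Suc n. rH q 1 (q ^ k) * q ^ k) * (1 + q ^ Suc n)) sums (H q 1 - 2)"
      by (rule sums_Suc_iff[of "\<lambda>n. (\<Prod>k<n. rH q 1 (q ^ k) * q ^ k) * (1 + q ^ n)", THEN iffD2]) (use sH in simp)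
    thus ?thesis unfolding HS power_Suc .
  qed
  have "(\<lambda>n. 1 / (4 * q\<^sup>2) * (2 * q * (1 + q * q ^ n) * b n * (1 + q * q ^ n) - 2 * q * (1 + q\<^sup>2 * (q ^ n)\<^sup>2) * b n))
      sums (1 / (4 * q\<^sup>2) * ((H q 1 - 2) - (F' q 1 - 1)))"
    by (intro sums_mult sums_diff tF tH)
  moreover have "1 / (4 * q\<^sup>2) * (2 * q * (1 + q * q ^ n) * b n * (1 + q * q ^ n) - 2 * q * (1 + q\<^sup>2 * (q ^ n)\<^sup>2) * b n) = b n * q ^ n" for n
  proof -
    have "2 * q * (1 + q * q ^ n) * b n * (1 + q * q ^ n) - 2 * q * (1 + q\<^sup>2 * (q ^ n)\<^sup>2) * b n = 4 * q\<^sup>2 * (b n * q ^ n)"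
      by algebra
    thus ?thesis using q by simp
  qed
  moreover have "1 / (4 * q\<^sup>2) * ((H q 1 - 2) - (F' q 1 - 1)) = J q 6 * J q 8 * J2 q 2 24 / (J q 1 * J q 3 * J q 12)"
  proof -
    have "(H q 1 - 2) - (F' q 1 - 1) = H q 1 - F' q 1 - 1" by simp
    thus ?thesis using q by (simp add: F'_H_values(3)[OF q])
  qed
  ultimately show ?S3 by simp
  have "(\<lambda>n. 1 / 4 * (2 * q * (1 + q * q ^ n) * b n * (1 + q * q ^ n) + 2 * q * (1 + q\<^sup>2 * (q ^ n)\<^sup>2) * b n))
      sums (1 / 4 * ((H q 1 - 2) + (F' q 1 - 1)))"
    by (intro sums_mult sums_add tF tH)
  moreover have "1 / 4 * (2 * q * (1 + q * q ^ n) * b n * (1 + q * q ^ n) + 2 * q * (1 + q\<^sup>2 * (q ^ n)\<^sup>2) * b n)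
      = q * b n * (1 + q * q ^ n + (q * q ^ n)\<^sup>2)" for n
    by (simp add: field_simps power2_eq_square)
  ultimately show ?S4
    by (simp add: F'_H_values(1,2)[OF q] algebra_simps)
qed

theorem theorem4p1:
  fixes q :: complex
  assumes "norm q < 1"
  shows
    "((\<lambda>n. qpoch q (q^2) n * qpoch (- (q^2)) (q^4) n
           / (qpoch (q^4) (q^4) n * qpoch (- (q^3)) (q^6) n * (1 + q ^ (2*n + 1)))
           * (-1) ^ n * q ^ (n^2 + 2*n))
        sums (J q 12 * J2 q 1 12 * J2 q 3 12 * J2 q 10 24
              / (J2 q 2 12 * (J q 6)^2 * J q 8))) \<and>
     ((\<lambda>n. qpoch q (q^2) n * qpoch (- (q^2)) (q^4) n
           / (qpoch (q^4) (q^4) n * qpoch (- (q^3)) (q^6) (n + 1))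
           * (-1) ^ n * q ^ (n^2 + 4*n))
        sums (J q 12 * J2 q 3 12 * J2 q 5 12 * J2 q 2 24
              / (J2 q 2 12 * (J q 6)^2 * J q 8))) \<and>
     ((\<lambda>n. qpoch (- q) q n * qpoch (- (q^2)) (q^2) n
           / (qpoch q (q^2) (n + 1) * qpoch (q^3) (q^3) (n + 1))
           * q ^ ((n^2 + 5*n) div 2))
        sums (J q 8 * (J q 12)^5 * J2 q 2 24
              / (J q 4 * J q 6 * J2 q 1 12 * J2 q 2 12 * (J2 q 3 12)^2 * J2 q 5 12))) \<and>
     ((\<lambda>m. let n = m + 1 in
           qpoch (- q) q (n - 1) * qpoch (- (q^2)) (q^2) (n - 1)
           / (qpoch (q^3) (q^3) (n - 1) * qpoch q (q^2) n * (1 - q ^ n))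
           * q ^ (n * (n + 1) div 2))
        sums (1 / 4 * ((J q 2)^3 * (J q 6)^3 / ((J q 1)^2 * (J q 3)^2 * J q 4 * J q 12)
                       + 2 * (J q 4)^3 * J q 6 / (J q 1 * J q 2 * J q 3 * J q 12)
                       - 3)))"
proof (cases "q = 0")
  \<comment> \<open>The theta series need negative powers of \<open>q\<close>, so
    \<open>q = 0\<close> is checked directly: all products are 1, the first three series reduce to
    their term \<open>n = 0\<close>, and the fourth is zero, as
    \<open>1 + 2 - 3 = 0\<close>.\<close>
  case True
  have single: "f sums c" if "\<And>n. n \<noteq> 0 \<Longrightarrow> f n = 0" "f 0 = c" for f :: "nat \<Rightarrow> complex" and c
    using sums_finite[of "{0}" f] that by auto
  have z: "qpoch 0 p n = 1" "qpoch_inf 0 p = 1" for p n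
    by (simp_all add: qpoch_def qpoch_inf_def)
  have e3: "(n\<^sup>2 + 5 * n) div 2 \<noteq> 0" if "n \<noteq> 0" for n :: nat
    using that by (simp add: div_eq_0_iff)
  have e4: "(m + 1) * (m + 1 + 1) div 2 \<noteq> 0" for m :: nat
    by (simp add: div_eq_0_iff)
  show ?thesis
    unfolding True Let_def
    by (intro conjI single) (use e3 e4 in \<open>simp_all add: z J_def J2_def power_0_left\<close>)
next
  case False
  note q = assms False
  have y: "q ^ (2 * n + 1) = q * (q\<^sup>2) ^ n" "(q ^ 6) ^ n = ((q\<^sup>2) ^ n) ^ 3" "(q ^ 3) ^ n = (q ^ n) ^ 3" for n
    by (simp_all add: mult.commute flip: power_mult)
  \<comment> \<open>Applied with \<open>z = q^(2n+1)\<close>: extending the denominator by the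
    factor \<open>1 + z ^ 3\<close> costs the weight \<open>1 - z + z^2\<close>.\<close>
  have frac: "A / (B * C * (1 + z)) * s * t = A / (B * (C * (1 + z ^ 3))) * s * t * (1 - z + z\<^sup>2)"
    if "1 - z + z\<^sup>2 \<noteq> 0" for A B C z s t :: complex
  proof -
    have "1 + z ^ 3 = (1 + z) * (1 - z + z\<^sup>2)"
      by algebra
    thus ?thesis using that by (simp add: mult_ac)
  qed
  have id1: "qpoch q (q^2) n * qpoch (- (q^2)) (q^4) n
           / (qpoch (q^4) (q^4) n * qpoch (- (q^3)) (q^6) n * (1 + q ^ (2*n + 1))) * (-1) ^ n * q ^ (n^2 + 2*n)
      = qpoch q (q\<^sup>2) n * qpoch (- (q\<^sup>2)) (q ^ 4) n / (qpoch (q ^ 4) (q ^ 4) n * qpoch (- (q ^ 3)) (q ^ 6) (n + 1))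
       * (- 1) ^ n * q ^ (n\<^sup>2 + 2 * n) * (1 - q * (q\<^sup>2) ^ n + (q * (q\<^sup>2) ^ n)\<^sup>2)" for n
  proof -
    have "norm ((q\<^sup>2) ^ n) \<le> 1"
      using assms by (intro norm_pow_le_one) simp
    hence c: "1 - q * (q\<^sup>2) ^ n + (q * (q\<^sup>2) ^ n)\<^sup>2 \<noteq> 0"
      using cyclotomic3_neq_0[OF assms, of "- ((q\<^sup>2) ^ n)"] by simp
    have s: "qpoch (- (q ^ 3)) (q ^ 6) (n + 1) = qpoch (- (q ^ 3)) (q ^ 6) n * (1 + (q * (q\<^sup>2) ^ n) ^ 3)"
      by (simp add: qpoch_Suc y power_mult_distrib)
    show ?thesis
      unfolding y(1) s by (rule frac[OF c])
  qed
  have id2: "qpoch q (q^2) n * qpoch (- (q^2)) (q^4) n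
           / (qpoch (q^4) (q^4) n * qpoch (- (q^3)) (q^6) (n + 1)) * (-1) ^ n * q ^ (n^2 + 4*n)
      = qpoch q (q\<^sup>2) n * qpoch (- (q\<^sup>2)) (q ^ 4) n / (qpoch (q ^ 4) (q ^ 4) n * qpoch (- (q ^ 3)) (q ^ 6) (n + 1))
       * (- 1) ^ n * q ^ (n\<^sup>2 + 2 * n) * (q\<^sup>2) ^ n" for n
  proof -
    have "n\<^sup>2 + 4 * n = (n\<^sup>2 + 2 * n) + 2 * n" by simp
    hence "q ^ (n\<^sup>2 + 4 * n) = q ^ (n\<^sup>2 + 2 * n) * (q\<^sup>2) ^ n"
      by (simp only: power_add power_mult)
    thus ?thesis by simp
  qed
  let ?b = "\<lambda>n. qpoch (- q) q n * qpoch (- (q\<^sup>2)) (q\<^sup>2) n / (qpoch q (q\<^sup>2) (n + 1) * qpoch (q ^ 3) (q ^ 3) (n + 1))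
       * q ^ ((n\<^sup>2 + 3 * n) div 2)"
  have id3: "qpoch (- q) q n * qpoch (- (q^2)) (q^2) n
           / (qpoch q (q^2) (n + 1) * qpoch (q^3) (q^3) (n + 1)) * q ^ ((n^2 + 5*n) div 2) = ?b n * q ^ n" for n
  proof -
    have "n\<^sup>2 + 5 * n = (n\<^sup>2 + 3 * n) + n * 2" by simp
    hence "(n\<^sup>2 + 5 * n) div 2 = (n\<^sup>2 + 3 * n) div 2 + n"
      by (simp only: div_mult_self1)
    thus ?thesis by (simp add: power_add)
  qed
  \<comment> \<open>The summation starts at 1, so \<open>n = m + 1\<close>; extending
    \<open>(q^3;q^3)_m\<close> to index \<open>m + 1\<close> turns \<open>1 - q ^ n\<close> into the
    weight \<open>1 + y + y^2\<close> with \<open>y = q ^ n\<close>.\<close>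
  have id4: "(let n = m + 1 in qpoch (- q) q (n - 1) * qpoch (- (q^2)) (q^2) (n - 1)
           / (qpoch (q^3) (q^3) (n - 1) * qpoch q (q^2) n * (1 - q ^ n)) * q ^ (n * (n + 1) div 2))
      = q * ?b m * (1 + q * q ^ m + (q * q ^ m)\<^sup>2)" for m
  proof -
    have "(m + 1) * (m + 1 + 1) = (m\<^sup>2 + 3 * m) + 1 * 2"
      by (simp add: power2_eq_square)
    hence "(m + 1) * (m + 1 + 1) div 2 = (m\<^sup>2 + 3 * m) div 2 + 1"
      by (simp only: div_mult_self1)
    hence p: "q ^ ((m + 1) * (m + 1 + 1) div 2) = q * q ^ ((m\<^sup>2 + 3 * m) div 2)"
      by (simp only: power_add power_one_right mult.commute)
    have c: "1 - q ^ 3 * (q ^ 3) ^ m = (1 - q ^ (m + 1)) * (1 + q * q ^ m + (q * q ^ m)\<^sup>2)"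
    proof -
      have "1 - q ^ 3 * x ^ 3 = (1 - x * q) * (1 + q * x + (q * x)\<^sup>2)" for x
        by algebra
      thus ?thesis by (simp only: y(3) power_add power_one_right)
    qed
    have "norm (q ^ m) \<le> 1" using assms by simp
    hence n: "1 + q * q ^ m + (q * q ^ m)\<^sup>2 \<noteq> 0"
      by (rule cyclotomic3_neq_0[OF assms])
    have g: "A / (B * C * z) * (q * t) = q * (A / (C * (B * (z * v))) * t) * v" if "v \<noteq> 0" for A B C z t v :: complex
      using that by (simp add: mult_ac)
    have s: "qpoch (q ^ 3) (q ^ 3) (m + 1) = qpoch (q ^ 3) (q ^ 3) m * ((1 - q ^ (m + 1)) * (1 + q * q ^ m + (q * q ^ m)\<^sup>2))"
      unfolding c[symmetric] by (simp add: qpoch_Suc)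
    show ?thesis
      unfolding Let_def p s add_diff_cancel_right' using n by (simp only: g not_False_eq_True)
  qed
  \<comment> \<open>The stated product is longer than the one obtained:
    \<open>J_{1,12} J_{5,12}\<close>, \<open>J_{2,12}\<close> and \<open>J_{3,12}\<close> are
    themselves quotients of \<open>P\<close>, and most of it cancels.\<close>
  have rhs3: "J q 8 * (J q 12)^5 * J2 q 2 24 / (J q 4 * J q 6 * J2 q 1 12 * J2 q 2 12 * (J2 q 3 12)^2 * J2 q 5 12)
      = J q 6 * J q 8 * J2 q 2 24 / (J q 1 * J q 3 * J q 12)"
  proof -
    have pw: "norm (q ^ n) < 1" if "n > 0" for n
      using assms that by (rule norm_power_less_one)
    have nz: "P q \<noteq> 0" "P (q\<^sup>2) \<noteq> 0" "P (q ^ 3) \<noteq> 0" "P (q ^ 4) \<noteq> 0" "P (q ^ 6) \<noteq> 0" "P (q ^ 12) \<noteq> 0"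
      by (rule P_nonzero; use assms pw in simp)+
    have j15: "J2 q 1 12 * J2 q 5 12 = P q * P (q ^ 6) / (P (q\<^sup>2) * P (q ^ 3)) * (P (q ^ 12))\<^sup>2"
    proof -
      have "J2 q 1 12 * J2 q 5 12 = ((qpoch_inf q (q ^ 12) * qpoch_inf (q ^ 11) (q ^ 12))
          * (qpoch_inf (q ^ 5) (q ^ 12) * qpoch_inf (q ^ 7) (q ^ 12))) * (P (q ^ 12))\<^sup>2"
        by (simp add: J2_def P_def power2_eq_square mult_ac)
      thus ?thesis
        unfolding qpoch_15_mod_12[OF assms] .
    qed
    have j3: "J2 q 3 12 = P (q ^ 3) / P (q ^ 6) * P (q ^ 12)"
      using qpoch_3_mod_12[OF assms] by (simp add: J2_def P_def)
    have j2: "J2 q 2 12 = P (q\<^sup>2) * P (q ^ 12) / (P (q ^ 4) * P (q ^ 6)) * P (q ^ 12)"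
      using qpoch_2_mod_12[OF assms] by (simp add: J2_def P_def)
    have "J q 4 * J q 6 * J2 q 1 12 * J2 q 2 12 * (J2 q 3 12)^2 * J2 q 5 12
        = J q 4 * J q 6 * (J2 q 1 12 * J2 q 5 12) * J2 q 2 12 * (J2 q 3 12)^2"
      by (simp only: mult_ac)
    also have "\<dots> = P q * P (q ^ 3) * P (q ^ 12) ^ 6 / P (q ^ 6)"
    proof -
      have "p4 * p6 * (p1 * p6 / (p2 * p3) * p12\<^sup>2) * (p2 * p12 / (p4 * p6) * p12) * (p3 / p6 * p12)\<^sup>2 = p1 * p3 * p12 ^ 6 / p6"
        if "p1 \<noteq> 0" "p2 \<noteq> 0" "p3 \<noteq> 0" "p4 \<noteq> 0" "p6 \<noteq> 0" "p12 \<noteq> 0" for p1 p2 p3 p4 p6 p12 :: complex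
        using that by (simp add: field_simps power2_eq_square power_numeral_reduce)
      from this[OF nz] show ?thesis
        unfolding j15 j3 j2 J_eq_P .
    qed
    finally have D: "J q 4 * J q 6 * J2 q 1 12 * J2 q 2 12 * (J2 q 3 12)^2 * J2 q 5 12
        = P q * P (q ^ 3) * P (q ^ 12) ^ 6 / P (q ^ 6)" .
    have "p8 * p12 ^ 5 * l / (p1 * p3 * p12 ^ 6 / p6) = p6 * p8 * l / (p1 * p3 * p12)"
      if "p1 \<noteq> 0" "p3 \<noteq> 0" "p6 \<noteq> 0" "p12 \<noteq> 0" for p1 p3 p6 p8 p12 l :: complex
      using that by (simp add: field_simps power_numeral_reduce)
    from this[OF nz(1,3,5,6)] show ?thesis
      unfolding D unfolding J_eq_P power_one_right .
  qed
  show ?thesis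
    unfolding id1 id2 id3 id4 rhs3
    using series12(1,2)[OF q] series34[OF q] by blast
qed

end
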